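(* Let $n\ge 3$ be an integer and let $H$ be a group generated by $2$ elements. Then the full box space $\Box_f H$ is not coarsely equivalent to the full box space $\Box_f \mathbb{Z}^n$.
   Context: Full box space: for a finitely generated group $G$ with a fixed finite generating set $S$, the full box space $\Box_f G$ is the metrized disjoint union $\coprod_N G/N$ over all finite index normal subgroups $N\lhd G$ ($G$ is not required to be residually finite). Each component $G/N$ carries the word metric $d_{G/N}$ coming from the image of $S$; if $x\in G/N$ and $y\in G/N$ then $d(x,y)=d_{G/N}(x,y)$, and if $x\in G/N$, $y\in G/M$ with $N\neq M$ then $d(x,y)=\operatorname{diam}(G/N)+\operatorname{diam}(G/M)$. Coarse equivalence: for metric spaces $(X,d_X)$ and $(Y,d_Y)$, a map $f\colon X\to Y$ is a coarse equivalence if $f(X)$ is $C$-dense in $Y$ for some constant $C$ (every point of $Y$ is within distance $C$ of $f(X)$) and, for any two sequences $(x_n)_n$, $(y_n)_n$ in $X$, $d_X(x_n,y_n)\to+\infty$ if and only if $d_Y(f(x_n),f(y_n))\to+\infty$. Two spaces are coarsely equivalent if there is a coarse equivalence between them. *)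

theory Defs
  imports "HOL-Analysis.Abstract_Metric_Spaces" "HOL-Algebra.Product_Groups"
begin

section \<open>Word metrics\<close>

definition finite_generating_set :: "('a, 'b) monoid_scheme \<Rightarrow> 'a set \<Rightarrow> bool" where
  "finite_generating_set G S \<longleftrightarrow> finite S \<and> S \<subseteq> carrier G \<and> generate G S = carrier G"

definition word_length :: "('a, 'b) monoid_scheme \<Rightarrow> 'a set \<Rightarrow> 'a \<Rightarrow> nat" where
  "word_length G S g =
     (LEAST k. \<exists>ws. length ws = k \<and> set ws \<subseteq> S \<union> m_inv G ` S
                   \<and> foldr (\<otimes>\<^bsub>G\<^esub>) ws \<one>\<^bsub>G\<^esub> = g)"

definition word_dist :: "('a, 'b) monoid_scheme \<Rightarrow> 'a set \<Rightarrow> 'a \<Rightarrow> 'a \<Rightarrow> real" where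
  "word_dist G S x y = real (word_length G S (inv\<^bsub>G\<^esub> x \<otimes>\<^bsub>G\<^esub> y))"

definition word_diam :: "('a, 'b) monoid_scheme \<Rightarrow> 'a set \<Rightarrow> real" where
  "word_diam G S = Sup {word_dist G S x y | x y. x \<in> carrier G \<and> y \<in> carrier G}"


section \<open>Full box spaces\<close>

definition fin_index_normal :: "('a, 'b) monoid_scheme \<Rightarrow> 'a set set" where
  "fin_index_normal G = {N. N \<lhd> G \<and> finite (rcosets\<^bsub>G\<^esub> N)}"

definition quot_image :: "('a, 'b) monoid_scheme \<Rightarrow> 'a set \<Rightarrow> 'a set \<Rightarrow> 'a set set" where
  "quot_image G S N = (\<lambda>s. N #>\<^bsub>G\<^esub> s) ` S"

text \<open>A point of the disjoint union is a pair \<open>(N, x)\<close> with \<open>x\<close> an element of \<open>G/N\<close>.\<close>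

definition box_points :: "('a, 'b) monoid_scheme \<Rightarrow> ('a set \<times> 'a set) set" where
  "box_points G = (SIGMA N : fin_index_normal G. carrier (G Mod N))"

definition box_dist ::
  "('a, 'b) monoid_scheme \<Rightarrow> 'a set \<Rightarrow> 'a set \<times> 'a set \<Rightarrow> 'a set \<times> 'a set \<Rightarrow> real" where
  "box_dist G S p q =
     (if fst p = fst q
      then word_dist (G Mod fst p) (quot_image G S (fst p)) (snd p) (snd q)
      else word_diam (G Mod fst p) (quot_image G S (fst p))
         + word_diam (G Mod fst q) (quot_image G S (fst q)))"

text \<open>The distance is set to \<open>0\<close> off the carrier because \<^locale>\<open>Metric_space\<close> demands symmetry
  and nonnegativity of the distance on the whole type.  The lemmas \<open>mspace_full_box_space\<close> and
  \<open>mdist_full_box_space\<close> below show that the carrier and the distance are the intended ones.\<close>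

definition full_box_space ::
  "('a, 'b) monoid_scheme \<Rightarrow> 'a set \<Rightarrow> ('a set \<times> 'a set) metric" where
  "full_box_space G S =
     metric (box_points G,
             \<lambda>p q. if p \<in> box_points G \<and> q \<in> box_points G then box_dist G S p q else 0)"


section \<open>Coarse equivalence\<close>

definition coarse_equivalence :: "'a metric \<Rightarrow> 'b metric \<Rightarrow> ('a \<Rightarrow> 'b) \<Rightarrow> bool" where
  "coarse_equivalence X Y f \<longleftrightarrow>
     f ` mspace X \<subseteq> mspace Y \<and>
     (\<exists>C::real. \<forall>y\<in>mspace Y. \<exists>x\<in>mspace X. mdist Y y (f x) \<le> C) \<and>
     (\<forall>x x'. range x \<subseteq> mspace X \<longrightarrow> range x' \<subseteq> mspace X \<longrightarrow>
        (filterlim (\<lambda>k::nat. mdist X (x k) (x' k)) at_top sequentially \<longleftrightarrow>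
         filterlim (\<lambda>k. mdist Y (f (x k)) (f (x' k))) at_top sequentially))"

definition coarsely_equivalent :: "'a metric \<Rightarrow> 'b metric \<Rightarrow> bool" where
  "coarsely_equivalent X Y \<longleftrightarrow> (\<exists>f. coarse_equivalence X Y f)"


section \<open>The group \<open>\<int>\<^sup>n\<close>\<close>

definition int_power_group :: "nat \<Rightarrow> (nat \<Rightarrow> int) monoid" where
  "int_power_group n = product_group {..<n} (\<lambda>_. integer_group)"

lemma group_int_power_group: "group (int_power_group n)"
  by (simp add: int_power_group_def)


section \<open>The full box space is a metric space\<close>

definition is_word :: "('a, 'b) monoid_scheme \<Rightarrow> 'a set \<Rightarrow> 'a list \<Rightarrow> 'a \<Rightarrow> bool" where
  "is_word G S ws g \<longleftrightarrow> set ws \<subseteq> S \<union> m_inv G ` S \<and> foldr (\<otimes>\<^bsub>G\<^esub>) ws \<one>\<^bsub>G\<^esub> = g"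

lemma word_length_eq: "word_length G S g = (LEAST k. \<exists>ws. length ws = k \<and> is_word G S ws g)"
  unfolding word_length_def is_word_def ..

lemma word_length_le: "is_word G S ws g \<Longrightarrow> word_length G S g \<le> length ws"
  unfolding word_length_eq by (rule Least_le) blast

context group
begin

lemma foldr_mult_append:
  assumes "set us \<subseteq> carrier G" "set ws \<subseteq> carrier G"
  shows "foldr (\<otimes>) ws \<one> \<in> carrier G"
    and "foldr (\<otimes>) (us @ ws) \<one> = foldr (\<otimes>) us \<one> \<otimes> foldr (\<otimes>) ws \<one>"
proof -
  have cl: "foldr (\<otimes>) vs \<one> \<in> carrier G" if "set vs \<subseteq> carrier G" for vs
    using that by (induction vs) auto
  show "foldr (\<otimes>) ws \<one> \<in> carrier G" using assms cl by blast
  show "foldr (\<otimes>) (us @ ws) \<one> = foldr (\<otimes>) us \<one> \<otimes> foldr (\<otimes>) ws \<one>"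
    using assms(1)
  proof (induction us)
    case Nil
    then show ?case using cl[OF assms(2)] by simp
  next
    case (Cons u us)
    then show ?case using cl[OF assms(2)] cl[of us] by (simp add: m_assoc)
  qed
qed

lemma letters_closed: "S \<subseteq> carrier G \<Longrightarrow> S \<union> m_inv G ` S \<subseteq> carrier G"
  by auto

lemma is_word_closed: "S \<subseteq> carrier G \<Longrightarrow> is_word G S ws g \<Longrightarrow> g \<in> carrier G"
  using letters_closed[of S] foldr_mult_append(1)[of "[]" ws] unfolding is_word_def
  by (metis empty_set empty_subsetI subset_trans)

lemma is_word_append:
  assumes "S \<subseteq> carrier G" "is_word G S us g" "is_word G S ws h"
  shows "is_word G S (us @ ws) (g \<otimes> h)"
proof -
  have "set us \<subseteq> carrier G" "set ws \<subseteq> carrier G"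
    using assms letters_closed[of S] unfolding is_word_def by blast+
  then show ?thesis
    using assms(2,3) foldr_mult_append(2)[of us ws] unfolding is_word_def by simp
qed

lemma is_word_single:
  assumes "S \<subseteq> carrier G" "s \<in> S \<union> m_inv G ` S"
  shows "is_word G S [s] s"
  using assms letters_closed[of S] unfolding is_word_def by auto

lemma is_word_inv:
  assumes "S \<subseteq> carrier G" "is_word G S ws g"
  shows "\<exists>us. length us = length ws \<and> is_word G S us (inv g)"
  using assms(2)
proof (induction ws arbitrary: g)
  case Nil
  then show ?case by (auto simp: is_word_def)
next
  case (Cons w ws)
  let ?h = "foldr (\<otimes>) ws \<one>"
  have w: "w \<in> S \<union> m_inv G ` S" and h: "is_word G S ws ?h" and g: "g = w \<otimes> ?h"
    using Cons.prems by (auto simp: is_word_def)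
  obtain us where us: "length us = length ws" "is_word G S us (inv ?h)"
    using Cons.IH[OF h] by blast
  have wc: "w \<in> carrier G" "?h \<in> carrier G"
    using w letters_closed[OF assms(1)] is_word_closed[OF assms(1) h] by auto
  have "inv w \<in> S \<union> m_inv G ` S"
    using w assms(1) by auto
  then have "is_word G S (us @ [inv w]) (inv ?h \<otimes> inv w)"
    using is_word_append[OF assms(1) us(2)] is_word_single[OF assms(1)] by blast
  moreover have "inv g = inv ?h \<otimes> inv w"
    using wc by (simp add: g inv_mult_group)
  ultimately show ?case
    using us(1) by (intro exI[of _ "us @ [inv w]"]) simp
qed

lemma is_word_exists:
  assumes "S \<subseteq> carrier G" "g \<in> generate G S"
  shows "\<exists>ws. is_word G S ws g"
  using assms(2)
proof (induction rule: generate.induct)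
  case one
  show ?case by (rule exI[of _ "[]"]) (simp add: is_word_def)
next
  case (incl h)
  then show ?case using is_word_single[OF assms(1)] by blast
next
  case (inv h)
  then show ?case using is_word_single[OF assms(1)] by blast
next
  case (eng h1 h2)
  then show ?case using is_word_append[OF assms(1)] by blast
qed

context
  fixes S
  assumes S: "S \<subseteq> carrier G" and gen: "generate G S = carrier G"
begin

lemma word_length_attained:
  assumes "g \<in> carrier G"
  shows "\<exists>ws. length ws = word_length G S g \<and> is_word G S ws g"
  unfolding word_length_eq
  by (rule LeastI_ex) (use is_word_exists[OF S] assms gen in blast)

lemma word_length_0:
  assumes "g \<in> carrier G"
  shows "word_length G S g = 0 \<longleftrightarrow> g = \<one>"
proof
  assume "word_length G S g = 0"
  then show "g = \<one>" using word_length_attained[OF assms] by (auto simp: is_word_def)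
next
  assume "g = \<one>"
  then show "word_length G S g = 0"
    using word_length_le[of G S "[]" g] by (simp add: is_word_def)
qed

lemma word_length_inv_le:
  assumes "g \<in> carrier G"
  shows "word_length G S (inv g) \<le> word_length G S g"
  using word_length_attained[OF assms] is_word_inv[OF S] word_length_le by metis

lemma word_length_mult:
  assumes "g \<in> carrier G" "h \<in> carrier G"
  shows "word_length G S (g \<otimes> h) \<le> word_length G S g + word_length G S h"
  using word_length_attained[OF assms(1)] word_length_attained[OF assms(2)]
    is_word_append[OF S] word_length_le length_append by metis

lemma word_dist_0:
  assumes "x \<in> carrier G" "y \<in> carrier G"
  shows "word_dist G S x y = 0 \<longleftrightarrow> x = y"
proof -
  have "word_dist G S x y = 0 \<longleftrightarrow> inv x \<otimes> y = \<one>"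
    using assms by (simp add: word_dist_def word_length_0)
  also have "\<dots> \<longleftrightarrow> x = y"
    using assms by (metis inv_closed inv_equality inv_inv l_inv)
  finally show ?thesis .
qed

lemma word_dist_commute:
  assumes "x \<in> carrier G" "y \<in> carrier G"
  shows "word_dist G S x y = word_dist G S y x"
proof -
  have le: "word_length G S (inv v \<otimes> u) \<le> word_length G S (inv u \<otimes> v)"
    if "u \<in> carrier G" "v \<in> carrier G" for u v
    using word_length_inv_le[of "inv u \<otimes> v"] that by (simp add: inv_mult_group)
  show ?thesis
    using le[of x y] le[of y x] assms by (simp add: word_dist_def)
qed

lemma word_dist_triangle:
  assumes "x \<in> carrier G" "y \<in> carrier G" "z \<in> carrier G"
  shows "word_dist G S x z \<le> word_dist G S x y + word_dist G S y z"
proof -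
  have "inv x \<otimes> z = (inv x \<otimes> y) \<otimes> (inv y \<otimes> z)"
    using assms by (metis inv_closed inv_solve_left m_assoc m_closed)
  then show ?thesis
    using word_length_mult[of "inv x \<otimes> y" "inv y \<otimes> z"] assms
    by (simp add: word_dist_def flip: of_nat_add)
qed

end

end

lemma word_dist_nonneg: "0 \<le> word_dist G S x y"
  by (simp add: word_dist_def)

lemma word_dist_le_diam:
  assumes "finite (carrier G)" "x \<in> carrier G" "y \<in> carrier G"
  shows "word_dist G S x y \<le> word_diam G S"
proof -
  have eq: "{word_dist G S x y | x y. x \<in> carrier G \<and> y \<in> carrier G}
      = (\<lambda>(x, y). word_dist G S x y) ` (carrier G \<times> carrier G)"
    by auto
  have "finite {word_dist G S x y | x y. x \<in> carrier G \<and> y \<in> carrier G}"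
    unfolding eq using assms(1) by blast
  then show ?thesis
    unfolding word_diam_def using assms(2,3) by (intro cSup_upper bdd_above_finite) auto
qed

lemma quot_generating:
  assumes "group G" "finite_generating_set G S" "N \<in> fin_index_normal G"
  shows "group (G Mod N)" "quot_image G S N \<subseteq> carrier (G Mod N)"
    "generate (G Mod N) (quot_image G S N) = carrier (G Mod N)" "finite (carrier (G Mod N))"
proof -
  interpret normal N G using assms(3) by (simp add: fin_index_normal_def)
  have S: "S \<subseteq> carrier G" "generate G S = carrier G"
    using assms(2) by (auto simp: finite_generating_set_def)
  show grp: "group (G Mod N)" by (rule factorgroup_is_group)
  have c: "carrier (G Mod N) = (\<lambda>s. N #>\<^bsub>G\<^esub> s) ` carrier G"
    by (auto simp: FactGroup_def RCOSETS_def)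
  show "quot_image G S N \<subseteq> carrier (G Mod N)"
    unfolding c quot_image_def using S(1) by blast
  interpret h: group_hom G "G Mod N" "\<lambda>s. N #>\<^bsub>G\<^esub> s"
    unfolding group_hom_def group_hom_axioms_def
    using r_coset_hom_Mod grp group_axioms by blast
  show "generate (G Mod N) (quot_image G S N) = carrier (G Mod N)"
    unfolding quot_image_def c using h.generate_img[OF S(1)] S(2) by simp
  show "finite (carrier (G Mod N))"
    using assms(3) by (simp add: fin_index_normal_def FactGroup_def)
qed

lemma Metric_space_box:
  assumes G: "group G" and S: "finite_generating_set G S"
  shows "Metric_space (box_points G)
    (\<lambda>p q. if p \<in> box_points G \<and> q \<in> box_points G then box_dist G S p q else 0)"
proof -
  let ?D = "\<lambda>N. word_diam (G Mod N) (quot_image G S N)"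
  let ?d = "\<lambda>N. word_dist (G Mod N) (quot_image G S N)"
  let ?c = "\<lambda>N. carrier (G Mod N)"
  note q = quot_generating[OF G S]
  have pts: "p \<in> box_points G \<longleftrightarrow> fst p \<in> fin_index_normal G \<and> snd p \<in> ?c (fst p)" for p
    by (cases p) (simp add: box_points_def)
  have le: "?d N x y \<le> ?D N" if "N \<in> fin_index_normal G" "x \<in> ?c N" "y \<in> ?c N" for N x y
    by (rule word_dist_le_diam[OF q(4)[OF that(1)] that(2,3)])
  have sym: "?d N x y = ?d N y x" if "N \<in> fin_index_normal G" "x \<in> ?c N" "y \<in> ?c N" for N x y
    by (rule group.word_dist_commute[OF q(1-3)[OF that(1)] that(2,3)])
  have zero: "?d N x y = 0 \<longleftrightarrow> x = y"
    if "N \<in> fin_index_normal G" "x \<in> ?c N" "y \<in> ?c N" for N x y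
    by (rule group.word_dist_0[OF q(1-3)[OF that(1)] that(2,3)])
  have D0: "0 \<le> ?D N" if "N \<in> fin_index_normal G" for N
  proof -
    have "\<one>\<^bsub>G Mod N\<^esub> \<in> ?c N"
      by (rule monoid.one_closed[OF group.is_monoid[OF q(1)[OF that]]])
    from order_trans[OF word_dist_nonneg le[OF that this this]] show ?thesis .
  qed
  have Dpos: "N = carrier G" if N: "N \<in> fin_index_normal G" "?D N = 0" for N
  proof -
    interpret normal N G using N(1) by (simp add: fin_index_normal_def)
    have one: "\<one>\<^bsub>G Mod N\<^esub> \<in> ?c N"
      by (rule monoid.one_closed[OF group.is_monoid[OF q(1)[OF N(1)]]])
    have "N #>\<^bsub>G\<^esub> g = N" if "g \<in> carrier G" for g
    proof -
      have gc: "N #>\<^bsub>G\<^esub> g \<in> ?c N" using that by (auto simp: FactGroup_def RCOSETS_def)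
      have "?d N \<one>\<^bsub>G Mod N\<^esub> (N #>\<^bsub>G\<^esub> g) = 0"
        using le[OF N(1) one gc] N(2) word_dist_nonneg[of "G Mod N"] by (metis order_antisym)
      then show ?thesis
        using zero[OF N(1) one gc] by simp
    qed
    then show ?thesis
      using rcos_self[OF _ is_subgroup] subset by blast
  qed
  show ?thesis
  proof (unfold_locales, goal_cases)
    case (1 x y)
    show ?case using D0[of "fst x"] D0[of "fst y"] by (simp add: box_dist_def pts word_dist_nonneg)
  next
    case (2 x y)
    show ?case
      using sym[of "fst x" "snd x" "snd y"] by (cases "fst x = fst y") (auto simp: box_dist_def pts)
  next
    case (3 x y)
    show ?case
    proof (cases "fst x = fst y")
      case True
      then show ?thesis
        using 3 zero[of "fst x" "snd x" "snd y"] by (simp add: box_dist_def pts prod_eq_iff)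
    next
      case False
      have "?D (fst x) + ?D (fst y) \<noteq> 0"
        using False 3 Dpos[of "fst x"] Dpos[of "fst y"] D0[of "fst x"] D0[of "fst y"]
        by (auto simp: pts)
      then show ?thesis using 3 False by (auto simp: box_dist_def)
    qed
  next
    case (4 x y z)
    then have X: "fst x \<in> fin_index_normal G" "snd x \<in> ?c (fst x)"
      and Y: "fst y \<in> fin_index_normal G" "snd y \<in> ?c (fst y)"
      and Z: "fst z \<in> fin_index_normal G" "snd z \<in> ?c (fst z)"
      by (auto simp: pts)
    consider "fst x = fst y" "fst y = fst z" | "fst x = fst y" "fst y \<noteq> fst z"
      | "fst x \<noteq> fst y" "fst y = fst z" | "fst x \<noteq> fst y" "fst y \<noteq> fst z" "fst x = fst z"
      | "fst x \<noteq> fst y" "fst y \<noteq> fst z" "fst x \<noteq> fst z" by blast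
    then have "box_dist G S x z \<le> box_dist G S x y + box_dist G S y z"
    proof cases
      case 1
      then show ?thesis
        using group.word_dist_triangle[OF q(1-3)[OF X(1)]] X Y Z by (simp add: box_dist_def)
    next
      case 2
      then show ?thesis by (simp add: box_dist_def word_dist_nonneg)
    next
      case 3
      then show ?thesis by (simp add: box_dist_def word_dist_nonneg)
    next
      case 4
      then have "box_dist G S x z \<le> ?D (fst x)"
        using le[OF X, of "snd z"] Z(2) by (simp add: box_dist_def)
      moreover have "box_dist G S x y + box_dist G S y z
          = (?D (fst x) + ?D (fst y)) + (?D (fst y) + ?D (fst x))"
        using 4 by (simp add: box_dist_def)
      ultimately show ?thesis
        using D0[OF X(1)] D0[OF Y(1)] by linarith
    next
      case 5
      then show ?thesis using D0[OF Y(1)] by (simp add: box_dist_def)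
    qed
    then show ?case using 4 by simp
  qed
qed

lemma mspace_full_box_space:
  assumes "group G" "finite_generating_set G S"
  shows "mspace (full_box_space G S) = box_points G"
  unfolding full_box_space_def by (rule Metric_space.mspace_metric[OF Metric_space_box[OF assms]])

lemma mdist_full_box_space:
  assumes "group G" "finite_generating_set G S" "p \<in> box_points G" "q \<in> box_points G"
  shows "mdist (full_box_space G S) p q = box_dist G S p q"
  unfolding full_box_space_def Metric_space.mdist_metric[OF Metric_space_box[OF assms(1,2)]]
  using assms(3,4) by simp


section \<open>Coarse equivalence is symmetric\<close>

lemma filterlim_at_top_bounded_diff:
  fixes u v :: "nat \<Rightarrow> real"
  assumes "filterlim u at_top sequentially" "\<And>k. u k \<le> v k + c"
  shows "filterlim v at_top sequentially"
proof -
  have "filterlim (\<lambda>k. - c + u k) at_top sequentially"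
    by (rule filterlim_tendsto_add_at_top[OF tendsto_const assms(1)])
  then show ?thesis
    by (rule filterlim_at_top_mono) (use assms(2) in \<open>simp add: algebra_simps\<close>)
qed

lemma coarsely_equivalent_sym:
  assumes "coarsely_equivalent X Y"
  shows "coarsely_equivalent Y X"
proof -
  obtain f where ce: "coarse_equivalence X Y f"
    using assms unfolding coarsely_equivalent_def ..
  then obtain C where f: "f ` mspace X \<subseteq> mspace Y"
    and C: "\<forall>y\<in>mspace Y. \<exists>x\<in>mspace X. mdist Y y (f x) \<le> C"
    and lim: "\<And>x x'. range x \<subseteq> mspace X \<Longrightarrow> range x' \<subseteq> mspace X \<Longrightarrow>
        (filterlim (\<lambda>k::nat. mdist X (x k) (x' k)) at_top sequentially \<longleftrightarrow>
         filterlim (\<lambda>k. mdist Y (f (x k)) (f (x' k))) at_top sequentially)"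
    unfolding coarse_equivalence_def by blast
  obtain g where g: "\<And>y. y \<in> mspace Y \<Longrightarrow> g y \<in> mspace X"
    and gC: "\<And>y. y \<in> mspace Y \<Longrightarrow> mdist Y y (f (g y)) \<le> C"
    using C by metis
  have fY: "f x \<in> mspace Y" if "x \<in> mspace X" for x using f that by blast
  have "\<exists>C'. \<forall>x\<in>mspace X. mdist X x (g (f x)) \<le> C'"
  proof (rule ccontr)
    assume "\<not> ?thesis"
    then have "\<forall>k::nat. \<exists>x\<in>mspace X. real k < mdist X x (g (f x))"
      by (meson not_le)
    then obtain x where x: "\<And>k. x k \<in> mspace X" "\<And>k::nat. real k < mdist X (x k) (g (f (x k)))"
      by metis
    have "filterlim (\<lambda>k. mdist X (x k) (g (f (x k)))) at_top sequentially"
      by (rule filterlim_at_top_mono[OF filterlim_real_sequentially])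
        (use x(2) in \<open>simp add: less_imp_le\<close>)
    then have "filterlim (\<lambda>k. mdist Y (f (x k)) (f (g (f (x k))))) at_top sequentially"
      using lim[of x "\<lambda>k. g (f (x k))"] x(1) g fY by blast
    then have "eventually (\<lambda>k. C + 1 \<le> mdist Y (f (x k)) (f (g (f (x k))))) sequentially"
      by (simp add: filterlim_at_top)
    then obtain k where "C + 1 \<le> mdist Y (f (x k)) (f (g (f (x k))))"
      by (meson eventually_sequentially order_refl)
    moreover have "mdist Y (f (x k)) (f (g (f (x k)))) \<le> C"
      using gC fY x(1) by blast
    ultimately show False by linarith
  qed
  then have dense: "\<exists>C'. \<forall>x\<in>mspace X. \<exists>y\<in>mspace Y. mdist X x (g y) \<le> C'"
    using fY by meson
  have limg: "filterlim (\<lambda>k. mdist Y (y k) (y' k)) at_top sequentially \<longleftrightarrow>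
      filterlim (\<lambda>k. mdist X (g (y k)) (g (y' k))) at_top sequentially"
    if "range y \<subseteq> mspace Y" "range y' \<subseteq> mspace Y" for y y' :: "nat \<Rightarrow> _"
  proof -
    have yY: "y k \<in> mspace Y" "y' k \<in> mspace Y" for k using that by auto
    have m: "g (y k) \<in> mspace X" "g (y' k) \<in> mspace X"
        "f (g (y k)) \<in> mspace Y" "f (g (y' k)) \<in> mspace Y" for k
      using yY g fY by blast+
    have a: "mdist Y (y k) (y' k) \<le> mdist Y (f (g (y k))) (f (g (y' k))) + 2 * C" for k
      using mdist_triangle[OF yY(1) m(3) yY(2), of k k k] mdist_triangle[OF m(3) m(4) yY(2), of k k k]
        gC[OF yY(1), of k] gC[OF yY(2), of k] mdist_commute[of Y "f (g (y' k))" "y' k"]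
      by linarith
    have b: "mdist Y (f (g (y k))) (f (g (y' k))) \<le> mdist Y (y k) (y' k) + 2 * C" for k
      using mdist_triangle[OF m(3) yY(1) m(4), of k k k] mdist_triangle[OF yY(1) yY(2) m(4), of k k k]
        gC[OF yY(1), of k] gC[OF yY(2), of k] mdist_commute[of Y "f (g (y k))" "y k"]
      by linarith
    have "filterlim (\<lambda>k. mdist Y (y k) (y' k)) at_top sequentially \<longleftrightarrow>
        filterlim (\<lambda>k. mdist Y (f (g (y k))) (f (g (y' k)))) at_top sequentially"
      by (rule iffI) (erule filterlim_at_top_bounded_diff, rule a b)+
    also have "\<dots> \<longleftrightarrow> filterlim (\<lambda>k. mdist X (g (y k)) (g (y' k))) at_top sequentially"
      using lim[of "\<lambda>k. g (y k)" "\<lambda>k. g (y' k)"] m by blast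
    finally show ?thesis .
  qed
  show ?thesis
    unfolding coarsely_equivalent_def coarse_equivalence_def
    using g dense limg by (intro exI[of _ g]) blast
qed

end

theory Submission
  imports Defs "HOL-Library.Function_Algebras" "HOL-Algebra.Multiplicative_Group"
begin

text \<open>
  A coarse equivalence between the box spaces matches every large quotient \<open>\<int>\<^sup>n / M\<close> with a quotient
  \<open>H / N\<close>, with uniform control and different \<open>N\<close> for different \<open>M\<close>.  Take for \<open>M\<close> the
  \<open>l ^ n\<^sup>2\<close> lattices spanned by the rows of \<open>3 n l I + E\<close> with \<open>0 \<le> E < l\<close>.  By the pigeonhole
  principle a positive fraction of the subgroups \<open>N\<close>, for infinitely many \<open>l\<close>, meet a ball of a
  fixed radius in the same set.  Dividing by the intersection of all of these gives a quotient \<open>Q\<close>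
  of \<open>H\<close> in which each image \<open>K\<close> of an \<open>N\<close> misses a large ball, so that the map
  \<open>\<int>\<^sup>n \<rightarrow> Q / K\<close> lifts to \<open>\<int>\<^sup>n \<rightarrow> Q\<close> and restricts to a homomorphism of \<open>M\<close> onto \<open>K\<close>.
  Hence \<open>K\<close> is generated by \<open>n\<close> elements of length \<open>O(l)\<close>, and balls of radius \<open>r\<close> in \<open>Q\<close>
  have \<open>O(r ^ n)\<close> elements.

  If the homomorphism is not injective, \<open>Q\<close> has growth \<open>O(r ^ (n - 1))\<close>.  If \<open>Q\<close> acts on \<open>K\<close> by
  nonscalar matrices, one of the \<open>n\<close> generators of \<open>K\<close> is determined, up to boundedly many
  choices, by the others.  Both leave room only for \<open>O(l ^ (n\<^sup>2 - n))\<close> subgroups \<open>K\<close>.  So \<open>K\<close>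
  is isomorphic to \<open>\<int>\<^sup>n\<close> and \<open>Q\<close> acts on it by signs; a twisted transfer then maps \<open>Q\<close> to \<open>\<int>\<^sup>n\<close>
  by a crossed homomorphism whose image has full rank, although it is spanned by the values at the
  two generators.
\<close>

section \<open>Integer vectors\<close>

text \<open>The count is sharp by design: in a group of growth r ^ n there are O(l ^ (n * n)) tuples
  of n elements of length O(l), and the family consists of l ^ (n * n) lattices spanned by vectors
  of length O(l). Losing a single factor of l is therefore a contradiction, provided that the
  constants do not depend on l. The box spaces only offer a separate finite quotient of
  \<open>H\<close> for each lattice, so the kernels have to be brought into one group; there a
  single kernel with a relation lowers the growth for all of them, and a single torsion-free kernel
  serves as reference for all the others. In the nonscalar case conjugation expresses a nonzero
  multiple of one generator through the rest, and a root is determined by its class modulo that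
  reference kernel, whence the bounded number of choices. In the scalar case the scalars are
  invertible integers, hence signs, and two values of a crossed homomorphism span rank at most 2;
  this is where \<open>n \<ge> 3\<close> enters.\<close>

definition Zvec :: "nat \<Rightarrow> (nat \<Rightarrow> int) set" where
  "Zvec n = {x. \<forall>i\<ge>n. x i = 0}"

definition unit_vec :: "nat \<Rightarrow> nat \<Rightarrow> int" where
  "unit_vec i = (\<lambda>j. of_bool (j = i))"

definition l1_norm :: "nat \<Rightarrow> (nat \<Rightarrow> int) \<Rightarrow> nat" where
  "l1_norm n x = (\<Sum>i<n. nat \<bar>x i\<bar>)"

definition Zbox :: "nat \<Rightarrow> nat \<Rightarrow> (nat \<Rightarrow> int) set" where
  "Zbox n r = {x \<in> Zvec n. \<forall>i<n. \<bar>x i\<bar> \<le> int r}"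

lemma Zvec_closed [simp, intro]:
  "0 \<in> Zvec n" "x \<in> Zvec n \<Longrightarrow> y \<in> Zvec n \<Longrightarrow> x + y \<in> Zvec n"
  "x \<in> Zvec n \<Longrightarrow> y \<in> Zvec n \<Longrightarrow> x - y \<in> Zvec n" "x \<in> Zvec n \<Longrightarrow> - x \<in> Zvec n"
  "i < n \<Longrightarrow> unit_vec i \<in> Zvec n"
  by (auto simp: Zvec_def unit_vec_def)

lemma l1_norm_step:
  assumes "i < n" "0 \<le> x i \<and> y = x + unit_vec i \<or> x i \<le> 0 \<and> y = x - unit_vec i"
  shows "l1_norm n y = Suc (l1_norm n x)"
proof -
  have "l1_norm n y = nat \<bar>y i\<bar> + (\<Sum>j\<in>{..<n}-{i}. nat \<bar>y j\<bar>)"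
    unfolding l1_norm_def using assms(1) by (simp add: sum.remove)
  also have "(\<Sum>j\<in>{..<n}-{i}. nat \<bar>y j\<bar>) = (\<Sum>j\<in>{..<n}-{i}. nat \<bar>x j\<bar>)"
    by (rule sum.cong) (use assms(2) in \<open>auto simp: unit_vec_def\<close>)
  also have "nat \<bar>y i\<bar> = Suc (nat \<bar>x i\<bar>)" using assms(2) by (auto simp: unit_vec_def)
  also have "Suc (nat \<bar>x i\<bar>) + (\<Sum>j\<in>{..<n}-{i}. nat \<bar>x j\<bar>) = Suc (l1_norm n x)"
    unfolding l1_norm_def using assms(1) by (simp add: sum.remove)
  finally show ?thesis .
qed

lemma l1_norm_0_iff: "x \<in> Zvec n \<Longrightarrow> l1_norm n x = 0 \<longleftrightarrow> x = 0"
  by (auto simp: l1_norm_def Zvec_def fun_eq_iff) (meson lessThan_iff not_le)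

lemma l1_norm_le: "x \<in> Zbox n r \<Longrightarrow> l1_norm n x \<le> n * r"
  using sum_mono[of "{..<n}" "\<lambda>i. nat \<bar>x i\<bar>" "\<lambda>_. r"]
  by (simp add: l1_norm_def Zbox_def nat_le_iff)

text \<open>Every step leads away from the origin, so the l1 norm counts the steps and no coordinate
  ever cancels. The first fact turns walks into length bounds, the second keeps supports under
  control.\<close>

lemma Zvec_step_induct [consumes 1, case_names zero up down]:
  assumes "x \<in> Zvec n" "P 0"
    and up: "\<And>x i. x \<in> Zvec n \<Longrightarrow> i < n \<Longrightarrow> 0 \<le> x i \<Longrightarrow> P x \<Longrightarrow> P (x + unit_vec i)"
    and down: "\<And>x i. x \<in> Zvec n \<Longrightarrow> i < n \<Longrightarrow> x i \<le> 0 \<Longrightarrow> P x \<Longrightarrow> P (x - unit_vec i)"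
  shows "P x"
  using assms(1)
proof (induction "l1_norm n x" arbitrary: x)
  case 0
  then show ?case using assms(2) l1_norm_0_iff by metis
next
  case (Suc k)
  then have "x \<noteq> 0" using l1_norm_0_iff[of x n] by auto
  then obtain i where i: "i < n" "x i \<noteq> 0"
    using Suc.prems by (auto simp: Zvec_def fun_eq_iff) (meson not_le)
  show ?case
  proof (cases "0 < x i")
    case True
    let ?y = "x - unit_vec i"
    have y: "?y \<in> Zvec n" "0 \<le> ?y i" using True i(1) Suc.prems by auto (simp add: unit_vec_def)
    have "l1_norm n x = Suc (l1_norm n ?y)"
      using l1_norm_step[OF i(1), of ?y x] y by (simp)
    then have "P ?y" using Suc y by simp
    from up[OF y(1) i(1) y(2) this] show ?thesis by simp
  next
    case False
    let ?y = "x + unit_vec i"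
    have y: "?y \<in> Zvec n" "?y i \<le> 0" using False i Suc.prems by auto (simp add: unit_vec_def)
    have "l1_norm n x = Suc (l1_norm n ?y)"
      using l1_norm_step[OF i(1), of ?y x] y by (simp)
    then have "P ?y" using Suc y by simp
    from down[OF y(1) i(1) y(2) this] show ?thesis by simp
  qed
qed

text \<open>The equivalence serves both directions of an edge at once, so connectedness of the grid
  suffices.\<close>

lemma Zvec_induct [consumes 1, case_names zero step]:
  assumes "x \<in> Zvec n" "P 0"
    and step: "\<And>x i. x \<in> Zvec n \<Longrightarrow> i < n \<Longrightarrow> P x \<longleftrightarrow> P (x + unit_vec i)"
  shows "P x"
  using assms(1)
proof (induction rule: Zvec_step_induct)
  case (up x i)
  then show ?case using step by blast
next
  case (down x i)
  then have "P (x - unit_vec i) \<longleftrightarrow> P (x - unit_vec i + unit_vec i)" by (intro step) auto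
  then show ?case using down(4) by (simp only: diff_add_cancel)
qed (rule assms(2))

lemma Zbox_eq: "bij_betw (\<lambda>x. restrict x {..<n}) (Zbox n r) ({..<n} \<rightarrow>\<^sub>E {- int r..int r})"
proof (rule bij_betw_byWitness[where f' = "\<lambda>y i. if i < n then y i else 0"], goal_cases)
  case 1
  then show ?case by (auto simp: Zbox_def Zvec_def restrict_def fun_eq_iff)
next
  case 2
  then show ?case by (auto simp: PiE_def extensional_def restrict_def fun_eq_iff)
next
  case 3
  show ?case
  proof (intro image_subsetI PiE_I)
    fix x i assume "x \<in> Zbox n r" "i \<in> {..<n}"
    then have "\<bar>x i\<bar> \<le> int r" by (auto simp: Zbox_def)
    then show "restrict x {..<n} i \<in> {- int r..int r}" using \<open>i \<in> {..<n}\<close> by auto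
  qed auto
next
  case 4
  show ?case by (auto simp: Zbox_def Zvec_def abs_le_iff PiE_def Pi_def)
qed

lemma finite_Zbox [simp]: "finite (Zbox n r)"
  using bij_betw_finite[OF Zbox_eq[of n r]] by (simp add: finite_PiE)

lemma card_Zbox: "card (Zbox n r) = (2 * r + 1) ^ n"
  using bij_betw_same_card[OF Zbox_eq[of n r]] by (simp add: card_PiE nat_add_distrib nat_mult_distrib)

section \<open>Balls of a word metric\<close>

text \<open>The radius bounds the length of some word rather than the minimal length, so products,
  inverses and images require no geodesics; \<open>word_length_le_iff\<close> recovers the metric
  ball.\<close>

definition wball :: "('a, 'b) monoid_scheme \<Rightarrow> 'a set \<Rightarrow> nat \<Rightarrow> 'a set" where
  "wball G S r = {g. \<exists>ws. is_word G S ws g \<and> length ws \<le> r}"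

context group
begin

lemma one_in_wball [simp]: "\<one> \<in> wball G S r"
  by (auto simp: wball_def is_word_def intro!: exI[of _ "[]"])

lemma wball_mono: "g \<in> wball G S r \<Longrightarrow> r \<le> s \<Longrightarrow> g \<in> wball G S s"
  unfolding wball_def using le_trans by blast

lemma wball_closed: "S \<subseteq> carrier G \<Longrightarrow> g \<in> wball G S r \<Longrightarrow> g \<in> carrier G"
  unfolding wball_def using is_word_closed by blast

lemma wball_mult:
  assumes "S \<subseteq> carrier G" "g \<in> wball G S r" "h \<in> wball G S s"
  shows "g \<otimes> h \<in> wball G S (r + s)"
proof -
  obtain us vs where "is_word G S us g" "length us \<le> r" "is_word G S vs h" "length vs \<le> s"
    using assms by (auto simp: wball_def)
  then show ?thesis unfolding wball_def
    using is_word_append[OF assms(1)] by (auto intro!: exI[of _ "us @ vs"])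
qed

lemma wball_inv:
  assumes "S \<subseteq> carrier G" "g \<in> wball G S r"
  shows "inv g \<in> wball G S r"
  using is_word_inv[OF assms(1)] assms(2) unfolding wball_def by fastforce

text \<open>Asking for the second factor in the unit ball, instead of for a letter, absorbs the
  empty word.\<close>

lemma wball_Suc:
  assumes "S \<subseteq> carrier G" "g \<in> wball G S (Suc r)"
  obtains u v where "u \<in> wball G S r" "v \<in> wball G S 1" "g = u \<otimes> v"
proof -
  obtain ws where ws: "is_word G S ws g" "length ws \<le> Suc r"
    using assms by (auto simp: wball_def)
  show ?thesis
  proof (cases ws rule: rev_exhaust)
    case Nil
    then have "g = \<one>" using ws by (simp add: is_word_def)
    then show ?thesis using that[of \<one> \<one>] by simp
  next
    case (snoc vs v)
    then have v: "v \<in> S \<union> m_inv G ` S" "set vs \<subseteq> S \<union> m_inv G ` S"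
      using ws by (auto simp: is_word_def)
    then have cl: "set vs \<subseteq> carrier G" "set [v] \<subseteq> carrier G"
      using letters_closed[OF assms(1)] by auto
    have "is_word G S vs (foldr (\<otimes>) vs \<one>)" "is_word G S [v] v"
      using v is_word_single[OF assms(1)] by (auto simp: is_word_def)
    moreover have "g = foldr (\<otimes>) vs \<one> \<otimes> v"
      using ws foldr_mult_append(2)[OF cl] cl snoc unfolding is_word_def by simp
    ultimately show ?thesis
      using that[of "foldr (\<otimes>) vs \<one>" v] ws snoc unfolding wball_def by fastforce
  qed
qed

lemma finite_wball:
  assumes "finite S"
  shows "finite (wball G S r)"
proof -
  have "wball G S r \<subseteq> (\<lambda>ws. foldr (\<otimes>) ws \<one>) ` {ws. set ws \<subseteq> S \<union> m_inv G ` S \<and> length ws \<le> r}"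
    by (auto simp: wball_def is_word_def)
  moreover have "finite {ws. set ws \<subseteq> S \<union> m_inv G ` S \<and> length ws \<le> r}"
    using assms by (intro finite_lists_length_le) auto
  ultimately show ?thesis by (meson finite_imageI finite_subset)
qed

lemma wball_cover:
  assumes "S \<subseteq> carrier G" "generate G S = carrier G" "g \<in> carrier G"
  obtains r where "g \<in> wball G S r"
  using is_word_exists[OF assms(1)] assms(2,3) unfolding wball_def by blast

lemma word_length_le_iff:
  assumes "S \<subseteq> carrier G" "generate G S = carrier G" "g \<in> carrier G"
  shows "word_length G S g \<le> r \<longleftrightarrow> g \<in> wball G S r"
proof
  assume le: "word_length G S g \<le> r"
  obtain ws where "length ws = word_length G S g" "is_word G S ws g"
    using word_length_attained[OF assms] by blast
  then show "g \<in> wball G S r" using le unfolding wball_def by auto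
next
  assume "g \<in> wball G S r"
  then obtain ws where "is_word G S ws g" "length ws \<le> r" unfolding wball_def by blast
  then show "word_length G S g \<le> r" using word_length_le[of G S ws g] by linarith
qed

end

text \<open>Every letter of the image comes from a letter of \<open>G\<close>, so words lift letter
  by letter. This replaces the word metric of a quotient by balls of the group above it.\<close>

lemma (in group_hom) wball_image:
  assumes "S \<subseteq> carrier G"
  shows "wball H (h ` S) r = h ` wball G S r"
proof -
  have letters: "h ` S \<union> m_inv H ` h ` S = h ` (S \<union> m_inv G ` S)"
  proof -
    have "m_inv H ` h ` S = h ` m_inv G ` S"
      unfolding image_image using assms by (intro image_cong) (auto simp: subset_iff)
    then show ?thesis by (simp add: image_Un)
  qed
  have fold: "h (foldr (\<otimes>\<^bsub>G\<^esub>) ws \<one>\<^bsub>G\<^esub>) = foldr (\<otimes>\<^bsub>H\<^esub>) (map h ws) \<one>\<^bsub>H\<^esub>"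
    if "set ws \<subseteq> S \<union> m_inv G ` S" for ws
  proof -
    have "set ws \<subseteq> carrier G" using that G.letters_closed[OF assms] by blast
    then show ?thesis
    proof (induction ws)
      case (Cons w ws)
      then show ?case using G.foldr_mult_append(1)[of "[]" ws] by simp
    qed simp
  qed
  have "y \<in> h ` wball G S r" if y: "y \<in> wball H (h ` S) r" for y
  proof -
    obtain vs where vs: "set vs \<subseteq> h ` (S \<union> m_inv G ` S)" "foldr (\<otimes>\<^bsub>H\<^esub>) vs \<one>\<^bsub>H\<^esub> = y" "length vs \<le> r"
      using y letters by (auto simp: wball_def is_word_def)
    obtain ws where ws: "set ws \<subseteq> S \<union> m_inv G ` S" "vs = map h ws"
    proof -
      have "vs \<in> lists (h ` (S \<union> m_inv G ` S))" using vs by auto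
      then have "vs \<in> map h ` lists (S \<union> m_inv G ` S)" by (simp only: lists_image)
      then show ?thesis using that by auto
    qed
    have "foldr (\<otimes>\<^bsub>G\<^esub>) ws \<one>\<^bsub>G\<^esub> \<in> wball G S r"
      using ws vs unfolding wball_def is_word_def by auto
    moreover have "y = h (foldr (\<otimes>\<^bsub>G\<^esub>) ws \<one>\<^bsub>G\<^esub>)" using fold ws vs by simp
    ultimately show ?thesis by blast
  qed
  moreover have "h g \<in> wball H (h ` S) r" if g: "g \<in> wball G S r" for g
  proof -
    obtain ws where ws: "set ws \<subseteq> S \<union> m_inv G ` S" "foldr (\<otimes>\<^bsub>G\<^esub>) ws \<one>\<^bsub>G\<^esub> = g" "length ws \<le> r"
      using g unfolding wball_def is_word_def by blast
    then have "is_word H (h ` S) (map h ws) (h g)"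
      using fold[OF ws(1)] letters unfolding is_word_def by auto
    then show ?thesis using ws unfolding wball_def by auto
  qed
  ultimately show ?thesis by blast
qed

section \<open>Lifting to a coarse cover\<close>

text \<open>The step equation is solved by two recursions starting at 0; to the left it is run
  backwards with the inverses of \<open>g t\<close>.\<close>

lemma (in group) int_line_exists:
  assumes "u \<in> carrier G" and g: "\<And>t::int. g t \<in> carrier G"
  obtains h where "h 0 = u" "\<And>t. h t \<in> carrier G" "\<And>t::int. h (t + 1) = h t \<otimes> g t"
proof -
  define P where "P = rec_nat u (\<lambda>k y. y \<otimes> g (int k))"
  define N where "N = rec_nat u (\<lambda>k y. y \<otimes> inv (g (- int k - 1)))"
  define h where "h t = (if 0 \<le> t then P (nat t) else N (nat (- t)))" for t :: int
  have P: "P 0 = u" "P (Suc k) = P k \<otimes> g (int k)" "P k \<in> carrier G" for k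
    unfolding P_def using assms by (induction k) auto
  have N: "N 0 = u" "N (Suc k) = N k \<otimes> inv (g (- int k - 1))" "N k \<in> carrier G" for k
    unfolding N_def using assms by (induction k) auto
  show thesis
  proof (rule that[of h])
    show "h 0 = u" by (simp add: h_def P)
    show "h t \<in> carrier G" for t by (simp add: h_def P N)
    show "h (t + 1) = h t \<otimes> g t" for t
    proof (cases "0 \<le> t")
      case True
      then have "nat (t + 1) = Suc (nat t)" by simp
      then show ?thesis using True P(2)[of "nat t"] by (simp add: h_def)
    next
      case False
      define k where "k = nat (- t - 1)"
      have t: "t = - int k - 1" "nat (- t) = Suc k" using False by (auto simp: k_def)
      have "h (t + 1) = N k"
      proof (cases k)
        case 0
        then show ?thesis using t by (simp add: h_def P N)
      next
        case (Suc j)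
        have "- (t + 1) = int k" "\<not> 0 \<le> t + 1" using t Suc by auto
        then show ?thesis by (simp only: h_def if_False nat_int)
      qed
      moreover have "h t = N k \<otimes> inv (g t)" using False t N(2)[of k] by (simp add: h_def)
      ultimately show ?thesis using N(3)[of k] g by (simp add: m_assoc)
    qed
  qed
qed

lemma unit_vec_upd:
  shows "x(k := t) + unit_vec k = x(k := t + 1)"
    and "i \<noteq> k \<Longrightarrow> (x + unit_vec i)(k := t) = x(k := t) + unit_vec i"
  by (auto simp: unit_vec_def fun_eq_iff)

text \<open>A discrete Poincare lemma with values in a nonabelian group. One coordinate is added at
  a time: the primitive on the hyperplane is prolonged along the lines in the new direction, and
  flatness of the squares carries the equations for the old directions from height t to t + 1 and
  back.\<close>

lemma (in group) flat_connection_primitive: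
  assumes s: "\<And>i x. i < n \<Longrightarrow> x \<in> Zvec n \<Longrightarrow> s i x \<in> carrier G"
    and flat: "\<And>i j x. i < n \<Longrightarrow> j < n \<Longrightarrow> x \<in> Zvec n \<Longrightarrow>
      s i x \<otimes> s j (x + unit_vec i) = s j x \<otimes> s i (x + unit_vec j)"
  obtains \<Phi> where "\<Phi> 0 = \<one>" "\<And>x. x \<in> Zvec n \<Longrightarrow> \<Phi> x \<in> carrier G"
    "\<And>x i. x \<in> Zvec n \<Longrightarrow> i < n \<Longrightarrow> \<Phi> (x + unit_vec i) = \<Phi> x \<otimes> s i x"
proof -
  have "k \<le> n \<Longrightarrow> \<exists>\<Phi>. \<Phi> 0 = \<one> \<and> (\<forall>x\<in>Zvec k. \<Phi> x \<in> carrier G) \<and>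
      (\<forall>x\<in>Zvec k. \<forall>i<k. \<Phi> (x + unit_vec i) = \<Phi> x \<otimes> s i x)" for k
  proof (induction k)
    case 0
    then show ?case by (intro exI[of _ "\<lambda>_. \<one>"]) auto
  next
    case (Suc k)
    then obtain \<Phi> where \<Phi>: "\<Phi> 0 = \<one>" "\<And>x. x \<in> Zvec k \<Longrightarrow> \<Phi> x \<in> carrier G"
      "\<And>x i. x \<in> Zvec k \<Longrightarrow> i < k \<Longrightarrow> \<Phi> (x + unit_vec i) = \<Phi> x \<otimes> s i x"
      using Suc_leD by blast
    have k: "k < n" using Suc by simp
    have up: "x(k := t) \<in> Zvec n" if "x \<in> Zvec k" for x t
      using that k by (auto simp: Zvec_def)
    have "\<exists>h. h 0 = \<Phi> x \<and> (\<forall>t. h t \<in> carrier G) \<and> (\<forall>t. h (t + 1) = h t \<otimes> s k (x(k := t)))"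
      if x: "x \<in> Zvec k" for x
    proof -
      obtain h where "h 0 = \<Phi> x" "\<And>t. h t \<in> carrier G" "\<And>t. h (t + 1) = h t \<otimes> s k (x(k := t))"
        using int_line_exists[of "\<Phi> x" "\<lambda>t. s k (x(k := t))"] \<Phi>(2)[OF x] s[OF k up[OF x]]
        by metis
      then show ?thesis by blast
    qed
    then obtain h where h: "\<And>x. x \<in> Zvec k \<Longrightarrow> h x 0 = \<Phi> x"
      "\<And>x t. x \<in> Zvec k \<Longrightarrow> h x t \<in> carrier G"
      "\<And>x t. x \<in> Zvec k \<Longrightarrow> h x (t + 1) = h x t \<otimes> s k (x(k := t))"
      by metis
    have side: "h (x + unit_vec i) t = h x t \<otimes> s i (x(k := t))" if x: "x \<in> Zvec k" "i < k" for x i t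
    proof -
      have i: "i < n" "i \<noteq> k" using x(2) k by auto
      have xi: "x + unit_vec i \<in> Zvec k" using x by auto
      have x0: "x(k := 0) = x" using x by (auto simp: Zvec_def)
      have iff: "h (x + unit_vec i) t = h x t \<otimes> s i (x(k := t)) \<longleftrightarrow>
          h (x + unit_vec i) (t + 1) = h x (t + 1) \<otimes> s i (x(k := t + 1))" for t
      proof -
        let ?y = "x(k := t)"
        have y: "?y \<in> Zvec n" "?y + unit_vec i \<in> Zvec n" "?y + unit_vec k \<in> Zvec n"
          using up[OF x(1)] i k by auto
        have "h x (t + 1) \<otimes> s i (x(k := t + 1)) = h x t \<otimes> (s k ?y \<otimes> s i (?y + unit_vec k))"
          using h x s i k y by (simp add: unit_vec_upd m_assoc)
        also have "\<dots> = h x t \<otimes> s i ?y \<otimes> s k (?y + unit_vec i)"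
          using flat[OF i(1) k y(1)] h x s i k y by (simp add: m_assoc)
        finally have "h x (t + 1) \<otimes> s i (x(k := t + 1)) = h x t \<otimes> s i ?y \<otimes> s k (?y + unit_vec i)" .
        moreover have "h (x + unit_vec i) (t + 1) = h (x + unit_vec i) t \<otimes> s k (?y + unit_vec i)"
          using h(3)[OF xi] i by (simp add: unit_vec_upd)
        ultimately show ?thesis using h x xi s i k y by simp
      qed
      show ?thesis
      proof (induction t rule: int_induct[where k = 0])
        case base
        show ?case using h(1)[OF x(1)] h(1)[OF xi] \<Phi>(3)[OF x] by (simp only: x0)
      next
        case (step1 t)
        then show ?case using iff by blast
      next
        case (step2 t)
        then show ?case using iff[of "t - 1"] by (simp del: plus_fun_apply fun_upd_apply)
      qed
    qed
    let ?F = "\<lambda>x. h (x(k := 0)) (x k)"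
    have dn: "x(k := 0) \<in> Zvec k" if "x \<in> Zvec (Suc k)" for x
      using that by (auto simp: Zvec_def)
    have z: "0(k := 0) = (0 :: nat \<Rightarrow> int)" by auto
    have "?F 0 = \<one>" using h(1)[of 0] \<Phi>(1) z by simp
    moreover have "?F x \<in> carrier G" if "x \<in> Zvec (Suc k)" for x
      using h(2)[OF dn[OF that]] .
    moreover have "?F (x + unit_vec i) = ?F x \<otimes> s i x" if x: "x \<in> Zvec (Suc k)" "i < Suc k" for x i
    proof (cases "i = k")
      case True
      have "(x + unit_vec k)(k := 0) = x(k := 0)" "(x + unit_vec k) k = x k + 1"
        by (auto simp: unit_vec_def)
      then show ?thesis using True h(3)[OF dn[OF x(1)], of "x k"] by simp
    next
      case False
      then have "(x + unit_vec i)(k := 0) = x(k := 0) + unit_vec i" "(x + unit_vec i) k = x k"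
        by (auto simp: unit_vec_def)
      then show ?thesis using False x(2) side[OF dn[OF x(1)], of i "x k"] by simp
    qed
    ultimately show ?case by (intro exI[of _ ?F]) blast
  qed
  from this[of n] show thesis using that by blast
qed

lemma Zbox_add: "x \<in> Zbox n r \<Longrightarrow> y \<in> Zbox n s \<Longrightarrow> x + y \<in> Zbox n (r + s)"
  by (fastforce simp: Zbox_def abs_le_iff)

lemma Zbox_uminus: "x \<in> Zbox n r \<Longrightarrow> - x \<in> Zbox n r"
  by (auto simp: Zbox_def abs_le_iff Zvec_def)

lemma Zbox_Zvec: "x \<in> Zbox n r \<Longrightarrow> x \<in> Zvec n"
  by (auto simp: Zbox_def)

text \<open>Short elements of \<open>G\<close> are determined by their images in \<open>H\<close>, so every edge of \<open>\<int>\<^sup>n\<close>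
  lifts to a unique short element, and the lifts are flat around squares because these are short too.\<close>

theorem (in group_hom) coarse_cover:
  assumes S: "S \<subseteq> carrier G"
    and M: "M \<subseteq> Zvec n" "0 \<in> M" "\<And>x y. x \<in> M \<Longrightarrow> y \<in> M \<Longrightarrow> x - y \<in> M"
    and f: "\<And>x. x \<in> Zvec n \<Longrightarrow> f x \<in> carrier H" "f 0 = \<one>\<^bsub>H\<^esub>"
    and per: "\<And>x m. x \<in> Zvec n \<Longrightarrow> m \<in> M \<Longrightarrow> f (x + m) = f x"
    and lip: "\<And>x i. x \<in> Zvec n \<Longrightarrow> i < n \<Longrightarrow>
      \<exists>b\<in>wball G S L. f (x + unit_vec i) = f x \<otimes>\<^bsub>H\<^esub> h b"
    and ctrl: "\<And>x y b. x \<in> Zvec n \<Longrightarrow> y \<in> Zvec n \<Longrightarrow> b \<in> wball G S (2 * C + 1) \<Longrightarrow>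
      f y = f x \<otimes>\<^bsub>H\<^esub> h b \<Longrightarrow> \<exists>m\<in>M. y - x - m \<in> Zbox n s"
    and dense: "\<And>q. q \<in> carrier G \<Longrightarrow> \<exists>x\<in>Zvec n. \<exists>b\<in>wball G S C. h q = f x \<otimes>\<^bsub>H\<^esub> h b"
    and R: "4 * L \<le> R" "L * (n * s) + 2 * C + 1 \<le> R"
    and ker: "\<And>g. g \<in> wball G S R \<Longrightarrow> h g = \<one>\<^bsub>H\<^esub> \<Longrightarrow> g = \<one>"
  obtains \<Phi> where "\<And>x. x \<in> Zvec n \<Longrightarrow> \<Phi> x \<in> carrier G" "\<And>x. x \<in> Zvec n \<Longrightarrow> h (\<Phi> x) = f x"
    "\<And>m x. m \<in> M \<Longrightarrow> x \<in> Zvec n \<Longrightarrow> \<Phi> (m + x) = \<Phi> m \<otimes> \<Phi> x"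
    "\<And>x. x \<in> Zvec n \<Longrightarrow> \<Phi> x \<in> wball G S (L * l1_norm n x)"
    "\<And>q r. q \<in> wball G S r \<Longrightarrow> \<exists>p\<in>Zbox n (s * r). \<exists>b\<in>wball G S C. q = \<Phi> p \<otimes> b"
    "\<And>k r. k \<in> wball G S r \<Longrightarrow> h k = \<one>\<^bsub>H\<^esub> \<Longrightarrow> \<exists>m\<in>M. m \<in> Zbox n (s * r + s) \<and> k = \<Phi> m"
proof -
  note [simp del] = plus_fun_apply zero_fun_apply minus_apply uminus_apply
  note cl [intro] = G.wball_closed[OF S]
  have inj: "b = b'" if "b \<in> wball G S r" "b' \<in> wball G S r'" "r + r' \<le> R" "h b = h b'" for b b' r r'
  proof -
    have c: "b \<in> carrier G" "b' \<in> carrier G" using that by auto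
    have "inv b \<otimes> b' \<in> wball G S R"
      using G.wball_mult[OF S G.wball_inv[OF S that(1)] that(2)] that(3) G.wball_mono by blast
    then have "inv b \<otimes> b' = \<one>" using ker that(4) c by simp
    then show ?thesis using c by (metis G.inv_closed G.inv_inv G.inv_solve_left G.r_one G.one_closed)
  qed
  have cancel: "h b = h b'" if "b \<in> carrier G" "b' \<in> carrier G" "x \<in> Zvec n"
    "f x \<otimes>\<^bsub>H\<^esub> h b = f x \<otimes>\<^bsub>H\<^esub> h b'" for b b' x
    using that f by simp
  define s' where "s' i x = (SOME b. b \<in> wball G S L \<and> f (x + unit_vec i) = f x \<otimes>\<^bsub>H\<^esub> h b)" for i x
  have s': "s' i x \<in> wball G S L" "f (x + unit_vec i) = f x \<otimes>\<^bsub>H\<^esub> h (s' i x)"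
    if "i < n" "x \<in> Zvec n" for i x
    using someI_ex[of "\<lambda>b. b \<in> wball G S L \<and> f (x + unit_vec i) = f x \<otimes>\<^bsub>H\<^esub> h b"] lip[OF that(2,1)]
    unfolding s'_def by blast+
  have s'c: "s' i x \<in> carrier G" if "i < n" "x \<in> Zvec n" for i x using s'(1)[OF that] by auto
  have flat: "s' i x \<otimes> s' j (x + unit_vec i) = s' j x \<otimes> s' i (x + unit_vec j)"
    if "i < n" "j < n" "x \<in> Zvec n" for i j x
  proof (rule inj)
    have xi: "x + unit_vec i \<in> Zvec n" "x + unit_vec j \<in> Zvec n" using that by auto
    show "s' i x \<otimes> s' j (x + unit_vec i) \<in> wball G S (L + L)"
      "s' j x \<otimes> s' i (x + unit_vec j) \<in> wball G S (L + L)"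
      using that xi s' by (auto intro!: G.wball_mult[OF S])
    \<comment> \<open>Each of the two paths around a square has length at most \<open>2 * L\<close>;
      comparing them is what requires \<open>4 * L \<le> R\<close>.\<close>
    show "L + L + (L + L) \<le> R" using R by simp
    have "f x \<otimes>\<^bsub>H\<^esub> h (s' i x \<otimes> s' j (x + unit_vec i)) = f (x + unit_vec i + unit_vec j)"
      using that xi s'c s'(2)[OF that(1,3)] s'(2)[OF that(2) xi(1)] f by (simp add: H.m_assoc)
    also have "\<dots> = f x \<otimes>\<^bsub>H\<^esub> h (s' j x \<otimes> s' i (x + unit_vec j))"
      using that xi s'c s'(2)[OF that(2,3)] s'(2)[OF that(1) xi(2)] f
      by (simp add: H.m_assoc add.assoc add.commute[of "unit_vec i" "unit_vec j"])
    finally show "h (s' i x \<otimes> s' j (x + unit_vec i)) = h (s' j x \<otimes> s' i (x + unit_vec j))"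
      using that xi s'c by (intro cancel) auto
  qed
  obtain \<Phi> where \<Phi>0: "\<Phi> 0 = \<one>" and \<Phi>c [simp, intro]: "\<And>x. x \<in> Zvec n \<Longrightarrow> \<Phi> x \<in> carrier G"
    and \<Phi>s: "\<And>x i. x \<in> Zvec n \<Longrightarrow> i < n \<Longrightarrow> \<Phi> (x + unit_vec i) = \<Phi> x \<otimes> s' i x"
    using G.flat_connection_primitive[of n s', OF s'c flat] by blast
  have h\<Phi>: "h (\<Phi> x) = f x" if "x \<in> Zvec n" for x
    using that
  proof (induction rule: Zvec_induct)
    case zero
    then show ?case by (simp add: \<Phi>0 f)
  next
    case (step x i)
    then show ?case using f s'c s'(2)[of i x] by (simp add: \<Phi>s)
  qed
  have Mv: "m \<in> Zvec n" if "m \<in> M" for m using M that by auto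
  have Madd: "m + m' \<in> M" if "m \<in> M" "m' \<in> M" for m m'
    using M(3)[OF that(1) M(3)[OF M(2) that(2)]] by simp
  \<comment> \<open>The edge labels were chosen separately at each vertex; uniqueness of short lifts
    makes them periodic nevertheless.\<close>
  have s'per: "s' i (m + x) = s' i x" if "i < n" "x \<in> Zvec n" "m \<in> M" for i x m
  proof (rule inj)
    have v: "m + x \<in> Zvec n" using that Mv by auto
    show "s' i (m + x) \<in> wball G S L" "s' i x \<in> wball G S L" using s' v that by auto
    show "L + L \<le> R" using R by simp
    have "f x \<otimes>\<^bsub>H\<^esub> h (s' i (m + x)) = f (m + x) \<otimes>\<^bsub>H\<^esub> h (s' i (m + x))"
      using per[OF that(2,3)] by (simp add: add.commute)
    also have "\<dots> = f ((x + unit_vec i) + m)" using s'(2)[OF that(1) v] by (simp add: algebra_simps)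
    also have "\<dots> = f x \<otimes>\<^bsub>H\<^esub> h (s' i x)" using per[of "x + unit_vec i" m] that s'(2) by auto
    finally show "h (s' i (m + x)) = h (s' i x)"
      using that s'c v by (intro cancel) auto
  qed
  have equi: "\<Phi> (m + x) = \<Phi> m \<otimes> \<Phi> x" if m: "m \<in> M" and "x \<in> Zvec n" for m x
    using that(2)
  proof (induction rule: Zvec_induct)
    case zero
    then show ?case using m Mv by (simp add: \<Phi>0)
  next
    case (step x i)
    have "m + x \<in> Zvec n" using Mv[OF m] step by auto
    then have "\<Phi> (m + (x + unit_vec i)) = \<Phi> (m + x) \<otimes> s' i x"
      using \<Phi>s[of "m + x" i] s'per[of i x m] m step by (simp add: add.assoc)
    moreover have "\<Phi> m \<otimes> \<Phi> (x + unit_vec i) = \<Phi> m \<otimes> \<Phi> x \<otimes> s' i x"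
      using Mv[OF m] step s'c by (simp add: \<Phi>s G.m_assoc)
    ultimately show ?case using Mv[OF m] step s'c \<open>m + x \<in> Zvec n\<close> by simp
  qed
  have move: "\<exists>b\<in>wball G S (L * l1_norm n v). \<Phi> (x + v) = \<Phi> x \<otimes> b"
    if x: "x \<in> Zvec n" and "v \<in> Zvec n" for x v
    using that(2)
  proof (induction rule: Zvec_step_induct)
    case zero
    then show ?case using x by (intro bexI[of _ \<one>]) auto
  next
    case (up v i)
    then obtain b where b: "b \<in> wball G S (L * l1_norm n v)" "\<Phi> (x + v) = \<Phi> x \<otimes> b" by blast
    have xv: "x + v \<in> Zvec n" using x up by auto
    have l: "l1_norm n (v + unit_vec i) = Suc (l1_norm n v)" using up by (intro l1_norm_step) auto
    have "b \<otimes> s' i (x + v) \<in> wball G S (L * l1_norm n (v + unit_vec i))"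
      using G.wball_mult[OF S b(1) s'(1)[OF up(2) xv]] by (simp add: l add.commute)
    moreover have "\<Phi> (x + (v + unit_vec i)) = \<Phi> x \<otimes> (b \<otimes> s' i (x + v))"
      using \<Phi>s[OF xv up(2)] b x s'c[OF up(2) xv] cl[OF b(1)] by (simp add: add.assoc G.m_assoc)
    ultimately show ?case by blast
  next
    case (down v i)
    then obtain b where b: "b \<in> wball G S (L * l1_norm n v)" "\<Phi> (x + v) = \<Phi> x \<otimes> b" by blast
    let ?y = "x + (v - unit_vec i)"
    have y: "?y \<in> Zvec n" "?y + unit_vec i = x + v" using x down by (auto simp: add.assoc)
    have l: "l1_norm n (v - unit_vec i) = Suc (l1_norm n v)" using down by (intro l1_norm_step) auto
    have "b \<otimes> inv s' i ?y \<in> wball G S (L * l1_norm n (v - unit_vec i))"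
      using G.wball_mult[OF S b(1) G.wball_inv[OF S s'(1)[OF down(2) y(1)]]] by (simp add: l add.commute)
    moreover have "\<Phi> ?y = \<Phi> x \<otimes> (b \<otimes> inv s' i ?y)"
    proof -
      have "\<Phi> x \<otimes> b = \<Phi> ?y \<otimes> s' i ?y" using \<Phi>s[OF y(1) down(2)] b y by simp
      then show ?thesis
        using x y s'c[OF down(2) y(1)] cl[OF b(1)]
        by (metis G.inv_solve_right G.m_assoc G.inv_closed G.m_closed \<Phi>c)
    qed
    ultimately show ?case by blast
  qed
  have ball\<Phi>: "\<Phi> x \<in> wball G S (L * l1_norm n x)" if "x \<in> Zvec n" for x
    using move[of 0 x] that \<Phi>0 cl by auto
  have small: "L * l1_norm n v \<le> L * (n * s)" if "v \<in> Zbox n s" for v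
    using l1_norm_le[OF that] by simp
  \<comment> \<open>A word for \<open>q\<close> is followed letter by letter. Density proposes the
    next point \<open>y\<close>, control places it near \<open>p\<close> up to a period, and
    removing the period keeps the walk within \<open>s\<close> of its last position; after
    \<open>r\<close> letters it is still in the box of radius \<open>s * r\<close>.\<close>
  have track: "\<exists>p\<in>Zbox n (s * r). \<exists>b\<in>wball G S C. q = \<Phi> p \<otimes> b" if "q \<in> wball G S r" for q r
    using that
  proof (induction r arbitrary: q)
    case 0
    then have "q = \<one>" by (auto simp: wball_def is_word_def)
    then have "q = \<Phi> 0 \<otimes> \<one>" by (simp add: \<Phi>0)
    moreover have "(0 :: nat \<Rightarrow> int) \<in> Zbox n (s * 0)" by (simp add: Zbox_def zero_fun_apply)
    ultimately show ?case using G.one_in_wball by blast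
  next
    case (Suc r)
    obtain u v where uv: "u \<in> wball G S r" "v \<in> wball G S 1" "q = u \<otimes> v"
      using G.wball_Suc[OF S Suc.prems] by blast
    obtain p b where p: "p \<in> Zbox n (s * r)" "b \<in> wball G S C" "u = \<Phi> p \<otimes> b"
      using Suc.IH[OF uv(1)] by blast
    have q: "q \<in> carrier G" "u \<in> carrier G" "v \<in> carrier G" "b \<in> carrier G" and pv: "p \<in> Zvec n"
      using uv p cl by (auto intro: Zbox_Zvec)
    obtain y c where y: "y \<in> Zvec n" "c \<in> wball G S C" "h q = f y \<otimes>\<^bsub>H\<^esub> h c"
      using dense[OF q(1)] by blast
    let ?d = "b \<otimes> v \<otimes> inv c"
    have c: "c \<in> carrier G" using y cl by auto
    have d: "?d \<in> wball G S (2 * C + 1)"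
      using G.wball_mult[OF S G.wball_mult[OF S p(2) uv(2)] G.wball_inv[OF S y(2)]]
      by (simp add: mult_2 add.commute add.left_commute)
    have "f y = h q \<otimes>\<^bsub>H\<^esub> h (inv c)"
      using y(3) c f(1)[OF y(1)] by (simp add: H.m_assoc)
    also have "\<dots> = f p \<otimes>\<^bsub>H\<^esub> h ?d"
      using uv(3) p(3) q c pv f(1)[OF pv] by (simp add: h\<Phi> H.m_assoc)
    finally obtain m where m: "m \<in> M" "y - p - m \<in> Zbox n s"
      using ctrl[OF pv y(1) d] by blast
    let ?v = "y - p - m"
    let ?p = "p + ?v"
    have v: "?v \<in> Zvec n" "?p \<in> Zvec n" using pv y(1) Mv[OF m(1)] by auto
    have fp: "f ?p = f y" using per[OF v(2) m(1)] by (simp add: algebra_simps)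
    obtain e where e: "e \<in> wball G S (L * l1_norm n ?v)" "\<Phi> ?p = \<Phi> p \<otimes> e"
      using move[OF pv v(1)] by blast
    have ec: "e \<in> carrier G" using e cl by auto
    \<comment> \<open>This element is to be identified with \<open>c\<close>, of length at most
      \<open>C\<close>; the two radii add up to the second lower bound on \<open>R\<close>.\<close>
    have e': "inv e \<otimes> (b \<otimes> v) \<in> wball G S (L * (n * s) + (C + 1))"
      by (rule G.wball_mono[OF G.wball_mult[OF S G.wball_inv[OF S e(1)] G.wball_mult[OF S p(2) uv(2)]]])
        (use small[OF m(2)] in linarith)
    have "f y \<otimes>\<^bsub>H\<^esub> h (inv e \<otimes> (b \<otimes> v)) = h (\<Phi> ?p \<otimes> (inv e \<otimes> (b \<otimes> v)))"
      using h\<Phi>[OF v(2)] fp v q ec by simp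
    also have "\<Phi> ?p \<otimes> (inv e \<otimes> (b \<otimes> v)) = q"
      using e uv(3) p(3) q ec pv by (simp add: G.m_assoc) (simp add: G.m_assoc[symmetric])
    also have "h q = f y \<otimes>\<^bsub>H\<^esub> h c" by (rule y(3))
    finally have "h (inv e \<otimes> (b \<otimes> v)) = h c"
      using ec q c y by (intro cancel[of _ _ y]) auto
    then have "inv e \<otimes> (b \<otimes> v) = c"
      using R by (intro inj[OF e' y(2)]) auto
    moreover have "\<Phi> ?p \<otimes> (inv e \<otimes> (b \<otimes> v)) = q" by fact
    ultimately have "q = \<Phi> ?p \<otimes> c" by simp
    moreover have "?p \<in> Zbox n (s * Suc r)" using Zbox_add[OF p(1) m(2)] by (simp add: add.commute)
    ultimately show ?case using y(2) by blast
  qed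
  have kernel: "\<exists>m\<in>M. m \<in> Zbox n (s * r + s) \<and> k = \<Phi> m" if k: "k \<in> wball G S r" "h k = \<one>\<^bsub>H\<^esub>" for k r
  proof -
    obtain p b where p: "p \<in> Zbox n (s * r)" "b \<in> wball G S C" "k = \<Phi> p \<otimes> b"
      using track[OF k(1)] by blast
    have pv: "p \<in> Zvec n" and bc: "b \<in> carrier G" using p cl by (auto intro: Zbox_Zvec)
    have "f 0 = f p \<otimes>\<^bsub>H\<^esub> h b" using k(2) p(3) pv bc f(2) by (simp add: h\<Phi>)
    moreover have "b \<in> wball G S (2 * C + 1)" using p(2) by (rule G.wball_mono) simp
    ultimately obtain m where m: "m \<in> M" "0 - p - m \<in> Zbox n s"
      using ctrl[OF pv, of 0 b] by blast
    let ?m = "0 - m" and ?v = "- (0 - p - m)"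
    have m': "?m \<in> M" by (rule M(3)[OF M(2) m(1)])
    have v: "?v \<in> Zbox n s" using m(2) by (rule Zbox_uminus)
    have vv: "?v \<in> Zvec n" using v by (rule Zbox_Zvec)
    have pm: "p = ?m + ?v" by simp
    have "?m = p + (0 - p - m)" by simp
    then have mb: "?m \<in> Zbox n (s * r + s)" using Zbox_add[OF p(1) m(2)] by metis
    \<comment> \<open>Once the period is split off, the remaining factor is short and lies in the
      kernel of \<open>h\<close>, hence is trivial.\<close>
    have km: "k = \<Phi> ?m \<otimes> (\<Phi> ?v \<otimes> b)"
      using p(3) equi[OF m' vv] pm Mv[OF m'] vv bc by (metis G.m_assoc \<Phi>c)
    have hm: "h (\<Phi> ?m) = \<one>\<^bsub>H\<^esub>" using h\<Phi>[OF Mv[OF m']] per[of 0 ?m] m' f(2) by simp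
    have "h (\<Phi> ?v \<otimes> b) = \<one>\<^bsub>H\<^esub>"
      using km k(2) hm Mv[OF m'] vv bc by (metis G.m_closed H.l_one \<Phi>c hom_closed hom_mult)
    moreover have "\<Phi> ?v \<otimes> b \<in> wball G S R"
      by (rule G.wball_mono[OF G.wball_mult[OF S ball\<Phi>[OF vv] p(2)]])
        (use small[OF v] R(2) in linarith)
    ultimately have "\<Phi> ?v \<otimes> b = \<one>" by (intro ker) auto
    then have "k = \<Phi> ?m" using km Mv[OF m'] by simp
    then show ?thesis using m' mb by blast
  qed
  show thesis
    by (rule that[OF \<Phi>c h\<Phi> equi ball\<Phi> track kernel])
qed

section \<open>Twisted transfer\<close>

text \<open>The cross product works unless it vanishes; then the vectors are parallel, and anything
  orthogonal to a nonzero one of them is orthogonal to both. Two equations in three unknowns are how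
  two generators fail to account for three coordinates.\<close>

lemma int_orthogonal_pair:
  fixes u v :: "nat \<Rightarrow> int"
  obtains c0 c1 c2 where "(c0, c1, c2) \<noteq> (0, 0, 0)"
    "c0 * u 0 + c1 * u 1 + c2 * u 2 = 0" "c0 * v 0 + c1 * v 1 + c2 * v 2 = 0"
proof -
  define w0 w1 w2 where w: "w0 = u 1 * v 2 - u 2 * v 1" "w1 = u 2 * v 0 - u 0 * v 2" "w2 = u 0 * v 1 - u 1 * v 0"
  show thesis
  proof (cases "(w0, w1, w2) = (0, 0, 0)")
    case False
    then show ?thesis by (rule that) (simp_all add: w algebra_simps)
  next
    case True
    then have z: "u 1 * v 2 = u 2 * v 1" "u 2 * v 0 = u 0 * v 2" "u 0 * v 1 = u 1 * v 0"
      using w by auto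
    have main: thesis
      if p: "p 1 * q 2 = p 2 * q 1" "p 2 * q 0 = p 0 * q 2" "p 0 * q 1 = p 1 * q 0" "(p 0, p 1, p 2) \<noteq> (0, 0, 0)"
        and conc: "\<And>c0 c1 c2. (c0, c1, c2) \<noteq> (0, 0, 0) \<Longrightarrow> c0 * p 0 + c1 * p 1 + c2 * p 2 = 0
          \<Longrightarrow> c0 * q 0 + c1 * q 1 + c2 * q 2 = 0 \<Longrightarrow> thesis" for p q :: "nat \<Rightarrow> int"
    proof (cases "p 0 = 0 \<and> p 1 = 0")
      case True
      then have "p 2 \<noteq> 0" using p(4) by simp
      then have "q 0 = 0" using True p(2) by simp
      then show ?thesis using True by (intro conc[of 1 0 0]) simp_all
    next
      case False
      show ?thesis
      proof (rule conc[of "p 1" "- p 0" 0])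
        show "(p 1, - p 0, 0) \<noteq> (0, 0, 0)" using False by auto
        show "p 1 * p 0 + - p 0 * p 1 + 0 * p 2 = 0" by simp
        show "p 1 * q 0 + - p 0 * q 1 + 0 * q 2 = 0" using p(3) by simp
      qed
    qed
    show ?thesis
    proof (cases "(u 0, u 1, u 2) = (0, 0, 0)")
      case False
      show ?thesis by (rule main[of u v, OF z False]) (rule that)
    next
      case u0: True
      show ?thesis
      proof (cases "(v 0, v 1, v 2) = (0, 0, 0)")
        case False
        have "v 1 * u 2 = v 2 * u 1" "v 2 * u 0 = v 0 * u 2" "v 0 * u 1 = v 1 * u 0"
          using z by (simp_all add: mult.commute)
        from main[of v u, OF this False] show ?thesis using that by blast
      next
        case True
        then show ?thesis using u0 by (intro that[of 1 0 0]) auto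
      qed
    qed
  qed
qed

text \<open>The transfer into the abelian kernel, with the coset of \<open>t\<close> weighted by the sign \<open>\<xi> t\<close>; the
  weight makes it a crossed homomorphism instead of a homomorphism that would vanish on the kernel.\<close>

lemma (in group_hom) twisted_transfer:
  fixes \<phi> \<xi> :: "'a \<Rightarrow> int"
  assumes fin: "finite (carrier H)" and surj: "h ` carrier G = carrier H"
    and add: "\<And>k k'. k \<in> kernel G H h \<Longrightarrow> k' \<in> kernel G H h \<Longrightarrow> \<phi> (k \<otimes> k') = \<phi> k + \<phi> k'"
    and conj: "\<And>g k. g \<in> carrier G \<Longrightarrow> k \<in> kernel G H h \<Longrightarrow> \<phi> (g \<otimes> k \<otimes> inv g) = \<xi> g * \<phi> k"
    and \<xi>: "\<And>g g'. g \<in> carrier G \<Longrightarrow> g' \<in> carrier G \<Longrightarrow> \<xi> (g \<otimes> g') = \<xi> g * \<xi> g'"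
      "\<And>k. k \<in> kernel G H h \<Longrightarrow> \<xi> k = 1" "\<And>g. g \<in> carrier G \<Longrightarrow> \<xi> g * \<xi> g = 1"
  obtains W where "\<And>x y. x \<in> carrier G \<Longrightarrow> y \<in> carrier G \<Longrightarrow> W (x \<otimes> y) = W x + \<xi> x * W y"
    "\<And>k. k \<in> kernel G H h \<Longrightarrow> W k = int (card (carrier H)) * \<phi> k"
proof -
  define t where "t = inv_into (carrier G) h"
  have t: "t c \<in> carrier G" "h (t c) = c" if "c \<in> carrier H" for c
    using that surj unfolding t_def by (auto simp: inv_into_into f_inv_into_f)
  \<comment> \<open>The Schreier cocycle of the section \<open>t\<close>: the kernel part of
    \<open>t c \<otimes> x\<close>.\<close>
  define \<alpha> where "\<alpha> c x = t c \<otimes> x \<otimes> inv (t (c \<otimes>\<^bsub>H\<^esub> h x))" for c x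
  have \<alpha>: "\<alpha> c x \<in> kernel G H h" if "c \<in> carrier H" "x \<in> carrier G" for c x
    using that t by (simp add: \<alpha>_def kernel_def)
  have \<alpha>c: "\<alpha> c x \<in> carrier G" if "c \<in> carrier H" "x \<in> carrier G" for c x
    using \<alpha>[OF that] by (simp add: kernel_def)
  have \<alpha>t: "\<alpha> c x \<otimes> t (c \<otimes>\<^bsub>H\<^esub> h x) = t c \<otimes> x" if "c \<in> carrier H" "x \<in> carrier G" for c x
    using that t by (simp add: \<alpha>_def G.m_assoc)
  have cocycle: "\<alpha> c (x \<otimes> y) = \<alpha> c x \<otimes> \<alpha> (c \<otimes>\<^bsub>H\<^esub> h x) y"
    if "c \<in> carrier H" "x \<in> carrier G" "y \<in> carrier G" for c x y
  proof -
    let ?s = "t (c \<otimes>\<^bsub>H\<^esub> h x)"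
    have s: "?s \<in> carrier G" "t (c \<otimes>\<^bsub>H\<^esub> (h x \<otimes>\<^bsub>H\<^esub> h y)) \<in> carrier G" using t that by auto
    have "\<alpha> c x \<otimes> \<alpha> (c \<otimes>\<^bsub>H\<^esub> h x) y = \<alpha> c x \<otimes> ?s \<otimes> y \<otimes> inv (t (c \<otimes>\<^bsub>H\<^esub> h x \<otimes>\<^bsub>H\<^esub> h y))"
      using that s \<alpha>c by (simp add: \<alpha>_def[of "c \<otimes>\<^bsub>H\<^esub> h x"] G.m_assoc H.m_assoc)
    then show ?thesis
      unfolding \<alpha>t[OF that(1,2)] using that s t by (simp add: \<alpha>_def G.m_assoc H.m_assoc)
  qed
  have \<xi>t: "\<xi> (t c) = \<xi> (t (c \<otimes>\<^bsub>H\<^esub> h x)) * \<xi> x" if "c \<in> carrier H" "x \<in> carrier G" for c x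
  proof -
    have s: "t (c \<otimes>\<^bsub>H\<^esub> h x) \<in> carrier G" using t that by auto
    have "\<xi> (t c) * \<xi> x = \<xi> (t (c \<otimes>\<^bsub>H\<^esub> h x))"
      using \<alpha>t[OF that] \<xi>(1)[OF \<alpha>c[OF that] s] \<xi>(2)[OF \<alpha>[OF that]] \<xi>(1)[OF t(1)[OF that(1)] that(2)]
      by simp
    then show ?thesis using \<xi>(3)[OF that(2)] by (metis mult.assoc mult.right_neutral)
  qed
  define W where "W x = (\<Sum>c\<in>carrier H. \<xi> (t c) * \<phi> (\<alpha> c x))" for x
  show thesis
  proof (rule that[of W])
    fix x y assume xy: "x \<in> carrier G" "y \<in> carrier G"
    have "W (x \<otimes> y) = (\<Sum>c\<in>carrier H. \<xi> (t c) * \<phi> (\<alpha> c x) + \<xi> (t c) * \<phi> (\<alpha> (c \<otimes>\<^bsub>H\<^esub> h x) y))"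
      unfolding W_def
    proof (rule sum.cong, goal_cases)
      case (2 c)
      then have "c \<otimes>\<^bsub>H\<^esub> h x \<in> carrier H" using xy by simp
      then show ?case using 2 xy by (simp add: cocycle add \<alpha> distrib_left)
    qed simp
    also have "\<dots> = W x + (\<Sum>c\<in>carrier H. \<xi> (t c) * \<phi> (\<alpha> (c \<otimes>\<^bsub>H\<^esub> h x) y))"
      by (simp add: sum.distrib W_def)
    also have "(\<Sum>c\<in>carrier H. \<xi> (t c) * \<phi> (\<alpha> (c \<otimes>\<^bsub>H\<^esub> h x) y)) =
        (\<Sum>c\<in>carrier H. \<xi> x * (\<xi> (t (c \<otimes>\<^bsub>H\<^esub> h x)) * \<phi> (\<alpha> (c \<otimes>\<^bsub>H\<^esub> h x) y)))"
      using xy by (intro sum.cong) (auto simp: \<xi>t)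
    also have "\<dots> = (\<Sum>c\<in>carrier H. \<xi> x * (\<xi> (t c) * \<phi> (\<alpha> c y)))"
    proof (rule sum.reindex_bij_witness[where i = "\<lambda>c. c \<otimes>\<^bsub>H\<^esub> inv\<^bsub>H\<^esub> h x" and j = "\<lambda>c. c \<otimes>\<^bsub>H\<^esub> h x"])
    qed (use xy in \<open>auto simp: H.m_assoc\<close>)
    also have "\<dots> = \<xi> x * W y" by (simp add: W_def sum_distrib_left)
    finally show "W (x \<otimes> y) = W x + \<xi> x * W y" .
  next
    fix k assume k: "k \<in> kernel G H h"
    then have kc: "k \<in> carrier G" "h k = \<one>\<^bsub>H\<^esub>" by (auto simp: kernel_def)
    have "W k = (\<Sum>c\<in>carrier H. \<phi> k)"
      unfolding W_def
    proof (rule sum.cong, goal_cases)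
      case (2 c)
      \<comment> \<open>A kernel element fixes every coset, so the summand is the value at a
        conjugate of \<open>k\<close>; the sign of the conjugation meets the weight and squares to
        1, so that nothing cancels in the sum.\<close>
      then have "\<alpha> c k = t c \<otimes> k \<otimes> inv (t c)" using kc by (simp add: \<alpha>_def)
      then have "\<xi> (t c) * \<phi> (\<alpha> c k) = (\<xi> (t c) * \<xi> (t c)) * \<phi> k"
        using conj[OF t(1)[OF 2] k] by (simp add: mult.assoc)
      then show ?case using \<xi>(3)[OF t(1)[OF 2]] by simp
    qed simp
    then show "W k = int (card (carrier H)) * \<phi> k" by simp
  qed
qed

text \<open>The zeros of a crossed homomorphism are closed under products and inverses whatever the
  twist, so generators decide.\<close>

lemma (in group) crossed_hom_vanishes:
  fixes W \<xi> :: "'a \<Rightarrow> int"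
  assumes W: "\<And>x y. x \<in> carrier G \<Longrightarrow> y \<in> carrier G \<Longrightarrow> W (x \<otimes> y) = W x + \<xi> x * W y"
    and \<xi>: "\<And>g. g \<in> carrier G \<Longrightarrow> \<xi> g * \<xi> g = 1"
    and S: "S \<subseteq> carrier G" "\<And>s. s \<in> S \<Longrightarrow> W s = 0" and g: "g \<in> generate G S"
  shows "W g = 0"
  using g
proof (induction rule: generate.induct)
  have W1: "W \<one> = 0" using W[of \<one> \<one>] \<xi>[of \<one>] by auto
  case one
  then show ?case by (rule W1)
  case (inv s)
  then show ?case using W[of s "inv s"] S \<xi>[of s] W1 by (auto simp: subset_iff)
next
  case (eng x y)
  then have "x \<in> carrier G" "y \<in> carrier G" using generate_in_carrier[OF S(1)] by auto
  then show ?case using W eng by simp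
qed (use S in auto)

text \<open>Transfer of three coordinates of \<psi> gives crossed homomorphisms with the same sign.
  A nonzero combination of them vanishes at \<open>a\<close> and \<open>b\<close>, hence everywhere;
  on the kernel it is a positive multiple of the same combination of coordinates, which the unit
  vectors detect.\<close>

theorem (in group_hom) no_scalar_action_of_two_generated:
  assumes gen: "generate G {a, b} = carrier G"
    and fin: "finite (carrier H)" and surj: "h ` carrier G = carrier H"
    and add: "\<And>k k'. k \<in> kernel G H h \<Longrightarrow> k' \<in> kernel G H h \<Longrightarrow> \<psi> (k \<otimes> k') = \<psi> k + \<psi> k'"
    and basis: "\<And>i. i < 3 \<Longrightarrow> \<exists>k\<in>kernel G H h. \<psi> k = unit_vec i"
    and scalar: "\<And>g. g \<in> carrier G \<Longrightarrow>
      \<exists>\<epsilon>::int. \<epsilon> * \<epsilon> = 1 \<and> (\<forall>k\<in>kernel G H h. \<forall>j. \<psi> (g \<otimes> k \<otimes> inv g) j = \<epsilon> * \<psi> k j)"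
  shows False
proof -
  obtain \<xi> :: "'a \<Rightarrow> int" where \<xi>: "\<And>g. g \<in> carrier G \<Longrightarrow> \<xi> g * \<xi> g = 1"
    "\<And>g k j. g \<in> carrier G \<Longrightarrow> k \<in> kernel G H h \<Longrightarrow> \<psi> (g \<otimes> k \<otimes> inv g) j = \<xi> g * \<psi> k j"
    using scalar by metis
  have ab: "{a, b} \<subseteq> carrier G" unfolding gen[symmetric] by (blast intro: generate.incl)
  have kc: "k \<in> carrier G" if "k \<in> kernel G H h" for k using that by (simp add: kernel_def)
  have conj_ker: "g \<otimes> k \<otimes> inv g \<in> kernel G H h" if "g \<in> carrier G" "k \<in> kernel G H h" for g k
    using that by (simp add: kernel_def)
  obtain k0 where k0: "k0 \<in> kernel G H h" "\<psi> k0 = unit_vec 0" using basis[of 0] by auto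
  have \<psi>0: "\<psi> k0 0 = 1" using k0 by (simp add: unit_vec_def)
  have mult: "\<xi> (g \<otimes> g') = \<xi> g * \<xi> g'" if "g \<in> carrier G" "g' \<in> carrier G" for g g'
  proof -
    have "\<xi> (g \<otimes> g') = \<psi> (g \<otimes> g' \<otimes> k0 \<otimes> inv (g \<otimes> g')) 0"
      using \<xi>(2)[of "g \<otimes> g'" k0 0] that k0 \<psi>0 by simp
    also have "g \<otimes> g' \<otimes> k0 \<otimes> inv (g \<otimes> g') = g \<otimes> (g' \<otimes> k0 \<otimes> inv g') \<otimes> inv g"
      using that kc[OF k0(1)] by (simp add: G.inv_mult_group G.m_assoc)
    also have "\<psi> \<dots> 0 = \<xi> g * \<xi> g'"
      using \<xi>(2)[OF that(1) conj_ker[OF that(2) k0(1)], of 0] \<xi>(2)[OF that(2) k0(1), of 0] \<psi>0 by simp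
    finally show ?thesis .
  qed
  have one_ker: "\<one> \<in> kernel G H h" by (simp add: kernel_def)
  have \<psi>1: "\<psi> \<one> = 0" using add[OF one_ker one_ker] by simp
  \<comment> \<open>Additivity of \<psi> makes conjugation by kernel elements invisible to it;
    evaluation at \<open>k0\<close> reads off the sign.\<close>
  have triv: "\<xi> k = 1" if k: "k \<in> kernel G H h" for k
  proof -
    have ik: "inv k \<in> kernel G H h" using k by (simp add: kernel_def)
    have "\<psi> (k \<otimes> inv k) = \<psi> k + \<psi> (inv k)" by (rule add[OF k ik])
    then have i: "\<psi> (inv k) = - \<psi> k" using \<psi>1 kc[OF k] by (simp add: eq_neg_iff_add_eq_0 add.commute)
    have kk0: "k \<otimes> k0 \<in> kernel G H h" using k k0 by (simp add: kernel_def)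
    have "\<psi> (k \<otimes> k0 \<otimes> inv k) = \<psi> k0" using add[OF kk0 ik] add[OF k k0(1)] i by simp
    then show ?thesis using \<xi>(2)[OF kc[OF k] k0(1), of 0] \<psi>0 by simp
  qed
  have "\<exists>W. (\<forall>x\<in>carrier G. \<forall>y\<in>carrier G. W (x \<otimes> y) = W x + \<xi> x * W y) \<and>
      (\<forall>k\<in>kernel G H h. W k = int (card (carrier H)) * \<psi> k j)" for j
  proof -
    obtain W where "\<And>x y. x \<in> carrier G \<Longrightarrow> y \<in> carrier G \<Longrightarrow> W (x \<otimes> y) = W x + \<xi> x * W y"
      "\<And>k. k \<in> kernel G H h \<Longrightarrow> W k = int (card (carrier H)) * \<psi> k j"
      using twisted_transfer[of "\<lambda>k. \<psi> k j" \<xi>, OF fin surj _ \<xi>(2) mult triv \<xi>(1)] add by auto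
    then show ?thesis by blast
  qed
  then obtain W where W: "\<And>j x y. x \<in> carrier G \<Longrightarrow> y \<in> carrier G \<Longrightarrow> W j (x \<otimes> y) = W j x + \<xi> x * W j y"
    "\<And>j k. k \<in> kernel G H h \<Longrightarrow> W j k = int (card (carrier H)) * \<psi> k j"
    by metis
  obtain c0 c1 c2 where c: "(c0, c1, c2) \<noteq> (0, 0, 0)"
    "c0 * W 0 a + c1 * W 1 a + c2 * W 2 a = 0" "c0 * W 0 b + c1 * W 1 b + c2 * W 2 b = 0"
    using int_orthogonal_pair[of "\<lambda>j. W j a" "\<lambda>j. W j b"] by metis
  define V where "V x = c0 * W 0 x + c1 * W 1 x + c2 * W 2 x" for x
  have V: "V (x \<otimes> y) = V x + \<xi> x * V y" if "x \<in> carrier G" "y \<in> carrier G" for x y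
    using W(1)[OF that] by (simp add: V_def algebra_simps)
  have V0: "V g = 0" if "g \<in> carrier G" for g
    using G.crossed_hom_vanishes[of V \<xi>, OF V \<xi>(1) ab, of g] c that gen by (auto simp: V_def)
  have "card (carrier H) \<noteq> 0" using fin H.one_closed by auto
  moreover have "V k = int (card (carrier H)) * (c0 * \<psi> k 0 + c1 * \<psi> k 1 + c2 * \<psi> k 2)"
    if "k \<in> kernel G H h" for k
    using W(2)[OF that] by (simp add: V_def algebra_simps)
  ultimately have z: "c0 * \<psi> k 0 + c1 * \<psi> k 1 + c2 * \<psi> k 2 = 0" if "k \<in> kernel G H h" for k
    using V0[OF kc[OF that]] that by simp
  have "c0 = 0" using basis[of 0] z by (fastforce simp: unit_vec_def)
  moreover have "c1 = 0" using basis[of 1] z by (fastforce simp: unit_vec_def)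
  moreover have "c2 = 0" using basis[of 2] z by (fastforce simp: unit_vec_def)
  ultimately show False using c(1) by simp
qed

section \<open>Counting lattice kernels\<close>

definition Zscale :: "int \<Rightarrow> (nat \<Rightarrow> int) \<Rightarrow> nat \<Rightarrow> int" where
  "Zscale c x = (\<lambda>i. c * x i)"

text \<open>The shear replaces the basis vector \<open>e\<^sub>i\<close> by \<open>e\<^sub>i + e\<^sub>j\<close>; it serves to make a diagonal but
  nonscalar matrix nondiagonal.\<close>

definition shear :: "bool \<Rightarrow> nat \<Rightarrow> nat \<Rightarrow> (nat \<Rightarrow> int) \<Rightarrow> nat \<Rightarrow> int" where
  "shear u i j x = x(j := x j + of_bool u * x i)"

lemma Zscale_Zvec [simp, intro]: "x \<in> Zvec n \<Longrightarrow> Zscale c x \<in> Zvec n"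
  by (simp add: Zscale_def Zvec_def)

lemma Zscale_simps [simp]:
  "Zscale 0 x = 0" "Zscale c 0 = 0" "Zscale 1 x = x" "Zscale c (Zscale d x) = Zscale (c * d) x"
  "Zscale (c + d) x = Zscale c x + Zscale d x" "Zscale c (x + y) = Zscale c x + Zscale c y"
  "Zscale (c - d) x = Zscale c x - Zscale d x"
  by (auto simp: Zscale_def fun_eq_iff algebra_simps)

lemma Zscale_cancel: "c \<noteq> 0 \<Longrightarrow> Zscale c x = Zscale c y \<longleftrightarrow> x = y"
  by (auto simp: Zscale_def fun_eq_iff)

lemma shear_Zvec [simp, intro]: "x \<in> Zvec n \<Longrightarrow> j < n \<Longrightarrow> shear u i j x \<in> Zvec n"
  by (auto simp: shear_def Zvec_def)

lemma shear_add: "shear u i j (x + y) = shear u i j x + shear u i j y"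
  by (auto simp: shear_def fun_eq_iff algebra_simps)

lemma shear_unit_vec:
  "i \<noteq> j \<Longrightarrow> shear u i j (unit_vec l) = unit_vec l + (if l = i \<and> u then unit_vec j else 0)"
  by (auto simp: shear_def unit_vec_def fun_eq_iff)

text \<open>A walk away from the origin stays within the support of its endpoint: a step in
  direction \<open>i\<close> leaves a nonzero coordinate there, which forces
  \<open>i \<in> I\<close>. Only generators on which the two maps agree are ever used.\<close>

lemma hom_eq_on_support:
  assumes G: "group G"
    and \<theta>: "\<And>x. x \<in> Zvec n \<Longrightarrow> \<theta> x \<in> carrier G"
      "\<And>x y. x \<in> Zvec n \<Longrightarrow> y \<in> Zvec n \<Longrightarrow> \<theta> (x + y) = \<theta> x \<otimes>\<^bsub>G\<^esub> \<theta> y"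
    and \<theta>': "\<And>x. x \<in> Zvec n \<Longrightarrow> \<theta>' x \<in> carrier G"
      "\<And>x y. x \<in> Zvec n \<Longrightarrow> y \<in> Zvec n \<Longrightarrow> \<theta>' (x + y) = \<theta>' x \<otimes>\<^bsub>G\<^esub> \<theta>' y"
    and eq: "\<And>l. l < n \<Longrightarrow> l \<in> I \<Longrightarrow> \<theta> (unit_vec l) = \<theta>' (unit_vec l)"
    and x: "x \<in> Zvec n" "\<And>l. l \<notin> I \<Longrightarrow> x l = 0"
  shows "\<theta> x = \<theta>' x"
proof -
  interpret group G by (rule G)
  have hom0: "\<phi> 0 = \<one>\<^bsub>G\<^esub>" if "\<phi> 0 \<in> carrier G" "\<phi> (0 + 0) = \<phi> 0 \<otimes>\<^bsub>G\<^esub> \<phi> 0" for \<phi> :: "(nat \<Rightarrow> int) \<Rightarrow> 'a"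
  proof -
    have "\<phi> 0 \<otimes>\<^bsub>G\<^esub> \<phi> 0 = \<phi> 0" using that(2) by (simp only: add_0)
    then show ?thesis using that(1) l_cancel_one by blast
  qed
  have "(\<forall>l. l \<notin> I \<longrightarrow> x l = 0) \<longrightarrow> \<theta> x = \<theta>' x"
    using x(1)
  proof (induction rule: Zvec_step_induct)
    case zero
    have "\<theta> 0 = \<theta>' 0"
      using hom0[OF \<theta>(1)[OF Zvec_closed(1)] \<theta>(2)[OF Zvec_closed(1) Zvec_closed(1)]]
        hom0[OF \<theta>'(1)[OF Zvec_closed(1)] \<theta>'(2)[OF Zvec_closed(1) Zvec_closed(1)]]
      by (rule trans[OF _ sym])
    then show ?case by blast
  next
    case (up x i)
    show ?case
    proof
      assume s: "\<forall>l. l \<notin> I \<longrightarrow> (x + unit_vec i) l = 0"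
      then have i: "i \<in> I" using up(3) by (force simp: unit_vec_def)
      have "x l = 0" if "l \<notin> I" for l
      proof -
        have "l \<noteq> i" "(x + unit_vec i) l = 0" using that i s by auto
        then show ?thesis by (simp add: unit_vec_def)
      qed
      then have "\<theta> x = \<theta>' x" using up by blast
      then show "\<theta> (x + unit_vec i) = \<theta>' (x + unit_vec i)"
        using \<theta>(2)[of x "unit_vec i"] \<theta>'(2)[of x "unit_vec i"] eq[OF up(2) i] up(1,2)
        by (metis Zvec_closed(5))
    qed
  next
    case (down x i)
    let ?y = "x - unit_vec i"
    show ?case
    proof
      assume s: "\<forall>l. l \<notin> I \<longrightarrow> ?y l = 0"
      then have i: "i \<in> I" using down(3) by (force simp: unit_vec_def)
      have "x l = 0" if "l \<notin> I" for l
      proof -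
        have "l \<noteq> i" "?y l = 0" using that i s by auto
        then show ?thesis by (simp add: unit_vec_def)
      qed
      then have e: "\<theta> x = \<theta>' x" using down by blast
      have v: "?y \<in> Zvec n" "unit_vec i \<in> Zvec n" "?y + unit_vec i = x" using down(1,2) by auto
      have "\<theta> ?y \<otimes>\<^bsub>G\<^esub> \<theta> (unit_vec i) = \<theta>' ?y \<otimes>\<^bsub>G\<^esub> \<theta> (unit_vec i)"
        using e \<theta>(2)[OF v(1,2)] \<theta>'(2)[OF v(1,2)] eq[OF down(2) i] v(3) by metis
      then show "\<theta> ?y = \<theta>' ?y" using \<theta>(1) \<theta>'(1) v right_cancel by blast
    qed
  qed
  then show ?thesis using x(2) by blast
qed

text \<open>\<theta> presents the kernel of a finite quotient as an image of \<open>Zvec n\<close>,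
  possibly with relations. The scale \<open>l\<close> of the generators is separated from the
  constant \<open>D\<close>, which bounds both their length relative to \<open>l\<close> and the
  conjugation matrices of \<open>a\<close> and \<open>b\<close>; in the count \<open>l\<close> grows
  while \<open>D\<close> is fixed.\<close>

locale lattice_kernel = group_hom G H h
  for G (structure) and H (structure) and h +
  fixes S and n :: nat and \<theta> :: "(nat \<Rightarrow> int) \<Rightarrow> 'a" and a b and D l :: nat
  assumes S: "S \<subseteq> carrier G" and finH: "finite (carrier H)" and surj: "h ` carrier G = carrier H"
    and \<theta>_add: "\<And>x y. x \<in> Zvec n \<Longrightarrow> y \<in> Zvec n \<Longrightarrow> \<theta> (x + y) = \<theta> x \<otimes> \<theta> y"
    and \<theta>_image: "\<theta> ` Zvec n = kernel G H h"
    and \<theta>_ball: "\<And>j. j < n \<Longrightarrow> \<theta> (unit_vec j) \<in> wball G S (D * l)"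
    and ab: "a \<in> carrier G" "b \<in> carrier G"
    and \<theta>_conj: "\<And>g j. g \<in> {a, b} \<Longrightarrow> j < n \<Longrightarrow>
      \<exists>p\<in>Zbox n D. g \<otimes> \<theta> (unit_vec j) \<otimes> inv g = \<theta> p"
begin

lemma \<theta>_kernel: "x \<in> Zvec n \<Longrightarrow> \<theta> x \<in> kernel G H h"
  using \<theta>_image by blast

lemma \<theta>_closed [simp, intro]: "x \<in> Zvec n \<Longrightarrow> \<theta> x \<in> carrier G"
  using \<theta>_kernel by (simp add: kernel_def)

lemma \<theta>_0: "\<theta> 0 = \<one>"
  using \<theta>_add[of 0 0] by (metis G.l_cancel_one' Zvec_closed(1) \<theta>_closed add_0)

lemma \<theta>_commute: "x \<in> Zvec n \<Longrightarrow> y \<in> Zvec n \<Longrightarrow> \<theta> x \<otimes> \<theta> y = \<theta> y \<otimes> \<theta> x"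
  using \<theta>_add by (metis add.commute)

lemma \<theta>_scale:
  assumes "x \<in> Zvec n"
  shows "\<theta> (Zscale c x) = \<theta> x [^] (c :: int)"
proof (induction c rule: int_induct[where k = 0])
  case base
  show "\<theta> (Zscale 0 x) = \<theta> x [^] (0 :: int)" by (simp only: Zscale_simps \<theta>_0 int_pow_0)
next
  case (step1 c)
  then show ?case using assms by (simp add: \<theta>_add G.int_pow_mult del: plus_fun_apply)
next
  case (step2 c)
  have "\<theta> (Zscale (c - 1) x) \<otimes> \<theta> x = \<theta> x [^] (c - 1) \<otimes> \<theta> x"
    using step2 assms \<theta>_add[of "Zscale (c - 1) x" x] G.int_pow_mult[of "\<theta> x" "c - 1" 1]
    by simp
  then have "\<theta> (Zscale (c - 1) x) = \<theta> x [^] (c - 1)"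
    using assms G.right_cancel[of "\<theta> x" "\<theta> (Zscale (c - 1) x)" "\<theta> x [^] (c - 1)"] by blast
  then show ?case .
qed

lemma \<theta>_conj_kernel:
  "x \<in> Zvec n \<Longrightarrow> g \<in> carrier G \<Longrightarrow> \<exists>y\<in>Zvec n. g \<otimes> \<theta> x \<otimes> inv g = \<theta> y"
proof -
  assume "x \<in> Zvec n" "g \<in> carrier G"
  then have "g \<otimes> \<theta> x \<otimes> inv g \<in> kernel G H h" using \<theta>_kernel by (simp add: kernel_def)
  then show ?thesis unfolding \<theta>_image[symmetric] by auto
qed

lemma conj_add:
  assumes "x \<in> Zvec n" "y \<in> Zvec n" "g \<in> carrier G"
  shows "g \<otimes> \<theta> (x + y) \<otimes> inv g = (g \<otimes> \<theta> x \<otimes> inv g) \<otimes> (g \<otimes> \<theta> y \<otimes> inv g)"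
  using assms by (simp add: \<theta>_add G.m_assoc del: plus_fun_apply) (simp add: G.m_assoc[symmetric])

text \<open>An off-diagonal entry is a witness without shear. For a diagonal matrix with entries d_0
  and d_j that differ, e_0 + e_j goes to d_0 (e_0 + e_j) + (d_j - d_0) e_j, so in the sheared basis
  the difference becomes an off-diagonal entry; it explains the bound \<open>2 * D\<close>.\<close>

lemma nonscalar_shear:
  assumes g: "g \<in> {a, b}" and n: "0 < n"
    and ns: "\<not> (\<exists>\<epsilon>. \<forall>i<n. g \<otimes> \<theta> (unit_vec i) \<otimes> inv g = \<theta> (Zscale \<epsilon> (unit_vec i)))"
  shows "\<exists>i<n. \<exists>j<n. \<exists>u. \<exists>c\<in>Zbox n (2 * D). i \<noteq> j \<and> c j \<noteq> 0 \<and>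
    g \<otimes> \<theta> (shear u i j (unit_vec i)) \<otimes> inv g = \<theta> (shear u i j c)"
proof -
  obtain p where p: "\<And>i. i < n \<Longrightarrow> p i \<in> Zbox n D"
    "\<And>i. i < n \<Longrightarrow> g \<otimes> \<theta> (unit_vec i) \<otimes> inv g = \<theta> (p i)"
    using \<theta>_conj[OF g] by metis
  have gc: "g \<in> carrier G" using g ab by auto
  have witness: ?thesis if "i < n" "j < n" "c \<in> Zbox n (2 * D)" "i \<noteq> j" "c j \<noteq> 0"
    "g \<otimes> \<theta> (shear u i j (unit_vec i)) \<otimes> inv g = \<theta> (shear u i j c)" for i j u c
    using that by blast
  show ?thesis
  proof (cases "\<exists>i<n. \<exists>j<n. i \<noteq> j \<and> p i j \<noteq> 0")
    case True
    then obtain i j where ij: "i < n" "j < n" "i \<noteq> j" "p i j \<noteq> 0" by blast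
    have pi: "p i \<in> Zbox n (2 * D)" using p(1)[OF ij(1)] by (fastforce simp: Zbox_def)
    show ?thesis
      by (rule witness[where u = False and i = i and j = j and c = "p i"])
        (simp_all add: ij pi shear_def p(2)[OF ij(1)])
  next
    case off: False
    have diag: "p i = Zscale (p i i) (unit_vec i)" if "i < n" for i
    proof (rule ext)
      fix l
      show "p i l = Zscale (p i i) (unit_vec i) l"
      proof (cases "l < n")
        case True
        then show ?thesis using off that by (auto simp: Zscale_def unit_vec_def)
      next
        case False
        then show ?thesis using p(1)[OF that] that by (auto simp: Zbox_def Zvec_def Zscale_def unit_vec_def)
      qed
    qed
    obtain j where j: "j < n" "p j j \<noteq> p 0 0"
    proof -
      have "\<not> (\<forall>i<n. g \<otimes> \<theta> (unit_vec i) \<otimes> inv g = \<theta> (Zscale (p 0 0) (unit_vec i)))"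
        using ns by blast
      then obtain j where "j < n" "g \<otimes> \<theta> (unit_vec j) \<otimes> inv g \<noteq> \<theta> (Zscale (p 0 0) (unit_vec j))"
        by blast
      then have "j < n" "p j j \<noteq> p 0 0" using p(2)[of j] arg_cong[OF diag[of j], of \<theta>] by auto
      then show ?thesis by (rule that)
    qed
    define c where "c = Zscale (p 0 0) (unit_vec 0) + Zscale (p j j - p 0 0) (unit_vec j)"
    have j0: "j \<noteq> 0" using j(2) by (rule contrapos_nn) simp
    have v: "unit_vec 0 \<in> Zvec n" "unit_vec j \<in> Zvec n" using n j by auto
    have "\<bar>p 0 0\<bar> \<le> int D" "\<bar>p j j\<bar> \<le> int D" using p(1) n j by (auto simp: Zbox_def)
    then have c: "c \<in> Zbox n (2 * D)" "c j \<noteq> 0"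
      using j n j0 by (auto simp: c_def Zbox_def Zvec_def Zscale_def unit_vec_def)
    have s: "shear True 0 j (unit_vec 0) = unit_vec 0 + unit_vec j"
      using shear_unit_vec[of 0 j True 0] j0 by simp
    have "shear True 0 j c = p 0 + p j"
      using j0 by (subst diag[OF n], subst diag[OF j(1)])
        (auto simp: c_def shear_def Zscale_def unit_vec_def fun_eq_iff)
    moreover have "g \<otimes> \<theta> (unit_vec 0 + unit_vec j) \<otimes> inv g = \<theta> (p 0 + p j)"
      using conj_add[OF v gc] p(2)[OF n] p(2)[OF j(1)] \<theta>_add[of "p 0" "p j"] p(1)[OF n] p(1)[OF j(1)]
      by (metis Zbox_Zvec)
    ultimately show ?thesis using j0 c s n j(1)
      by (intro witness[where u = True and i = 0 and j = j and c = c]) (simp_all del: plus_fun_apply)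
  qed
qed

text \<open>Conjugation by the inverse of a generator preserves the kernel too, so the scalar
  divides 1 and is a sign. Signs multiply and are their own inverses, which carries the property to
  the generated group.\<close>

lemma scalar_everywhere:
  assumes inj: "inj_on \<theta> (Zvec n)" and n: "0 < n" and gen: "generate G {a, b} = carrier G"
    and sc: "\<And>g. g \<in> {a, b} \<Longrightarrow> \<exists>\<epsilon>. \<forall>i<n. g \<otimes> \<theta> (unit_vec i) \<otimes> inv g = \<theta> (Zscale \<epsilon> (unit_vec i))"
    and g: "g \<in> carrier G"
  shows "\<exists>\<epsilon>. \<epsilon> * \<epsilon> = 1 \<and> (\<forall>x\<in>Zvec n. g \<otimes> \<theta> x \<otimes> inv g = \<theta> (Zscale \<epsilon> x))"
proof -
  have ab': "{a, b} \<subseteq> carrier G" using ab by auto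
  have base: "\<exists>\<epsilon>. \<epsilon> * \<epsilon> = 1 \<and> (\<forall>x\<in>Zvec n. g \<otimes> \<theta> x \<otimes> inv g = \<theta> (Zscale \<epsilon> x))" if gab: "g \<in> {a, b}" for g
  proof -
    obtain \<epsilon> where \<epsilon>: "\<And>i. i < n \<Longrightarrow> g \<otimes> \<theta> (unit_vec i) \<otimes> inv g = \<theta> (Zscale \<epsilon> (unit_vec i))"
      using sc[OF gab] by auto
    have gc: "g \<in> carrier G" using gab ab by auto
    have all: "g \<otimes> \<theta> x \<otimes> inv g = \<theta> (Zscale \<epsilon> x)" if x: "x \<in> Zvec n" for x
    proof (rule hom_eq_on_support[OF G.is_group, where n = n and I = UNIV and x = x
          and \<theta> = "\<lambda>x. g \<otimes> \<theta> x \<otimes> inv g" and \<theta>' = "\<lambda>x. \<theta> (Zscale \<epsilon> x)"])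
      show "\<theta> (Zscale \<epsilon> (x + y)) = \<theta> (Zscale \<epsilon> x) \<otimes> \<theta> (Zscale \<epsilon> y)"
        if "x \<in> Zvec n" "y \<in> Zvec n" for x y
        unfolding Zscale_simps by (rule \<theta>_add) (use that in auto)
    qed (use gc conj_add \<epsilon> x in auto)
    have e0: "unit_vec 0 \<in> Zvec n" using n by auto
    obtain y where y: "y \<in> Zvec n" "inv g \<otimes> \<theta> (unit_vec 0) \<otimes> inv (inv g) = \<theta> y"
      using \<theta>_conj_kernel[OF e0, of "inv g"] gc by auto
    have "\<theta> (unit_vec 0) = g \<otimes> (inv g \<otimes> \<theta> (unit_vec 0) \<otimes> inv (inv g)) \<otimes> inv g"
      using gc e0 by (simp add: G.m_assoc) (simp add: G.m_assoc[symmetric])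
    then have "\<theta> (unit_vec 0) = \<theta> (Zscale \<epsilon> y)" using y all by simp
    then have "unit_vec 0 = Zscale \<epsilon> y" using inj y(1) e0 by (auto dest: inj_onD)
    then have "\<epsilon> * y 0 = 1" by (metis Zscale_def of_bool_eq(2) unit_vec_def)
    then have "\<epsilon> * \<epsilon> = 1" by (auto simp: zmult_eq_1_iff)
    then show ?thesis using all by blast
  qed
  have "g \<in> generate G {a, b}" using g gen by simp
  then show ?thesis
  proof (induction rule: generate.induct)
    case one
    then show ?case by (intro exI[of _ 1]) auto
  next
    case (incl g)
    then show ?case by (rule base)
  next
    case (inv g)
    then obtain \<epsilon> where \<epsilon>: "\<epsilon> * \<epsilon> = 1" "\<And>x. x \<in> Zvec n \<Longrightarrow> g \<otimes> \<theta> x \<otimes> inv g = \<theta> (Zscale \<epsilon> x)"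
      using base by blast
    have gc: "g \<in> carrier G" using inv ab by auto
    have "inv g \<otimes> \<theta> x \<otimes> inv (inv g) = \<theta> (Zscale \<epsilon> x)" if x: "x \<in> Zvec n" for x
    proof -
      have "\<theta> x = g \<otimes> \<theta> (Zscale \<epsilon> x) \<otimes> inv g" using \<epsilon>(1) \<epsilon>(2)[of "Zscale \<epsilon> x"] x by simp
      then show ?thesis using gc x by (simp add: G.m_assoc) (simp add: G.m_assoc[symmetric])
    qed
    then show ?case using \<epsilon>(1) by blast
  next
    case (eng g g')
    then obtain \<epsilon> \<epsilon>' where \<epsilon>: "\<epsilon> * \<epsilon> = 1" "\<And>x. x \<in> Zvec n \<Longrightarrow> g \<otimes> \<theta> x \<otimes> inv g = \<theta> (Zscale \<epsilon> x)"
      "\<epsilon>' * \<epsilon>' = 1" "\<And>x. x \<in> Zvec n \<Longrightarrow> g' \<otimes> \<theta> x \<otimes> inv g' = \<theta> (Zscale \<epsilon>' x)"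
      by metis
    have c: "g \<in> carrier G" "g' \<in> carrier G" using eng G.generate_in_carrier[OF ab'] by auto
    have "g \<otimes> g' \<otimes> \<theta> x \<otimes> inv (g \<otimes> g') = \<theta> (Zscale (\<epsilon> * \<epsilon>') x)" if x: "x \<in> Zvec n" for x
    proof -
      have "g \<otimes> g' \<otimes> \<theta> x \<otimes> inv (g \<otimes> g') = g \<otimes> (g' \<otimes> \<theta> x \<otimes> inv g') \<otimes> inv g"
        using c x by (simp add: G.inv_mult_group G.m_assoc)
      then show ?thesis using \<epsilon> x by simp
    qed
    moreover have "(\<epsilon> * \<epsilon>') * (\<epsilon> * \<epsilon>') = (\<epsilon> * \<epsilon>) * (\<epsilon>' * \<epsilon>')" by (simp only: ac_simps)
    then have "(\<epsilon> * \<epsilon>') * (\<epsilon> * \<epsilon>') = 1" using \<epsilon>(1,3) by simp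
    ultimately show ?case by blast
  qed
qed

text \<open>If both generators acted by scalars, the whole group would act by signs; the inverse of
  \<theta> provides coordinates on the kernel to which the transfer argument applies.\<close>

lemma nonscalar_exists:
  assumes inj: "inj_on \<theta> (Zvec n)" and n: "3 \<le> n" and gen: "generate G {a, b} = carrier G"
  shows "\<exists>g\<in>{a, b}. \<not> (\<exists>\<epsilon>. \<forall>i<n. g \<otimes> \<theta> (unit_vec i) \<otimes> inv g = \<theta> (Zscale \<epsilon> (unit_vec i)))"
proof (rule ccontr)
  assume neg: "\<not> ?thesis"
  define \<psi> where "\<psi> = inv_into (Zvec n) \<theta>"
  have \<psi>: "\<psi> (\<theta> x) = x" if "x \<in> Zvec n" for x using that inj by (simp add: \<psi>_def)
  have ker: "\<exists>x\<in>Zvec n. k = \<theta> x" if "k \<in> kernel G H h" for k using that \<theta>_image by auto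
  show False
  proof (rule no_scalar_action_of_two_generated[OF gen finH surj, of \<psi>])
    fix k k' assume "k \<in> kernel G H h" "k' \<in> kernel G H h"
    then obtain x y where xy: "x \<in> Zvec n" "y \<in> Zvec n" "k = \<theta> x" "k' = \<theta> y" using ker by metis
    then show "\<psi> (k \<otimes> k') = \<psi> k + \<psi> k'" using \<psi>[of "x + y"] \<psi> by (simp add: \<theta>_add)
  next
    fix i :: nat assume "i < 3"
    then have "unit_vec i \<in> Zvec n" using n by auto
    then show "\<exists>k\<in>kernel G H h. \<psi> k = unit_vec i" using \<psi> \<theta>_kernel by blast
  next
    fix g assume g: "g \<in> carrier G"
    obtain \<epsilon> where \<epsilon>: "\<epsilon> * \<epsilon> = 1" "\<And>x. x \<in> Zvec n \<Longrightarrow> g \<otimes> \<theta> x \<otimes> inv g = \<theta> (Zscale \<epsilon> x)"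
      using scalar_everywhere[OF inj _ gen _ g] n neg by (metis not_gr_zero not_numeral_le_zero)
    have "\<psi> (g \<otimes> k \<otimes> inv g) j = \<epsilon> * \<psi> k j" if "k \<in> kernel G H h" for k j
    proof -
      obtain x where x: "x \<in> Zvec n" "k = \<theta> x" using ker[OF \<open>k \<in> kernel G H h\<close>] by blast
      have "\<psi> (g \<otimes> k \<otimes> inv g) = Zscale \<epsilon> x" using x \<epsilon>(2) \<psi>[of "Zscale \<epsilon> x"] by simp
      then show ?thesis using \<psi> x by (simp add: Zscale_def)
    qed
    then show "\<exists>\<epsilon>::int. \<epsilon> * \<epsilon> = 1 \<and> (\<forall>k\<in>kernel G H h. \<forall>j. \<psi> (g \<otimes> k \<otimes> inv g) j = \<epsilon> * \<psi> k j)"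
      using \<epsilon>(1) by blast
  qed
qed

end

section \<open>Comparing several lattice kernels in one group\<close>

text \<open>A power of \<open>\<theta> x\<close> lies in the second kernel, which is abelian, and the first one is torsion free.\<close>

lemma lattice_kernels_commute:
  assumes lk: "lattice_kernel G H h S n \<theta> a b D l" and lk': "lattice_kernel G H' h' S n \<theta>' a b D l'"
    and inj: "inj_on \<theta> (Zvec n)" and x: "x \<in> Zvec n" and y: "y \<in> Zvec n"
  shows "\<theta>' y \<otimes>\<^bsub>G\<^esub> \<theta> x = \<theta> x \<otimes>\<^bsub>G\<^esub> \<theta>' y"
proof -
  interpret L: lattice_kernel G H h S n \<theta> a b D l by (rule lk)
  interpret L': lattice_kernel G H' h' S n \<theta>' a b D l' by (rule lk')
  define m where "m = order H'"
  have m: "m \<noteq> 0" using L'.finH L'.H.one_closed unfolding m_def order_def by auto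
  let ?k = "\<theta>' y"
  obtain w where w: "w \<in> Zvec n" "?k \<otimes>\<^bsub>G\<^esub> \<theta> x \<otimes>\<^bsub>G\<^esub> inv\<^bsub>G\<^esub> ?k = \<theta> w"
    using L.\<theta>_conj_kernel[OF x L'.\<theta>_closed[OF y]] by blast
  have pow: "?k \<otimes>\<^bsub>G\<^esub> \<theta> (Zscale (int k) x) \<otimes>\<^bsub>G\<^esub> inv\<^bsub>G\<^esub> ?k = \<theta> (Zscale (int k) w)" for k
  proof (induction k)
    case 0
    show ?case using y by (simp add: L.\<theta>_0 del: zero_fun_apply)
  next
    case (Suc k)
    have e: "Zscale (int (Suc k)) v = v + Zscale (int k) v" for v
      by (auto simp: Zscale_def fun_eq_iff algebra_simps)
    show ?case
      unfolding e L.conj_add[OF x Zscale_Zvec[OF x] L'.\<theta>_closed[OF y]] Suc.IH w(2)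
      by (rule L.\<theta>_add[symmetric]) (use w in auto)
  qed
  have "h' (\<theta> (Zscale (int m) x)) = h' (\<theta> x) [^]\<^bsub>H'\<^esub> m"
    using L.\<theta>_scale[OF x, of "int m"] L'.hom_nat_pow[of "\<theta> x" m] x by (simp add: int_pow_int)
  also have "\<dots> = \<one>\<^bsub>H'\<^esub>"
    unfolding m_def using x by (intro L'.H.pow_order_eq_1) auto
  finally have "\<theta> (Zscale (int m) x) \<in> kernel G H' h'" using x by (simp add: kernel_def)
  then obtain z where z: "z \<in> Zvec n" "\<theta> (Zscale (int m) x) = \<theta>' z"
    using L'.\<theta>_image by auto
  have "?k \<otimes>\<^bsub>G\<^esub> \<theta>' z \<otimes>\<^bsub>G\<^esub> inv\<^bsub>G\<^esub> ?k = \<theta>' z"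
    using L'.\<theta>_commute[OF y z(1)] y z(1) by (simp add: L.G.m_assoc)
  then have "\<theta> (Zscale (int m) w) = \<theta> (Zscale (int m) x)" using pow[of m] z by simp
  then have "Zscale (int m) w = Zscale (int m) x" using inj w(1) x by (auto dest: inj_onD)
  then have "w = x" using m by (simp add: Zscale_cancel)
  then have "?k \<otimes>\<^bsub>G\<^esub> \<theta> x \<otimes>\<^bsub>G\<^esub> inv\<^bsub>G\<^esub> ?k \<otimes>\<^bsub>G\<^esub> ?k = \<theta> x \<otimes>\<^bsub>G\<^esub> ?k" using w by simp
  then show ?thesis using x y by (simp add: L.G.m_assoc)
qed

text \<open>The quotient of the two roots lies in the reference kernel and commutes with the first
  root, so its own \<open>c\<close>-th power is trivial; the reference kernel is torsion free. A
  root is thus determined by its class in the finite group \<open>H\<close>.\<close>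

lemma lattice_kernel_root_unique:
  assumes lk: "lattice_kernel G H h S n \<theta> a b D l" and inj: "inj_on \<theta> (Zvec n)"
    and lk': "lattice_kernel G H' h' S n \<theta>' a b D l'" and lk'': "lattice_kernel G H'' h'' S n \<theta>'' a b D l''"
    and v: "v \<in> Zvec n" "w \<in> Zvec n" and c: "c \<noteq> 0"
    and pow: "\<theta>' (Zscale c v) = \<theta>'' (Zscale c w)" and eq: "h (\<theta>' v) = h (\<theta>'' w)"
  shows "\<theta>' v = \<theta>'' w"
proof -
  interpret L: lattice_kernel G H h S n \<theta> a b D l by (rule lk)
  interpret L': lattice_kernel G H' h' S n \<theta>' a b D l' by (rule lk')
  interpret L'': lattice_kernel G H'' h'' S n \<theta>'' a b D l'' by (rule lk'')
  have cl: "\<theta>' v \<in> carrier G" "\<theta>'' w \<in> carrier G" using v by auto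
  have "inv\<^bsub>G\<^esub> \<theta>' v \<otimes>\<^bsub>G\<^esub> \<theta>'' w \<in> kernel G H h" using cl eq by (simp add: kernel_def)
  then obtain z where z: "z \<in> Zvec n" "inv\<^bsub>G\<^esub> \<theta>' v \<otimes>\<^bsub>G\<^esub> \<theta>'' w = \<theta> z"
    using L.\<theta>_image by auto
  have zc: "\<theta> z \<in> carrier G" using z by auto
  have y': "\<theta>'' w = \<theta>' v \<otimes>\<^bsub>G\<^esub> \<theta> z"
    unfolding z(2)[symmetric] using cl by (simp add: L.G.m_assoc[symmetric])
  have "\<theta>' v [^]\<^bsub>G\<^esub> c = \<theta>'' w [^]\<^bsub>G\<^esub> c" using pow L'.\<theta>_scale L''.\<theta>_scale v by simp
  also have "\<dots> = \<theta>' v [^]\<^bsub>G\<^esub> c \<otimes>\<^bsub>G\<^esub> \<theta> z [^]\<^bsub>G\<^esub> c"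
    unfolding y' using lattice_kernels_commute[OF lk lk' inj z(1) v(1)] cl zc
    by (intro L.G.int_pow_mult_distrib) auto
  finally have "\<theta> z [^]\<^bsub>G\<^esub> c = \<one>\<^bsub>G\<^esub>" using cl zc by simp
  then have "\<theta> (Zscale c z) = \<theta> (Zscale c 0)" using L.\<theta>_scale[OF z(1), of c] L.\<theta>_0 by simp
  then have "Zscale c z = Zscale c 0" using inj z(1) by (auto dest: inj_onD)
  then have "z = 0" using c Zscale_cancel by blast
  then show ?thesis using y' cl L.\<theta>_0 by simp
qed

lemma lattice_kernel_eqI:
  assumes lk: "lattice_kernel G H h S n \<theta> a b D l" and lk': "lattice_kernel G H' h' S n \<theta>' a b D l'"
    and eq: "\<And>j. j < n \<Longrightarrow> \<theta> (unit_vec j) = \<theta>' (unit_vec j)"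
  shows "kernel G H h = kernel G H' h'"
proof -
  interpret L: lattice_kernel G H h S n \<theta> a b D l by (rule lk)
  interpret L': lattice_kernel G H' h' S n \<theta>' a b D l' by (rule lk')
  have "\<theta> x = \<theta>' x" if "x \<in> Zvec n" for x
    by (rule hom_eq_on_support[OF L.G.is_group, where I = UNIV and n = n])
      (use eq that in \<open>auto simp: L.\<theta>_add L'.\<theta>_add simp del: plus_fun_apply\<close>)
  then show ?thesis unfolding L.\<theta>_image[symmetric] L'.\<theta>_image[symmetric] by auto
qed

text \<open>Since \<open>c j \<noteq> 0\<close>, the conjugation relation expresses a nonzero
  multiple of the generator for \<open>unit_vec j\<close>, which the shear fixes, through the other
  sheared generators. Taking the root costs only a class in \<open>H\<^sub>0\<close>, and the shear
  is then undone to recover all generators.\<close>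

lemma lattice_kernel_eqI_shear:
  assumes lk0: "lattice_kernel G H\<^sub>0 h\<^sub>0 S n \<theta>\<^sub>0 a b D l\<^sub>0" and inj: "inj_on \<theta>\<^sub>0 (Zvec n)"
    and lk: "lattice_kernel G H h S n \<theta> a b D l" and lk': "lattice_kernel G H' h' S n \<theta>' a b D l'"
    and ij: "i < n" "j < n" "i \<noteq> j" and c: "c \<in> Zvec n" "c j \<noteq> 0" and g: "g \<in> carrier G"
    and conj: "g \<otimes>\<^bsub>G\<^esub> \<theta> (shear u i j (unit_vec i)) \<otimes>\<^bsub>G\<^esub> inv\<^bsub>G\<^esub> g = \<theta> (shear u i j c)"
      "g \<otimes>\<^bsub>G\<^esub> \<theta>' (shear u i j (unit_vec i)) \<otimes>\<^bsub>G\<^esub> inv\<^bsub>G\<^esub> g = \<theta>' (shear u i j c)"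
    and eq: "\<And>m. m < n \<Longrightarrow> m \<noteq> j \<Longrightarrow> \<theta> (shear u i j (unit_vec m)) = \<theta>' (shear u i j (unit_vec m))"
    and eq0: "h\<^sub>0 (\<theta> (unit_vec j)) = h\<^sub>0 (\<theta>' (unit_vec j))"
  shows "kernel G H h = kernel G H' h'"
proof -
  interpret L: lattice_kernel G H h S n \<theta> a b D l by (rule lk)
  interpret L': lattice_kernel G H' h' S n \<theta>' a b D l' by (rule lk')
  have off_j: "\<theta> (shear u i j x) = \<theta>' (shear u i j x)" if x: "x \<in> Zvec n" "x j = 0" for x
  proof (rule hom_eq_on_support[OF L.G.is_group, where I = "- {j}" and n = n and x = x
        and \<theta> = "\<lambda>x. \<theta> (shear u i j x)" and \<theta>' = "\<lambda>x. \<theta>' (shear u i j x)"])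
    show "\<theta> (shear u i j (x + y)) = \<theta> (shear u i j x) \<otimes>\<^bsub>G\<^esub> \<theta> (shear u i j y)"
      "\<theta>' (shear u i j (x + y)) = \<theta>' (shear u i j x) \<otimes>\<^bsub>G\<^esub> \<theta>' (shear u i j y)"
      if "x \<in> Zvec n" "y \<in> Zvec n" for x y
      unfolding shear_add using that ij by (auto intro!: L.\<theta>_add L'.\<theta>_add)
  qed (use x ij eq in auto)
  let ?d = "c(j := 0)" and ?e = "Zscale (c j) (unit_vec j)"
  have d: "?d \<in> Zvec n" "shear u i j ?d \<in> Zvec n" "?e \<in> Zvec n" "unit_vec j \<in> Zvec n"
    using c ij by (auto simp: Zvec_def shear_def Zscale_def unit_vec_def)
  have split: "shear u i j c = shear u i j ?d + ?e"
    using ij by (auto simp: shear_def Zscale_def unit_vec_def fun_eq_iff)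
  have "\<theta> (shear u i j (unit_vec i)) = \<theta>' (shear u i j (unit_vec i))" using eq ij by auto
  then have "\<theta> (shear u i j ?d) \<otimes>\<^bsub>G\<^esub> \<theta> ?e = \<theta>' (shear u i j ?d) \<otimes>\<^bsub>G\<^esub> \<theta>' ?e"
    using conj L.\<theta>_add[OF d(2,3)] L'.\<theta>_add[OF d(2,3)] unfolding split by simp
  then have "\<theta> ?e = \<theta>' ?e"
    using off_j[OF d(1)] d by simp
  then have ej: "\<theta> (unit_vec j) = \<theta>' (unit_vec j)"
    by (rule lattice_kernel_root_unique[OF lk0 inj lk lk' d(4,4) c(2) _ eq0])
  show ?thesis
  proof (rule lattice_kernel_eqI[OF lk lk'])
    fix m assume m: "m < n"
    show "\<theta> (unit_vec m) = \<theta>' (unit_vec m)"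
    proof (cases "m = j")
      case True
      then show ?thesis using ej by simp
    next
      case False
      have v: "unit_vec m \<in> Zvec n" using m by auto
      show ?thesis
      proof (cases "m = i \<and> u")
        case True
        then have "\<theta> (unit_vec m) \<otimes>\<^bsub>G\<^esub> \<theta> (unit_vec j) = \<theta>' (unit_vec m) \<otimes>\<^bsub>G\<^esub> \<theta>' (unit_vec j)"
          using eq[OF m False] L.\<theta>_add[OF v d(4)] L'.\<theta>_add[OF v d(4)] shear_unit_vec[OF ij(3), of u m]
          by simp
        then show ?thesis using ej v d(4) by simp
      next
        case False
        have "shear u i j (unit_vec m) = unit_vec m + 0"
          unfolding shear_unit_vec[OF ij(3), of u m] if_not_P[OF False] ..
        then show ?thesis using eq[OF m \<open>m \<noteq> j\<close>] by simp
      qed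
    qed
  qed
qed

text \<open>The two exponents of \<open>l\<close> differ by \<open>n\<close>, so
  \<open>l ^ n\<close> would stay below \<open>K\<close>.\<close>

lemma infinite_power_bound:
  fixes \<Lambda> :: "nat set"
  assumes inf: "infinite \<Lambda>" and n: "1 \<le> n"
    and le: "\<And>l. l \<in> \<Lambda> \<Longrightarrow> 1 \<le> l \<Longrightarrow> l ^ (n * n) \<le> K * (l ^ n) ^ (n - 1)"
  shows False
proof -
  have "l \<le> K" if l: "l \<in> \<Lambda>" for l
  proof (cases "l = 0")
    case False
    have "l ^ (n * n) = l ^ n * (l ^ n) ^ (n - 1)"
    proof -
      obtain m where m: "n = Suc m" using n by (cases n) auto
      show ?thesis unfolding power_mult m diff_Suc_1 by (rule power_Suc)
    qed
    then have "l ^ n * (l ^ n) ^ (n - 1) \<le> K * (l ^ n) ^ (n - 1)" using le[OF l] False by simp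
    then have "l ^ n \<le> K" using False by (auto dest: mult_right_le_imp_le)
    moreover have "l \<le> l ^ n" using False n by (simp add: self_le_power)
    ultimately show ?thesis by simp
  qed simp
  then have "\<Lambda> \<subseteq> {..K}" by auto
  then show False using inf finite_subset by blast
qed

text \<open>If some \<theta> has a relation, a kernel is given by n generators from a ball of O(l ^
  (n - 1)) elements; otherwise by n - 1 generators from a ball of O(l ^ n) elements and a bounded
  amount of further data. The two products agree.\<close>

theorem (in group) no_large_lattice_families:
  fixes P :: "'u \<Rightarrow> ('p, 'd) monoid_scheme" and Cls :: "nat \<Rightarrow> 'u set"
  assumes n: "3 \<le> n" and gen: "generate G {a, b} = carrier G" and finS: "finite S"
    and inf: "infinite \<Lambda>"
    and big: "\<And>l. l \<in> \<Lambda> \<Longrightarrow> l ^ (n * n) \<le> c * card (Cls l)"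
    and lk: "\<And>l U. l \<in> \<Lambda> \<Longrightarrow> U \<in> Cls l \<Longrightarrow> lattice_kernel G (P U) (h U) S n (\<theta> U) a b D l"
    and inj: "\<And>l. l \<in> \<Lambda> \<Longrightarrow> inj_on (\<lambda>U. kernel G (P U) (h U)) (Cls l)"
    and growth: "\<And>r. card (wball G S r) \<le> C * (r + 1) ^ n"
    and growth': "\<And>l U. l \<in> \<Lambda> \<Longrightarrow> U \<in> Cls l \<Longrightarrow> \<not> inj_on (\<theta> U) (Zvec n) \<Longrightarrow>
      \<exists>C. \<forall>r. card (wball G S r) \<le> C * (r + 1) ^ (n - 1)"
  shows False
proof -
  have ball: "card (wball G S (E * l)) \<le> C * (E + 1) ^ d * l ^ d"
    if "\<And>r. card (wball G S r) \<le> C * (r + 1) ^ d" "1 \<le> l" for C E d l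
  proof -
    have "card (wball G S (E * l)) \<le> C * (E * l + 1) ^ d" by (rule that)
    also have "\<dots> \<le> C * ((E + 1) * l) ^ d"
      using that(2) by (intro mult_left_mono power_mono) auto
    finally show ?thesis by (simp only: power_mult_distrib mult.assoc)
  qed
  note fin_ball = finite_wball[OF finS]
  show False
  proof (cases "\<exists>l\<in>\<Lambda>. \<exists>U\<in>Cls l. \<not> inj_on (\<theta> U) (Zvec n)")
    case True
    then obtain C' where C': "\<And>r. card (wball G S r) \<le> C' * (r + 1) ^ (n - 1)"
      using growth' by meson
    define B where "B = C' * (D + 1) ^ (n - 1)"
    have "l ^ (n * n) \<le> c * B ^ n * (l ^ n) ^ (n - 1)" if l: "l \<in> \<Lambda>" "1 \<le> l" for l
    proof -
      let ?X = "{..<n} \<rightarrow>\<^sub>E wball G S (D * l)"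
      let ?f = "\<lambda>U. \<lambda>j\<in>{..<n}. \<theta> U (unit_vec j)"
      have "card (Cls l) \<le> card ?X"
      proof (rule card_inj_on_le[of ?f])
        show "inj_on ?f (Cls l)"
        proof (rule inj_onI)
          fix U V assume UV: "U \<in> Cls l" "V \<in> Cls l" "?f U = ?f V"
          have "\<theta> U (unit_vec j) = \<theta> V (unit_vec j)" if "j < n" for j
            using fun_cong[OF UV(3), of j] that by simp
          then have "kernel G (P U) (h U) = kernel G (P V) (h V)"
            by (rule lattice_kernel_eqI[OF lk[OF l(1) UV(1)] lk[OF l(1) UV(2)]])
          then show "U = V" using inj[OF l(1)] UV by (auto dest: inj_onD)
        qed
        show "?f ` Cls l \<subseteq> ?X"
        proof (intro image_subsetI restrict_PiE_iff[THEN iffD2] ballI)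
          fix U j assume "U \<in> Cls l" "j \<in> {..<n}"
          then show "\<theta> U (unit_vec j) \<in> wball G S (D * l)"
            using lattice_kernel.\<theta>_ball[OF lk[OF l(1)]] by auto
        qed
        show "finite ?X" using fin_ball by (intro finite_PiE) auto
      qed
      also have "card ?X = card (wball G S (D * l)) ^ n" by (simp add: card_PiE)
      also have "\<dots> \<le> (B * l ^ (n - 1)) ^ n"
        unfolding B_def using ball[OF C' l(2)] by (intro power_mono) auto
      also have "\<dots> = B ^ n * (l ^ n) ^ (n - 1)"
        by (simp add: power_mult_distrib mult.commute flip: power_mult)
      finally have "c * card (Cls l) \<le> c * (B ^ n * (l ^ n) ^ (n - 1))" by (rule mult_left_mono) simp
      then show ?thesis using big[OF l(1)] unfolding mult.assoc by (rule order_trans[rotated])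
    qed
    then show False using n by (intro infinite_power_bound[OF inf, of n "c * B ^ n"]) linarith+
  next
    case False
    then have inj\<theta>: "inj_on (\<theta> U) (Zvec n)" if "l \<in> \<Lambda>" "U \<in> Cls l" for l U using that by blast
    \<comment> \<open>Any member can be the reference for taking roots; it is fixed once for all
      \<open>l\<close>, so the order of its quotient is a constant.\<close>
    obtain l0 U0 where U0: "l0 \<in> \<Lambda>" "U0 \<in> Cls l0"
    proof -
      have "\<not> \<Lambda> \<subseteq> {0}" using inf finite_subset by blast
      then obtain l where l: "l \<in> \<Lambda>" "l \<noteq> 0" by blast
      then have "0 < l ^ (n * n)" by simp
      then have "0 < c * card (Cls l)" using big[OF l(1)] by (rule less_le_trans)
      then have "card (Cls l) \<noteq> 0" by auto
      then show ?thesis using that[OF l(1)] by fastforce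
    qed
    note lk0 = lk[OF U0]
    let ?H0 = "carrier (P U0)"
    have "\<forall>U\<in>(\<Union>l\<in>\<Lambda>. Cls l). \<exists>t. case t of (g, i, j, u, w) \<Rightarrow> g \<in> {a, b} \<and> i < n \<and> j < n \<and>
        w \<in> Zbox n (2 * D) \<and> i \<noteq> j \<and> w j \<noteq> 0 \<and>
        g \<otimes> \<theta> U (shear u i j (unit_vec i)) \<otimes> inv g = \<theta> U (shear u i j w)"
    proof
      fix U assume "U \<in> (\<Union>l\<in>\<Lambda>. Cls l)"
      then obtain l where l: "l \<in> \<Lambda>" "U \<in> Cls l" by blast
      obtain g where g: "g \<in> {a, b}"
        "\<not> (\<exists>\<epsilon>. \<forall>i<n. g \<otimes> \<theta> U (unit_vec i) \<otimes> inv g = \<theta> U (Zscale \<epsilon> (unit_vec i)))"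
        using lattice_kernel.nonscalar_exists[OF lk[OF l] inj\<theta>[OF l] n gen] by blast
      then show "\<exists>t. case t of (g, i, j, u, w) \<Rightarrow> g \<in> {a, b} \<and> i < n \<and> j < n \<and>
        w \<in> Zbox n (2 * D) \<and> i \<noteq> j \<and> w j \<noteq> 0 \<and>
        g \<otimes> \<theta> U (shear u i j (unit_vec i)) \<otimes> inv g = \<theta> U (shear u i j w)"
        using lattice_kernel.nonscalar_shear[OF lk[OF l] g(1) _ g(2)] n by fastforce
    qed
    then obtain t where t: "\<And>U. U \<in> (\<Union>l\<in>\<Lambda>. Cls l) \<Longrightarrow>
        case t U of (g, i, j, u, w) \<Rightarrow> g \<in> {a, b} \<and> i < n \<and> j < n \<and>
        w \<in> Zbox n (2 * D) \<and> i \<noteq> j \<and> w j \<noteq> 0 \<and>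
        g \<otimes> \<theta> U (shear u i j (unit_vec i)) \<otimes> inv g = \<theta> U (shear u i j w)"
      by (meson bchoice)
    define \<tau> where "\<tau> U = (case t U of (g, i, j, u, w) \<Rightarrow>
      \<lambda>m\<in>{..<n} - {j}. \<theta> U (shear u i j (unit_vec m)))" for U
    define \<eta> where "\<eta> U = (case t U of (g, i, j, u, w) \<Rightarrow> h U0 (\<theta> U (unit_vec j)))" for U
    \<comment> \<open>All possible conjugation witnesses; their number does not depend on
      \<open>l\<close>.\<close>
    define A where "A = {a, b} \<times> {..<n} \<times> {..<n} \<times> (UNIV :: bool set) \<times> Zbox n (2 * D)"
    define B where "B = C * (2 * D + 1) ^ n"
    have finA: "finite A" unfolding A_def by auto
    have "l ^ (n * n) \<le> c * (card A * (n * B ^ (n - 1) * card ?H0)) * (l ^ n) ^ (n - 1)"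
      if l: "l \<in> \<Lambda>" "1 \<le> l" for l
    proof -
      let ?X = "\<Union>j<n. ({..<n} - {j}) \<rightarrow>\<^sub>E wball G S (2 * D * l)"
      let ?f = "\<lambda>U. (t U, \<tau> U, \<eta> U)"
      have finX: "finite ?X" using fin_ball by (intro finite_UN_I finite_PiE) auto
      have "card (Cls l) \<le> card (A \<times> ?X \<times> ?H0)"
      proof (rule card_inj_on_le[of ?f])
        show "inj_on ?f (Cls l)"
        proof (rule inj_onI)
          fix U V assume UV: "U \<in> Cls l" "V \<in> Cls l" "?f U = ?f V"
          obtain g i j u w where tU: "t U = (g, i, j, u, w)" by (cases "t U")
          then have tV: "t V = (g, i, j, u, w)" using UV(3) by simp
          have "U \<in> (\<Union>l\<in>\<Lambda>. Cls l)" "V \<in> (\<Union>l\<in>\<Lambda>. Cls l)" using UV l by auto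
          note tt = t[OF this(1), unfolded tU prod.case] t[OF this(2), unfolded tV prod.case]
          have "\<tau> U = \<tau> V" "\<eta> U = \<eta> V" using UV(3) by auto
          note \<tau>\<eta> = this[unfolded \<tau>_def \<eta>_def tU tV prod.case]
          have "kernel G (P U) (h U) = kernel G (P V) (h V)"
          proof (rule lattice_kernel_eqI_shear[OF lk0 inj\<theta>[OF U0] lk[OF l(1) UV(1)] lk[OF l(1) UV(2)]])
            show "g \<in> carrier G"
              using tt(1) lattice_kernel.ab[OF lk0] by auto
            show "w \<in> Zvec n" using tt(1) Zbox_Zvec by blast
            show "\<theta> U (shear u i j (unit_vec m)) = \<theta> V (shear u i j (unit_vec m))"
              if "m < n" "m \<noteq> j" for m
              using fun_cong[OF \<tau>\<eta>(1), of m] that by simp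
          qed (use tt \<tau>\<eta> in auto)
          then show "U = V" using inj[OF l(1)] UV by (auto dest: inj_onD)
        qed
        show "?f ` Cls l \<subseteq> A \<times> ?X \<times> ?H0"
        proof (rule image_subsetI)
          fix U assume U: "U \<in> Cls l"
          interpret L: lattice_kernel G "P U" "h U" S n "\<theta> U" a b D l by (rule lk[OF l(1) U])
          interpret L0: lattice_kernel G "P U0" "h U0" S n "\<theta> U0" a b D l0 by (rule lk0)
          obtain g i j u w where tU: "t U = (g, i, j, u, w)" by (cases "t U")
          have "U \<in> (\<Union>l\<in>\<Lambda>. Cls l)" using U l by auto
          note tt = t[OF this, unfolded tU prod.case]
          \<comment> \<open>A sheared generator is a product of at most two generators, whence the
            radius \<open>2 * D * l\<close>.\<close>
          have "\<theta> U (shear u i j (unit_vec m)) \<in> wball G S (2 * D * l)" if m: "m < n" for m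
          proof -
            have v: "unit_vec m \<in> Zvec n" "unit_vec j \<in> Zvec n" using m tt by auto
            have "\<theta> U (if m = i \<and> u then unit_vec j else 0) \<in> wball G S (D * l)"
              using L.\<theta>_ball[of j] tt L.\<theta>_0 by (auto simp: zero_fun_def)
            then have "\<theta> U (unit_vec m) \<otimes> \<theta> U (if m = i \<and> u then unit_vec j else 0) \<in> wball G S (D * l + D * l)"
              by (rule wball_mult[OF L.S L.\<theta>_ball[OF m]])
            moreover have "\<theta> U (shear u i j (unit_vec m)) =
                \<theta> U (unit_vec m) \<otimes> \<theta> U (if m = i \<and> u then unit_vec j else 0)"
            proof (subst shear_unit_vec)
              show "i \<noteq> j" using tt by blast
              show "\<theta> U (unit_vec m + (if m = i \<and> u then unit_vec j else 0)) =
                \<theta> U (unit_vec m) \<otimes> \<theta> U (if m = i \<and> u then unit_vec j else 0)"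
                by (rule L.\<theta>_add[OF v(1)]) (use v in auto)
            qed
            ultimately show ?thesis by (simp add: mult_2 add_mult_distrib)
          qed
          then have "\<tau> U \<in> ({..<n} - {j}) \<rightarrow>\<^sub>E wball G S (2 * D * l)"
            by (auto simp: \<tau>_def tU)
          then have "\<tau> U \<in> ?X" using tt by blast
          moreover have "unit_vec j \<in> Zvec n" using tt by auto
          then have "\<eta> U \<in> ?H0" by (simp add: \<eta>_def tU)
          moreover have "t U \<in> A" using tt by (auto simp: A_def tU)
          ultimately show "?f U \<in> A \<times> ?X \<times> ?H0" by blast
        qed
        show "finite (A \<times> ?X \<times> ?H0)"
          using finA finX lattice_kernel.finH[OF lk0] by blast
      qed
      also have "\<dots> = card A * (card ?X * card ?H0)" by (simp only: card_cartesian_product)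
      also have "card ?X \<le> n * (B * l ^ n) ^ (n - 1)"
      proof -
        have "card ?X \<le> (\<Sum>j<n. card (({..<n} - {j}) \<rightarrow>\<^sub>E wball G S (2 * D * l)))"
          by (rule card_UN_le) simp
        also have "\<dots> = (\<Sum>j<n. card (wball G S (2 * D * l)) ^ (n - 1))"
          by (rule sum.cong) (auto simp: card_PiE)
        also have "\<dots> = n * card (wball G S (2 * D * l)) ^ (n - 1)" by simp
        also have "\<dots> \<le> n * (B * l ^ n) ^ (n - 1)"
          unfolding B_def using ball[OF growth l(2), of "2 * D"]
          by (intro mult_left_mono power_mono) auto
        finally show ?thesis .
      qed
      finally have "card (Cls l) \<le> card A * (n * (B * l ^ n) ^ (n - 1) * card ?H0)"
        by simp
      then have "c * card (Cls l) \<le> c * (card A * (n * (B * l ^ n) ^ (n - 1) * card ?H0))"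
        by (rule mult_left_mono) simp
      also have "\<dots> = c * (card A * (n * B ^ (n - 1) * card ?H0)) * (l ^ n) ^ (n - 1)"
        by (simp add: power_mult_distrib ac_simps)
      finally show ?thesis using big[OF l(1)] by linarith
    qed
    then show False
      using n by (intro infinite_power_bound[OF inf, of n "c * (card A * (n * B ^ (n - 1) * card ?H0))"]) linarith+
  qed
qed

section \<open>A family of lattices\<close>

text \<open>\<open>comb n l E p\<close> is the combination with coefficients \<open>p\<close> of the rows of the matrix
  \<open>3 n l I + E\<close>.\<close>

definition comb :: "nat \<Rightarrow> nat \<Rightarrow> (nat \<times> nat \<Rightarrow> int) \<Rightarrow> (nat \<Rightarrow> int) \<Rightarrow> nat \<Rightarrow> int" where
  "comb n l E p = (\<lambda>i. if i < n then int (3 * n * l) * p i + (\<Sum>j<n. p j * E (j, i)) else 0)"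

definition perturbations :: "nat \<Rightarrow> nat \<Rightarrow> (nat \<times> nat \<Rightarrow> int) set" where
  "perturbations n l = ({..<n} \<times> {..<n}) \<rightarrow>\<^sub>E {0..<int l}"

lemma card_perturbations: "card (perturbations n l) = l ^ (n * n)"
  by (simp add: perturbations_def card_PiE card_cartesian_product)

lemma finite_perturbations: "finite (perturbations n l)"
  by (simp add: perturbations_def finite_PiE)

lemma perturbations_bounds:
  "E \<in> perturbations n l \<Longrightarrow> i < n \<Longrightarrow> j < n \<Longrightarrow> 0 \<le> E (i, j) \<and> E (i, j) < int l"
  by (auto simp: perturbations_def PiE_def Pi_def)

lemma comb_Zvec [simp, intro]: "comb n l E p \<in> Zvec n"
  by (simp add: comb_def Zvec_def)

lemma comb_add: "comb n l E (p + q) = comb n l E p + comb n l E q"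
  by (auto simp: comb_def fun_eq_iff algebra_simps sum.distrib)

lemma comb_diff: "comb n l E (p - q) = comb n l E p - comb n l E q"
  by (auto simp: comb_def fun_eq_iff algebra_simps sum_subtractf)

lemma comb_0: "comb n l E 0 = 0"
  by (auto simp: comb_def fun_eq_iff)

lemma comb_unit_vec: "j < n \<Longrightarrow> i < n \<Longrightarrow>
    comb n l E (unit_vec j) i = int (3 * n * l) * of_bool (i = j) + E (j, i)"
  by (simp add: comb_def unit_vec_def if_distrib[of "\<lambda>x. x * _"] flip: of_bool_def cong: if_cong)

lemma perturbation_sum_bound:
  assumes E: "E \<in> perturbations n l" and i: "i < n" and p: "\<And>j. j < n \<Longrightarrow> \<bar>p j\<bar> \<le> B"
  shows "\<bar>\<Sum>j<n. p j * E (j, i)\<bar> \<le> int (n * l) * B"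
proof -
  have "\<bar>\<Sum>j<n. p j * E (j, i)\<bar> \<le> (\<Sum>j<n. \<bar>p j * E (j, i)\<bar>)" by (rule sum_abs)
  also have "\<dots> \<le> (\<Sum>j<n. B * int l)"
  proof (rule sum_mono)
    fix j assume "j \<in> {..<n}"
    then have "\<bar>p j\<bar> \<le> B" "\<bar>E (j, i)\<bar> \<le> int l" using perturbations_bounds[OF E _ i, of j] p by auto
    moreover have "0 \<le> \<bar>p j\<bar>" by simp
    ultimately show "\<bar>p j * E (j, i)\<bar> \<le> B * int l"
      unfolding abs_mult by (intro mult_mono) linarith+
  qed
  finally show ?thesis by (simp add: algebra_simps)
qed

text \<open>At a coordinate where p is largest in absolute value, the diagonal contributes 3 n l
  times that value and the n perturbations, each below l, take away at most n l times it. The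
  diagonal is as large as it is for the sake of this dominance.\<close>

lemma comb_lower_bound:
  assumes E: "E \<in> perturbations n l" and R: "comb n l E p \<in> Zbox n R" and k: "k < n"
  shows "int (2 * n * l) * \<bar>p k\<bar> \<le> int R"
proof -
  obtain m where m: "m < n" "\<And>j. j < n \<Longrightarrow> \<bar>p j\<bar> \<le> \<bar>p m\<bar>"
  proof -
    have "Max ((\<lambda>j. \<bar>p j\<bar>) ` {..<n}) \<in> (\<lambda>j. \<bar>p j\<bar>) ` {..<n}" using k by (intro Max_in) auto
    then obtain m where "m < n" "\<bar>p m\<bar> = Max ((\<lambda>j. \<bar>p j\<bar>) ` {..<n})" by auto
    then show ?thesis by (intro that[of m]) auto
  qed
  have "\<bar>\<Sum>j<n. p j * E (j, m)\<bar> \<le> int (n * l) * \<bar>p m\<bar>"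
    by (rule perturbation_sum_bound[OF E m(1) m(2)])
  moreover have "\<bar>comb n l E p m\<bar> \<le> int R" using R m(1) by (auto simp: Zbox_def)
  then have "\<bar>int (3 * n * l) * p m + (\<Sum>j<n. p j * E (j, m))\<bar> \<le> int R" using m(1) by (simp add: comb_def)
  moreover have "\<bar>int (3 * n * l) * p m\<bar> = 3 * (int (n * l) * \<bar>p m\<bar>)" by (simp add: abs_mult)
  ultimately have "2 * (int (n * l) * \<bar>p m\<bar>) \<le> int R" by linarith
  moreover have "int (n * l) * \<bar>p k\<bar> \<le> int (n * l) * \<bar>p m\<bar>" using m(2)[OF k] by (intro mult_left_mono) auto
  ultimately have "2 * (int (n * l) * \<bar>p k\<bar>) \<le> int R" by linarith
  then show ?thesis by (simp add: mult.assoc)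
qed

lemma comb_unit_vec_Zbox:
  assumes E: "E \<in> perturbations n l" and j: "j < n"
  shows "comb n l E (unit_vec j) \<in> Zbox n (4 * n * l)"
proof -
  have "\<bar>comb n l E (unit_vec j) i\<bar> \<le> int (4 * n * l)" if i: "i < n" for i
  proof -
    have "0 \<le> E (j, i)" "E (j, i) < int l" using perturbations_bounds[OF E j i] by auto
    moreover have "int l \<le> int (n * l)" using j by (simp only: of_nat_le_iff) simp
    moreover have "0 \<le> int (3 * n * l) * of_bool (i = j)" "int (3 * n * l) * of_bool (i = j) \<le> 3 * int (n * l)"
      by (auto simp: of_bool_def)
    ultimately have "\<bar>comb n l E (unit_vec j) i\<bar> \<le> 4 * int (n * l)"
      unfolding comb_unit_vec[OF j i] by linarith
    then show ?thesis by simp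
  qed
  then show ?thesis by (simp add: Zbox_def)
qed

text \<open>With N = n * l, division by the diagonal 3 * N leaves a remainder below 3 * N, and the
  perturbation adds at most r / 3 + N. The total r / 3 + 4 * N is below r exactly when r exceeds 6 *
  N, so the reduction can be repeated down to that radius.\<close>

lemma comb_cobounded:
  assumes E: "E \<in> perturbations n l" and n: "1 \<le> n" "1 \<le> l" and x: "x \<in> Zvec n"
  shows "\<exists>p\<in>Zvec n. x - comb n l E p \<in> Zbox n (6 * n * l)"
proof -
  define N where "N = int (n * l)"
  have "1 \<le> n * l" using n by simp
  then have N: "1 \<le> N" unfolding N_def by linarith
  obtain r where "x \<in> Zbox n r"
  proof -
    have "\<bar>x i\<bar> \<le> int (l1_norm n x)" if "i < n" for i
      using that member_le_sum[of i "{..<n}" "\<lambda>i. nat \<bar>x i\<bar>"] by (auto simp: l1_norm_def nat_le_iff)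
    then show ?thesis using x by (intro that[of "l1_norm n x"]) (auto simp: Zbox_def)
  qed
  then show ?thesis
    using x
  proof (induction r arbitrary: x rule: less_induct)
    case (less r)
    show ?case
    proof (cases "r \<le> 6 * n * l")
      case True
      then have "int r \<le> int (6 * n * l)" by (simp only: of_nat_le_iff)
      then have "x \<in> Zbox n (6 * n * l)" using less(2) order_trans unfolding Zbox_def by blast
      then have "x - comb n l E 0 \<in> Zbox n (6 * n * l)" by (simp only: comb_0 diff_0_right)
      then show ?thesis by blast
    next
      case False
      then have "6 * (n * l) < r" by (simp add: mult.assoc)
      then have r: "6 * N < int r" unfolding N_def by linarith
      define p where "p = (\<lambda>i. x i div (3 * N))"
      have p: "p \<in> Zvec n" using less(3) by (auto simp: p_def Zvec_def)
      define B where "B = (int r + 3 * N) div (3 * N)"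
      have B: "3 * N * B \<le> int r + 3 * N"
        using mult_div_mod_eq[of "3 * N" "int r + 3 * N"] pos_mod_sign[of "3 * N" "int r + 3 * N"] N
        unfolding B_def by linarith
      have pB: "\<bar>p j\<bar> \<le> B" if j: "j < n" for j
      proof -
        have "x j = 3 * N * p j + x j mod (3 * N)" by (simp add: p_def)
        moreover have "0 \<le> x j mod (3 * N)" "x j mod (3 * N) < 3 * N" using N by auto
        moreover have "\<bar>x j\<bar> \<le> int r" using less(2) j by (auto simp: Zbox_def)
        ultimately have "\<bar>3 * N * p j\<bar> \<le> int r + 3 * N" by linarith
        then have "3 * N * \<bar>p j\<bar> \<le> int r + 3 * N" using N by (simp add: abs_mult)
        then have "(3 * N * \<bar>p j\<bar>) div (3 * N) \<le> B" unfolding B_def using N by (intro zdiv_mono1) auto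
        then show ?thesis using N by simp
      qed
      let ?y = "x - comb n l E p"
      have "\<bar>?y i\<bar> \<le> int (r - 1)" if i: "i < n" for i
      proof -
        have "\<bar>\<Sum>j<n. p j * E (j, i)\<bar> \<le> N * B"
          unfolding N_def by (rule perturbation_sum_bound[OF E i pB])
        moreover have "?y i = x i mod (3 * N) - (\<Sum>j<n. p j * E (j, i))"
          using i by (simp add: comb_def p_def N_def minus_mod_eq_mult_div[symmetric] mult.assoc)
        moreover have "0 \<le> x i mod (3 * N)" "x i mod (3 * N) < 3 * N" using N by auto
        ultimately show ?thesis using B r N by linarith
      qed
      then have y: "?y \<in> Zbox n (r - 1)" using less(3) by (simp add: Zbox_def)
      have yv: "?y \<in> Zvec n" using less(3) by auto
      have "r - 1 < r" using r N by linarith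
      then obtain q where q: "q \<in> Zvec n" "?y - comb n l E q \<in> Zbox n (6 * n * l)"
        using less(1)[OF _ y yv] by blast
      then have "x - comb n l E (p + q) \<in> Zbox n (6 * n * l)"
        by (simp only: comb_add diff_diff_eq)
      then show ?thesis using p q by blast
    qed
  qed
qed

text \<open>A row of one matrix has coefficients of size at most 2 in the rows of the other, by the
  bounds 4 n l above and 2 n l below. Off the diagonal a nonzero coefficient would contribute at
  least 3 N, more than the perturbations can balance; on the diagonal both entries lie between 3 N
  and 4 N, which leaves only the coefficient 1.\<close>

lemma comb_lattice_inj:
  assumes E: "E \<in> perturbations n l" and F: "F \<in> perturbations n l" and n: "1 \<le> n" "1 \<le> l"
    and eq: "comb n l E ` Zvec n = comb n l F ` Zvec n"
  shows "E = F"
proof -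
  define N where "N = int (n * l)"
  have "1 \<le> n * l" "l \<le> n * l" using n by auto
  then have N: "1 \<le> N" "int l \<le> N" unfolding N_def by linarith+
  have "E (j, i) = F (j, i)" if j: "j < n" and i: "i < n" for i j
  proof -
    have "comb n l E (unit_vec j) \<in> comb n l F ` Zvec n" using j eq by blast
    then obtain p where p: "p \<in> Zvec n" "comb n l E (unit_vec j) = comb n l F p" by blast
    have p2: "\<bar>p k\<bar> \<le> 2" if k: "k < n" for k
    proof -
      have "int (2 * n * l) * \<bar>p k\<bar> \<le> int (4 * n * l)"
        using comb_lower_bound[OF F _ k] comb_unit_vec_Zbox[OF E j] p(2) by metis
      then have "N * \<bar>p k\<bar> \<le> N * 2" by (simp add: N_def ac_simps)
      then show ?thesis using N by (simp add: mult_le_cancel_left)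
    qed
    have coord: "3 * N * of_bool (m = j) + E (j, m) = 3 * N * p m + (\<Sum>k<n. p k * F (k, m))"
      if m: "m < n" for m
      using fun_cong[OF p(2), of m] m unfolding comb_unit_vec[OF j m] by (simp add: comb_def N_def mult.assoc)
    have zero: "p m = 0" if m: "m < n" "m \<noteq> j" for m
    proof -
      have "\<bar>\<Sum>k<n. p k * F (k, m)\<bar> \<le> N * 2"
        unfolding N_def by (rule perturbation_sum_bound[OF F m(1) p2])
      moreover have "E (j, m) = 3 * N * p m + (\<Sum>k<n. p k * F (k, m))" using coord[OF m(1)] m(2) by simp
      moreover have "0 \<le> E (j, m)" "E (j, m) < int l" using perturbations_bounds[OF E j m(1)] by auto
      ultimately have "\<bar>3 * N * p m\<bar> < 3 * N" using N by linarith
      then have "3 * N * \<bar>p m\<bar> < 3 * N * 1" using N by (simp add: abs_mult)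
      then have "\<bar>p m\<bar> < 1" using N by (simp add: mult_less_cancel_left)
      then show ?thesis by simp
    qed
    have sum: "(\<Sum>k<n. p k * F (k, m)) = p j * F (j, m)" for m
    proof -
      have "(\<Sum>k<n. p k * F (k, m)) = (\<Sum>k<n. if k = j then p j * F (j, m) else 0)"
        by (rule sum.cong) (use zero in auto)
      then show ?thesis using j by simp
    qed
    have c: "3 * N + E (j, j) = p j * (3 * N + F (j, j))"
      using coord[OF j] by (simp add: sum algebra_simps)
    have b: "0 \<le> E (j, j)" "E (j, j) < int l" "0 \<le> F (j, j)"
      using perturbations_bounds[OF E j j] perturbations_bounds[OF F j j] by auto
    have "p j \<in> {-2, -1, 0, 1, 2}" using p2[OF j] by auto
    then have "p j = 1"
    proof (elim insertE emptyE)
    qed (use c b N in auto)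
    then show ?thesis using coord[OF i] zero[OF i] by (cases "i = j") (simp_all add: sum)
  qed
  then show ?thesis
    using E F unfolding perturbations_def by (intro PiE_ext) auto
qed

section \<open>Lattice kernels from coarse covers\<close>

lemma card_Zslab:
  assumes i: "i < n"
  shows "card {x \<in> Zbox n R. \<bar>x i\<bar> \<le> int W} \<le> (2 * W + 1) * (2 * R + 1) ^ (n - 1)"
proof -
  let ?X = "{- int W..int W} \<times> (({..<n} - {i}) \<rightarrow>\<^sub>E {- int R..int R})"
  let ?f = "\<lambda>x. (x i, restrict x ({..<n} - {i}))"
  have "card {x \<in> Zbox n R. \<bar>x i\<bar> \<le> int W} \<le> card ?X"
  proof (rule card_inj_on_le[of ?f])
    show "inj_on ?f {x \<in> Zbox n R. \<bar>x i\<bar> \<le> int W}"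
    proof (rule inj_onI)
      fix x y assume xy: "x \<in> {x \<in> Zbox n R. \<bar>x i\<bar> \<le> int W}" "y \<in> {x \<in> Zbox n R. \<bar>x i\<bar> \<le> int W}" "?f x = ?f y"
      have "x j = y j" for j
      proof (cases "j < n \<and> j \<noteq> i")
        case True
        have "restrict x ({..<n} - {i}) j = restrict y ({..<n} - {i}) j" using xy(3) by simp
        then show ?thesis using True by simp
      next
        case False
        then show ?thesis using xy by (cases "j = i") (auto simp: Zbox_def Zvec_def)
      qed
      then show "x = y" by blast
    qed
    show "?f ` {x \<in> Zbox n R. \<bar>x i\<bar> \<le> int W} \<subseteq> ?X"
    proof (rule image_subsetI)
      fix x assume x: "x \<in> {x \<in> Zbox n R. \<bar>x i\<bar> \<le> int W}"
      have "x j \<in> {- int R..int R}" if "j \<in> {..<n} - {i}" for j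
      proof -
        have "\<bar>x j\<bar> \<le> int R" using x that by (simp add: Zbox_def)
        then show ?thesis by auto
      qed
      then have "restrict x ({..<n} - {i}) \<in> ({..<n} - {i}) \<rightarrow>\<^sub>E {- int R..int R}"
        unfolding restrict_PiE_iff by blast
      moreover have "x i \<in> {- int W..int W}" using x by auto
      ultimately show "?f x \<in> ?X" by simp
    qed
    show "finite ?X" by (auto intro: finite_PiE)
  qed
  also have "card ?X = (2 * W + 1) * (2 * R + 1) ^ (n - 1)"
    using i by (simp add: card_cartesian_product card_PiE nat_add_distrib nat_mult_distrib)
  finally show ?thesis .
qed

lemma abs_int_div_le:
  fixes a b :: int
  assumes b: "b \<noteq> 0"
  shows "\<bar>a div b\<bar> \<le> \<bar>a\<bar>"
proof (rule ccontr)
  assume "\<not> ?thesis"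
  then have "\<bar>b\<bar> * (\<bar>a\<bar> + 1) \<le> \<bar>b\<bar> * \<bar>a div b\<bar>" by (intro mult_left_mono) auto
  moreover have "b * (a div b) = a - a mod b" by (rule minus_mod_eq_mult_div[symmetric])
  then have "\<bar>b\<bar> * \<bar>a div b\<bar> = \<bar>a - a mod b\<bar>" by (metis abs_mult)
  moreover have "\<bar>a mod b\<bar> < \<bar>b\<bar>" using b by (rule abs_mod_less)
  moreover have "1 * \<bar>a\<bar> \<le> \<bar>b\<bar> * \<bar>a\<bar>" using b by (intro mult_right_mono) auto
  ultimately show False by (simp add: algebra_simps)
qed

text \<open>Adding a multiple of the period \<open>m\<close> brings coordinate \<open>i\<close> into
  a range independent of \<open>r\<close>, at the price of a box larger by the factor
  \<open>1 + W\<close>. Short elements are then covered by a slab, which has one dimension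
  less.\<close>

lemma (in group) periodic_cover_growth:
  assumes finS: "finite S"
    and cover: "\<And>q r. q \<in> wball G S r \<Longrightarrow> \<exists>p\<in>Zbox n (s * r). \<exists>b\<in>wball G S C. q = \<Phi> p \<otimes> b"
    and m: "m \<in> Zvec n" "m \<noteq> 0" and per: "\<And>x. x \<in> Zvec n \<Longrightarrow> \<Phi> (m + x) = \<Phi> x"
  shows "\<exists>C'. \<forall>r. card (wball G S r) \<le> C' * (r + 1) ^ (n - 1)"
proof -
  obtain i where i: "i < n" "m i \<noteq> 0"
    using m by (auto simp: Zvec_def fun_eq_iff) (meson not_le)
  define W where "W = l1_norm n m"
  have mW: "\<bar>m j\<bar> \<le> int W" if "j < n" for j
    using that member_le_sum[of j "{..<n}" "\<lambda>i. nat \<bar>m i\<bar>"] by (auto simp: W_def l1_norm_def nat_le_iff)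
  have step: "\<Phi> (Zscale t m + x) = \<Phi> (Zscale (t + 1) m + x)" if x: "x \<in> Zvec n" for t x
  proof -
    have "Zscale (t + 1) m + x = m + (Zscale t m + x)" by (simp add: ac_simps)
    then show ?thesis using per[of "Zscale t m + x"] x m(1) by (metis Zscale_Zvec Zvec_closed(2))
  qed
  have perT: "\<Phi> (Zscale t m + x) = \<Phi> x" if x: "x \<in> Zvec n" for t x
  proof (induction t rule: int_induct[where k = 0])
    case base
    show ?case by (simp only: Zscale_simps add_0)
  next
    case (step1 t)
    then show ?case using step[OF x, of t] by metis
  next
    case (step2 t)
    then show ?case using step[OF x, of "t - 1"] by (metis diff_add_cancel)
  qed
  define Y where "Y r = {x \<in> Zbox n (s * r * (1 + W)). \<bar>x i\<bar> \<le> int W}" for r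
  have cardY: "card (Y r) \<le> (2 * W + 1) * (2 * (s * r * (1 + W)) + 1) ^ (n - 1)" for r
    unfolding Y_def by (rule card_Zslab[OF i(1)])
  have sub: "wball G S r \<subseteq> (\<lambda>(p, b). \<Phi> p \<otimes> b) ` (Y r \<times> wball G S C)" for r
  proof
    fix q assume "q \<in> wball G S r"
    then obtain p b where p: "p \<in> Zbox n (s * r)" "b \<in> wball G S C" "q = \<Phi> p \<otimes> b"
      using cover by blast
    define t where "t = - (p i div m i)"
    let ?p = "Zscale t m + p"
    have pv: "p \<in> Zvec n" using p(1) by (rule Zbox_Zvec)
    have "\<bar>p i\<bar> \<le> int (s * r)" using p(1) i by (auto simp: Zbox_def)
    moreover have "\<bar>p i div m i\<bar> \<le> \<bar>p i\<bar>" using i(2) by (rule abs_int_div_le)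
    ultimately have t: "\<bar>t\<bar> \<le> int (s * r)" by (simp add: t_def)
    have "\<bar>?p j\<bar> \<le> int (s * r * (1 + W))" if j: "j < n" for j
    proof -
      have "\<bar>t * m j\<bar> \<le> int (s * r) * int W"
        unfolding abs_mult using t mW[OF j] by (intro mult_mono) auto
      moreover have "\<bar>p j\<bar> \<le> int (s * r)" using p(1) j by (auto simp: Zbox_def)
      ultimately have "\<bar>t * m j + p j\<bar> \<le> int (s * r) + int (s * r) * int W" by linarith
      then show ?thesis by (simp add: Zscale_def algebra_simps)
    qed
    moreover have "\<bar>?p i\<bar> \<le> int W"
    proof -
      have "?p i = p i mod m i" by (simp add: Zscale_def t_def minus_div_mult_eq_mod[symmetric])
      moreover have "\<bar>p i mod m i\<bar> \<le> \<bar>m i\<bar>" using i(2) abs_mod_less[of "m i" "p i"] by simp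
      ultimately show ?thesis using mW[OF i(1)] by linarith
    qed
    ultimately have "?p \<in> Y r" using pv m(1) by (auto simp: Y_def Zbox_def)
    moreover have "q = \<Phi> ?p \<otimes> b" using p(3) perT[OF pv, of t] by simp
    ultimately show "q \<in> (\<lambda>(p, b). \<Phi> p \<otimes> b) ` (Y r \<times> wball G S C)"
      using p(2) by (intro image_eqI[of _ _ "(?p, b)"]) simp_all
  qed
  define c where "c = 2 * (s * (1 + W)) + 1"
  have "card (wball G S r) \<le> (2 * W + 1) * c ^ (n - 1) * card (wball G S C) * (r + 1) ^ (n - 1)" for r
  proof -
    have "finite (Y r \<times> wball G S C)" using finite_wball[OF finS] by (auto simp: Y_def)
    then have "card (wball G S r) \<le> card (Y r \<times> wball G S C)"
      by (rule surj_card_le[OF _ sub])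
    also have "\<dots> = card (Y r) * card (wball G S C)" by (rule card_cartesian_product)
    also have "\<dots> \<le> (2 * W + 1) * (2 * (s * r * (1 + W)) + 1) ^ (n - 1) * card (wball G S C)"
      using cardY by (rule mult_right_mono) simp
    also have "\<dots> \<le> (2 * W + 1) * (c * (r + 1)) ^ (n - 1) * card (wball G S C)"
      by (intro mult_right_mono mult_left_mono power_mono) (auto simp: c_def algebra_simps)
    finally show ?thesis by (simp only: power_mult_distrib ac_simps)
  qed
  then show ?thesis by blast
qed

lemma (in group) cover_growth:
  assumes finS: "finite S"
    and cover: "\<And>q r. q \<in> wball G S r \<Longrightarrow> \<exists>p\<in>Zbox n (s * r). \<exists>b\<in>wball G S C. q = \<Phi> p \<otimes> b"
  shows "card (wball G S r) \<le> card (wball G S C) * (2 * s + 1) ^ n * (r + 1) ^ n"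
proof -
  have "wball G S r \<subseteq> (\<lambda>(p, b). \<Phi> p \<otimes> b) ` (Zbox n (s * r) \<times> wball G S C)"
    using cover by fast
  moreover have "finite (Zbox n (s * r) \<times> wball G S C)" using finite_wball[OF finS] by auto
  ultimately have "card (wball G S r) \<le> card (Zbox n (s * r) \<times> wball G S C)"
    by (rule surj_card_le[rotated])
  also have "\<dots> = (2 * (s * r) + 1) ^ n * card (wball G S C)"
    by (simp only: card_cartesian_product card_Zbox)
  also have "\<dots> \<le> ((2 * s + 1) * (r + 1)) ^ n * card (wball G S C)"
    by (intro mult_right_mono power_mono) (auto simp: algebra_simps)
  finally show ?thesis by (simp only: power_mult_distrib ac_simps)
qed

text \<open>\<theta> is the cover restricted to the lattice, in coordinates with respect to the
  rows. The conjugation matrices are bounded independently of \<open>l\<close> because a conjugated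
  generator still has length O(l), and lattice vectors of size O(l) have bounded
  coordinates.\<close>

theorem (in group_hom) coarse_cover_lattice_kernel:
  assumes S: "S \<subseteq> carrier G" and finS: "finite S" and gen: "generate G S = carrier G"
    and finH: "finite (carrier H)" and surj: "h ` carrier G = carrier H"
    and n: "1 \<le> n" and l: "1 \<le> l" and E: "E \<in> perturbations n l"
    and f: "\<And>x. x \<in> Zvec n \<Longrightarrow> f x \<in> carrier H" "f 0 = \<one>\<^bsub>H\<^esub>"
    and per: "\<And>x p. x \<in> Zvec n \<Longrightarrow> p \<in> Zvec n \<Longrightarrow> f (x + comb n l E p) = f x"
    and lip: "\<And>x i. x \<in> Zvec n \<Longrightarrow> i < n \<Longrightarrow>
      \<exists>b\<in>wball G S L. f (x + unit_vec i) = f x \<otimes>\<^bsub>H\<^esub> h b"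
    and ctrl: "\<And>x y b. x \<in> Zvec n \<Longrightarrow> y \<in> Zvec n \<Longrightarrow> b \<in> wball G S (2 * C + 1) \<Longrightarrow>
      f y = f x \<otimes>\<^bsub>H\<^esub> h b \<Longrightarrow> \<exists>p\<in>Zvec n. y - x - comb n l E p \<in> Zbox n s"
    and dense: "\<And>q. q \<in> carrier G \<Longrightarrow> \<exists>x\<in>Zvec n. \<exists>b\<in>wball G S C. h q = f x \<otimes>\<^bsub>H\<^esub> h b"
    and R: "4 * L \<le> R" "L * (n * s) + 2 * C + 1 \<le> R"
    and ker: "\<And>g. g \<in> wball G S R \<Longrightarrow> h g = \<one>\<^bsub>H\<^esub> \<Longrightarrow> g = \<one>"
    and ab: "a \<in> wball G S r" "b \<in> wball G S r"
  shows "\<exists>\<theta>. lattice_kernel G H h S n \<theta> a b (4 * L * n * n + s * (2 * r + 4 * L * n * n + 1)) l \<and>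
    (\<forall>r. card (wball G S r) \<le> card (wball G S C) * (2 * s + 1) ^ n * (r + 1) ^ n) \<and>
    (\<not> inj_on \<theta> (Zvec n) \<longrightarrow> (\<exists>C'. \<forall>r. card (wball G S r) \<le> C' * (r + 1) ^ (n - 1)))"
proof -
  let ?M = "comb n l E ` Zvec n"
  \<comment> \<open>A row has l1 norm at most n * (4 * n * l), and the cover stretches norms by at
    most \<open>L\<close>.\<close>
  define D1 where "D1 = 4 * L * n * n"
  \<comment> \<open>A conjugate of a generator has length at most 2 * r + D1 * l; passing to lattice
    vectors multiplies by \<open>s\<close> and adds \<open>s\<close>, and
    \<open>comb_lower_bound\<close> divides by the scale. The summand \<open>D1\<close> lets the
    same constant bound the lengths of the generators.\<close>
  define D where "D = D1 + s * (2 * r + D1 + 1)"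
  have M: "?M \<subseteq> Zvec n" "0 \<in> ?M" using comb_0[of n l E] by (blast, metis Zvec_closed(1) image_eqI)
  have M': "x - y \<in> ?M" if "x \<in> ?M" "y \<in> ?M" for x y
    using that by (auto simp flip: comb_diff simp del: minus_apply)
  have perM: "f (x + m) = f x" if "x \<in> Zvec n" "m \<in> ?M" for x m using per that by blast
  have ctrlM: "\<exists>m\<in>?M. y - x - m \<in> Zbox n s" if "x \<in> Zvec n" "y \<in> Zvec n"
    "b \<in> wball G S (2 * C + 1)" "f y = f x \<otimes>\<^bsub>H\<^esub> h b" for x y b using ctrl[OF that] by blast
  obtain \<Phi> where \<Phi>: "\<And>x. x \<in> Zvec n \<Longrightarrow> \<Phi> x \<in> carrier G" "\<And>x. x \<in> Zvec n \<Longrightarrow> h (\<Phi> x) = f x"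
    "\<And>m x. m \<in> ?M \<Longrightarrow> x \<in> Zvec n \<Longrightarrow> \<Phi> (m + x) = \<Phi> m \<otimes> \<Phi> x"
    "\<And>x. x \<in> Zvec n \<Longrightarrow> \<Phi> x \<in> wball G S (L * l1_norm n x)"
    "\<And>q r. q \<in> wball G S r \<Longrightarrow> \<exists>p\<in>Zbox n (s * r). \<exists>b\<in>wball G S C. q = \<Phi> p \<otimes> b"
    "\<And>k r. k \<in> wball G S r \<Longrightarrow> h k = \<one>\<^bsub>H\<^esub> \<Longrightarrow> \<exists>m\<in>?M. m \<in> Zbox n (s * r + s) \<and> k = \<Phi> m"
  proof (rule coarse_cover[OF S M M' f perM lip ctrlM dense R ker], assumption+, goal_cases)
    case 1
    show ?case by (rule 1(1)) (fact 1)+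
  qed
  define \<theta> where "\<theta> p = \<Phi> (comb n l E p)" for p
  have \<theta>_add: "\<theta> (x + y) = \<theta> x \<otimes> \<theta> y" if "x \<in> Zvec n" "y \<in> Zvec n" for x y
    using \<Phi>(3)[of "comb n l E x" "comb n l E y"] that unfolding \<theta>_def comb_add by blast
  have \<theta>_ker: "\<theta> x \<in> kernel G H h" if "x \<in> Zvec n" for x
    using per[of 0 x] f(2) \<Phi>(1,2)[of "comb n l E x"] that by (simp add: \<theta>_def kernel_def)
  have \<theta>_ball: "\<theta> (unit_vec j) \<in> wball G S (D1 * l)" if j: "j < n" for j
    unfolding \<theta>_def
  proof (rule G.wball_mono[OF \<Phi>(4)[OF comb_Zvec]])
    have "l1_norm n (comb n l E (unit_vec j)) \<le> n * (4 * n * l)"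
      by (rule l1_norm_le[OF comb_unit_vec_Zbox[OF E j]])
    then have "L * l1_norm n (comb n l E (unit_vec j)) \<le> L * (n * (4 * n * l))" by (rule mult_left_mono) simp
    then show "L * l1_norm n (comb n l E (unit_vec j)) \<le> D1 * l" by (simp add: D1_def ac_simps)
  qed
  have kernel_in: "\<exists>p\<in>Zvec n. k = \<theta> p \<and> (\<forall>i<n. int (2 * n * l) * \<bar>p i\<bar> \<le> int (s * r + s))"
    if k: "k \<in> wball G S r" "h k = \<one>\<^bsub>H\<^esub>" for k r
  proof -
    obtain p where p: "p \<in> Zvec n" "comb n l E p \<in> Zbox n (s * r + s)" "k = \<Phi> (comb n l E p)"
      using \<Phi>(6)[OF k] by blast
    then show ?thesis using comb_lower_bound[OF E p(2)] by (auto simp: \<theta>_def)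
  qed
  have image: "\<theta> ` Zvec n = kernel G H h"
  proof
    show "\<theta> ` Zvec n \<subseteq> kernel G H h" using \<theta>_ker by blast
    show "kernel G H h \<subseteq> \<theta> ` Zvec n"
    proof
      fix k assume k: "k \<in> kernel G H h"
      then have "k \<in> carrier G" "h k = \<one>\<^bsub>H\<^esub>" by (auto simp: kernel_def)
      then obtain r where "k \<in> wball G S r" using G.wball_cover[OF S gen] by blast
      then show "k \<in> \<theta> ` Zvec n" using kernel_in \<open>h k = \<one>\<^bsub>H\<^esub>\<close> by blast
    qed
  qed
  have conj: "\<exists>p\<in>Zbox n D. g \<otimes> \<theta> (unit_vec j) \<otimes> inv g = \<theta> p" if g: "g \<in> wball G S r" and j: "j < n" for g j
  proof -
    have gc: "g \<in> carrier G" using G.wball_closed[OF S g] .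
    have ej: "unit_vec j \<in> Zvec n" using j by auto
    have "g \<otimes> \<theta> (unit_vec j) \<otimes> inv g \<in> wball G S (r + D1 * l + r)"
      using G.wball_mult[OF S G.wball_mult[OF S g \<theta>_ball[OF j]] G.wball_inv[OF S g]] .
    moreover have "h (g \<otimes> \<theta> (unit_vec j) \<otimes> inv g) = \<one>\<^bsub>H\<^esub>"
      using \<theta>_ker[OF ej] gc by (simp add: kernel_def)
    ultimately obtain p where p: "p \<in> Zvec n" "g \<otimes> \<theta> (unit_vec j) \<otimes> inv g = \<theta> p"
      "\<And>i. i < n \<Longrightarrow> int (2 * n * l) * \<bar>p i\<bar> \<le> int (s * (r + D1 * l + r) + s)"
      using kernel_in by blast
    have "\<bar>p i\<bar> \<le> int D" if i: "i < n" for i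
    proof -
      have "s * (r + D1 * l + r) + s \<le> s * ((2 * r + D1 + 1) * l)"
      proof -
        have "r + D1 * l + r + 1 \<le> (2 * r + D1 + 1) * l"
          using l mult_le_mono2[OF l, of "2 * r + 1"] by (simp add: algebra_simps)
        then have "s * (r + D1 * l + r + 1) \<le> s * ((2 * r + D1 + 1) * l)" by (rule mult_left_mono) simp
        then show ?thesis by simp
      qed
      also have "\<dots> \<le> D * l" by (simp add: D_def algebra_simps)
      finally have "int (s * (r + D1 * l + r) + s) \<le> int D * int l"
        by (simp only: of_nat_mult[symmetric] of_nat_le_iff)
      moreover have "int l * \<bar>p i\<bar> \<le> int (2 * n * l) * \<bar>p i\<bar>"
        using n by (intro mult_right_mono) (simp_all only: of_nat_le_iff, simp_all)
      ultimately have "int l * \<bar>p i\<bar> \<le> int l * int D" using p(3)[OF i] by (simp only: mult.commute)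
      then show ?thesis using l by (simp add: mult_le_cancel_left)
    qed
    then have "p \<in> Zbox n D" using p(1) by (simp add: Zbox_def)
    then show ?thesis using p(2) by blast
  qed
  have lk: "lattice_kernel G H h S n \<theta> a b D l"
  proof (unfold_locales, goal_cases)
    case 5
    show ?case using image .
  next
    case (6 j)
    show ?case by (rule G.wball_mono[OF \<theta>_ball[OF 6]]) (simp add: D_def)
  next
    case (9 g j)
    then show ?case using conj ab by blast
  qed (use S finH surj \<theta>_add ab G.wball_closed[OF S] in auto)
  \<comment> \<open>A relation of \<theta> is a nonzero period of \<Phi>, which costs one dimension
    of growth.\<close>
  have "\<exists>C'. \<forall>r. card (wball G S r) \<le> C' * (r + 1) ^ (n - 1)" if ni: "\<not> inj_on \<theta> (Zvec n)"
  proof -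
    obtain p q where pq: "p \<in> Zvec n" "q \<in> Zvec n" "p \<noteq> q" "\<theta> p = \<theta> q"
      using ni by (auto simp: inj_on_def)
    have v: "p - q \<in> Zvec n" using pq by blast
    have "\<theta> p = \<theta> (p - q) \<otimes> \<theta> q" using \<theta>_add[OF v pq(2)] by (simp only: diff_add_cancel)
    moreover have c: "\<theta> x \<in> carrier G" if "x \<in> Zvec n" for x using \<theta>_ker[OF that] by (simp add: kernel_def)
    ultimately have one: "\<theta> (p - q) = \<one>" using pq(4) c[OF v] c[OF pq(2)] by (metis G.r_cancel_one)
    have ne: "comb n l E (p - q) \<noteq> 0"
    proof
      assume "comb n l E (p - q) = 0"
      then have "comb n l E (p - q) \<in> Zbox n 0" by (simp add: Zbox_def)
      then have "(p - q) i = 0" if "i < n" for i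
        using comb_lower_bound[OF E _ that, of "p - q" 0] n l by (simp add: mult_le_0_iff)
      then have "p - q = 0" using v by (auto simp: Zvec_def fun_eq_iff) (metis not_le)
      then show False using pq(3) by (simp only: right_minus_eq)
    qed
    show ?thesis
    proof (rule G.periodic_cover_growth[OF finS \<Phi>(5) comb_Zvec ne])
      show "\<Phi> (comb n l E (p - q) + x) = \<Phi> x" if "x \<in> Zvec n" for x
        using \<Phi>(3)[of "comb n l E (p - q)" x] v that one \<Phi>(1)[OF that] unfolding \<theta>_def by simp
    qed
  qed
  then show ?thesis using lk G.cover_growth[OF finS \<Phi>(5)] unfolding D_def D1_def by blast
qed

section \<open>Distances in box spaces\<close>

lemma coset_group_hom:
  assumes "N \<lhd> G"
  shows "group_hom G (G Mod N) (\<lambda>x. N #>\<^bsub>G\<^esub> x)"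
proof -
  interpret normal N G by (rule assms)
  show ?thesis
    unfolding group_hom_def group_hom_axioms_def
    using r_coset_hom_Mod factorgroup_is_group group_axioms by blast
qed

lemma (in group) r_coset_eq_iff:
  assumes "subgroup N G" "x \<in> carrier G" "y \<in> carrier G"
  shows "N #> x = N #> y \<longleftrightarrow> y \<otimes> inv x \<in> N"
proof
  assume "N #> x = N #> y"
  then have "y \<in> N #> x" using rcos_self[OF assms(3,1)] by simp
  then obtain m where "m \<in> N" "y = m \<otimes> x" by (auto simp: r_coset_def)
  then show "y \<otimes> inv x \<in> N" using assms subgroup.mem_carrier by (fastforce simp: m_assoc)
next
  assume "y \<otimes> inv x \<in> N"
  moreover have "y = (y \<otimes> inv x) \<otimes> x" using assms by (simp add: m_assoc)
  ultimately have "y \<in> N #> x" unfolding r_coset_def by blast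
  then show "N #> x = N #> y" using assms by (intro repr_independence)
qed

text \<open>Balls of the quotient are images of balls of \<open>G\<close>. Closeness within a
  component thus becomes right multiplication by a short element, the form in which the covering
  argument consumes it.\<close>

lemma box_dist_le_iff:
  assumes G: "group G" and S: "finite_generating_set G S" and N: "N \<in> fin_index_normal G"
    and A: "A \<in> carrier (G Mod N)" "B \<in> carrier (G Mod N)"
  shows "box_dist G S (N, A) (N, B) \<le> real r \<longleftrightarrow>
    (\<exists>b\<in>wball G S r. B = A \<otimes>\<^bsub>G Mod N\<^esub> (N #>\<^bsub>G\<^esub> b))"
proof -
  note [simp del] = mult_FactGroup one_FactGroup
  have nN: "N \<lhd> G" using N by (simp add: fin_index_normal_def)
  interpret q: group_hom G "G Mod N" "\<lambda>x. N #>\<^bsub>G\<^esub> x" by (rule coset_group_hom[OF nN])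
  note quot = quot_generating[OF G S N]
  have Sc: "S \<subseteq> carrier G" using S by (simp add: finite_generating_set_def)
  let ?c = "inv\<^bsub>G Mod N\<^esub> A \<otimes>\<^bsub>G Mod N\<^esub> B"
  have c: "?c \<in> carrier (G Mod N)" using A by simp
  have "box_dist G S (N, A) (N, B) \<le> real r \<longleftrightarrow> word_length (G Mod N) (quot_image G S N) ?c \<le> r"
    by (simp add: box_dist_def word_dist_def)
  also have "\<dots> \<longleftrightarrow> ?c \<in> wball (G Mod N) (quot_image G S N) r"
    by (rule q.H.word_length_le_iff[OF quot(2,3) c])
  also have "\<dots> \<longleftrightarrow> ?c \<in> (\<lambda>x. N #>\<^bsub>G\<^esub> x) ` wball G S r"
    unfolding quot_image_def q.wball_image[OF Sc] ..
  also have "\<dots> \<longleftrightarrow> (\<exists>b\<in>wball G S r. B = A \<otimes>\<^bsub>G Mod N\<^esub> (N #>\<^bsub>G\<^esub> b))"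
  proof -
    have "?c = N #>\<^bsub>G\<^esub> b \<longleftrightarrow> B = A \<otimes>\<^bsub>G Mod N\<^esub> (N #>\<^bsub>G\<^esub> b)" if "b \<in> wball G S r" for b
    proof -
      have "N #>\<^bsub>G\<^esub> b \<in> carrier (G Mod N)" using q.G.wball_closed[OF Sc that] by (rule q.hom_closed)
      then show ?thesis using A by (metis q.H.inv_closed q.H.inv_solve_left q.H.inv_inv)
    qed
    then show ?thesis by blast
  qed
  finally show ?thesis .
qed

lemma box_dist_le_diam:
  assumes "group G" "finite_generating_set G S" "N \<in> fin_index_normal G"
    and "A \<in> carrier (G Mod N)" "B \<in> carrier (G Mod N)"
  shows "box_dist G S (N, A) (N, B) \<le> word_diam (G Mod N) (quot_image G S N)"
  using word_dist_le_diam[OF quot_generating(4)[OF assms(1-3)] assms(4,5)] by (simp add: box_dist_def)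

lemma word_diam_nonneg:
  assumes "group G" "finite_generating_set G S" "N \<in> fin_index_normal G"
  shows "0 \<le> word_diam (G Mod N) (quot_image G S N)"
proof -
  have "\<one>\<^bsub>G Mod N\<^esub> \<in> carrier (G Mod N)"
    by (rule monoid.one_closed[OF group.is_monoid[OF quot_generating(1)[OF assms]]])
  from order_trans[OF word_dist_nonneg word_dist_le_diam[OF quot_generating(4)[OF assms] this this]]
  show ?thesis .
qed

section \<open>Control functions of a coarse equivalence\<close>

lemma filterlim_at_top_not_bounded:
  fixes u :: "nat \<Rightarrow> real"
  assumes "\<And>k. u k \<le> r"
  shows "\<not> filterlim u at_top sequentially"
proof
  assume "filterlim u at_top sequentially"
  then have "eventually (\<lambda>k. r + 1 \<le> u k) sequentially" by (simp add: filterlim_at_top)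
  then obtain k where "r + 1 \<le> u k" by (meson eventually_sequentially order_refl)
  then show False using assms[of k] by simp
qed

text \<open>If a uniform bound failed, choosing a counterexample for every k would give sequences
  whose distances stay bounded on one side and diverge on the other.\<close>

lemma coarse_equivalence_control:
  assumes ce: "coarse_equivalence X Y f"
  obtains C :: nat and \<rho> \<sigma> :: "nat \<Rightarrow> nat"
  where "\<And>y. y \<in> mspace Y \<Longrightarrow> \<exists>x\<in>mspace X. mdist Y y (f x) \<le> real C"
    "\<And>x. x \<in> mspace X \<Longrightarrow> f x \<in> mspace Y"
    "\<And>r x x'. x \<in> mspace X \<Longrightarrow> x' \<in> mspace X \<Longrightarrow> mdist X x x' \<le> real r \<Longrightarrow> mdist Y (f x) (f x') \<le> real (\<rho> r)"
    "\<And>r x x'. x \<in> mspace X \<Longrightarrow> x' \<in> mspace X \<Longrightarrow> mdist Y (f x) (f x') \<le> real r \<Longrightarrow> mdist X x x' \<le> real (\<sigma> r)"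
proof -
  note ce' = ce[unfolded coarse_equivalence_def]
  have lim: "filterlim (\<lambda>k::nat. mdist X (x k) (x' k)) at_top sequentially \<longleftrightarrow>
         filterlim (\<lambda>k. mdist Y (f (x k)) (f (x' k))) at_top sequentially"
    if "\<And>k. x k \<in> mspace X" "\<And>k. x' k \<in> mspace X" for x x'
    using ce' that by (simp add: image_subset_iff)
  have diverges: "filterlim u at_top sequentially" if "\<And>k. real k < u k" for u :: "nat \<Rightarrow> real"
    by (rule filterlim_at_top_mono[OF filterlim_real_sequentially]) (use that in \<open>simp add: less_imp_le\<close>)
  have "\<exists>R::nat. \<forall>x\<in>mspace X. \<forall>x'\<in>mspace X. mdist X x x' \<le> real r \<longrightarrow> mdist Y (f x) (f x') \<le> real R" for r :: nat
  proof (rule ccontr)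
    assume "\<not> ?thesis"
    then have "\<forall>k::nat. \<exists>x x'. x \<in> mspace X \<and> x' \<in> mspace X \<and> mdist X x x' \<le> real r \<and> real k < mdist Y (f x) (f x')"
      by (meson not_le)
    then obtain x x' where x: "\<And>k::nat. x k \<in> mspace X" "\<And>k. x' k \<in> mspace X" "\<And>k. mdist X (x k) (x' k) \<le> real r"
      "\<And>k. real k < mdist Y (f (x k)) (f (x' k))"
      by metis
    show False
      using lim[of x x', OF x(1,2)] filterlim_at_top_not_bounded[of "\<lambda>k. mdist X (x k) (x' k)", OF x(3)] diverges[OF x(4)]
      by blast
  qed
  then obtain \<rho> where \<rho>: "\<And>r x x'. x \<in> mspace X \<Longrightarrow> x' \<in> mspace X \<Longrightarrow> mdist X x x' \<le> real r \<Longrightarrow>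
      mdist Y (f x) (f x') \<le> real (\<rho> r)"
    by metis
  have "\<exists>R::nat. \<forall>x\<in>mspace X. \<forall>x'\<in>mspace X. mdist Y (f x) (f x') \<le> real r \<longrightarrow> mdist X x x' \<le> real R" for r :: nat
  proof (rule ccontr)
    assume "\<not> ?thesis"
    then have "\<forall>k::nat. \<exists>x x'. x \<in> mspace X \<and> x' \<in> mspace X \<and> mdist Y (f x) (f x') \<le> real r \<and> real k < mdist X x x'"
      by (meson not_le)
    then obtain x x' where x: "\<And>k::nat. x k \<in> mspace X" "\<And>k. x' k \<in> mspace X"
      "\<And>k. mdist Y (f (x k)) (f (x' k)) \<le> real r" "\<And>k. real k < mdist X (x k) (x' k)"
      by metis
    show False
      using lim[of x x', OF x(1,2)] filterlim_at_top_not_bounded[of "\<lambda>k. mdist Y (f (x k)) (f (x' k))", OF x(3)] diverges[OF x(4)]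
      by blast
  qed
  then obtain \<sigma> where \<sigma>: "\<And>r x x'. x \<in> mspace X \<Longrightarrow> x' \<in> mspace X \<Longrightarrow> mdist Y (f x) (f x') \<le> real r \<Longrightarrow>
      mdist X x x' \<le> real (\<sigma> r)"
    by metis
  obtain C where C: "\<forall>y\<in>mspace Y. \<exists>x\<in>mspace X. mdist Y y (f x) \<le> C" using ce' by blast
  obtain C' :: nat where C': "C \<le> real C'" using real_arch_simple by blast
  show thesis
  proof (rule that[OF _ _ \<rho> \<sigma>])
    show "\<exists>x\<in>mspace X. mdist Y y (f x) \<le> real C'" if "y \<in> mspace Y" for y
      using C C' that order_trans by meson
    show "f x \<in> mspace Y" if "x \<in> mspace X" for x using ce' that by blast
  qed
qed

section \<open>The lattices as finite index subgroups\<close>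

text \<open>Elements of \<open>Zvec n\<close> vanish from \<open>n\<close> on, which lets the
  pointwise class operations act on them; elements of the carrier of
  \<open>int_power_group n\<close> are undefined there. \<open>Zemb\<close> passes from the first
  encoding to the second.\<close>

definition Zemb :: "nat \<Rightarrow> (nat \<Rightarrow> int) \<Rightarrow> nat \<Rightarrow> int" where
  "Zemb n x = restrict x {..<n}"

definition lattice_subgroup :: "nat \<Rightarrow> nat \<Rightarrow> (nat \<times> nat \<Rightarrow> int) \<Rightarrow> (nat \<Rightarrow> int) set" where
  "lattice_subgroup n l E = Zemb n ` comb n l E ` Zvec n"

lemma Zemb_closed [simp, intro]: "Zemb n x \<in> carrier (int_power_group n)"
  by (simp add: Zemb_def int_power_group_def)

lemma Zemb_mult: "Zemb n x \<otimes>\<^bsub>int_power_group n\<^esub> Zemb n y = Zemb n (x + y)"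
  by (auto simp: Zemb_def int_power_group_def product_group_def fun_eq_iff)

lemma Zemb_one: "\<one>\<^bsub>int_power_group n\<^esub> = Zemb n 0"
  by (auto simp: Zemb_def int_power_group_def product_group_def fun_eq_iff)

lemma Zemb_inv: "inv\<^bsub>int_power_group n\<^esub> Zemb n x = Zemb n (- x)"
  by (rule group.inv_equality[OF group_int_power_group]) (simp_all add: Zemb_mult Zemb_one)

lemma Zemb_surj:
  assumes "g \<in> carrier (int_power_group n)"
  obtains x where "x \<in> Zvec n" "g = Zemb n x"
proof (rule that[of "\<lambda>i. if i < n then g i else 0"])
  show "g = Zemb n (\<lambda>i. if i < n then g i else 0)"
    using assms by (auto simp: Zemb_def int_power_group_def fun_eq_iff PiE_def extensional_def)
qed (simp add: Zvec_def)

lemma Zemb_inj: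
  assumes "x \<in> Zvec n" "y \<in> Zvec n" "Zemb n x = Zemb n y"
  shows "x = y"
proof
  fix i
  show "x i = y i"
    using fun_cong[OF assms(3), of i] assms(1,2) by (cases "i < n") (auto simp: Zemb_def Zvec_def)
qed

lemma comm_group_int_power_group: "comm_group (int_power_group n)"
proof (rule group.group_comm_groupI[OF group_int_power_group])
  fix x y assume "x \<in> carrier (int_power_group n)" "y \<in> carrier (int_power_group n)"
  then show "x \<otimes>\<^bsub>int_power_group n\<^esub> y = y \<otimes>\<^bsub>int_power_group n\<^esub> x"
    by (metis Zemb_mult Zemb_surj add.commute)
qed

lemma subgroup_lattice_subgroup: "subgroup (lattice_subgroup n l E) (int_power_group n)"
proof (rule group.subgroupI[OF group_int_power_group])
  show "lattice_subgroup n l E \<subseteq> carrier (int_power_group n)" by (auto simp: lattice_subgroup_def)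
  show "lattice_subgroup n l E \<noteq> {}" by (auto simp: lattice_subgroup_def)
next
  fix g assume "g \<in> lattice_subgroup n l E"
  then obtain p where p: "p \<in> Zvec n" "g = Zemb n (comb n l E p)" by (auto simp: lattice_subgroup_def)
  have "- comb n l E p = comb n l E (- p)" using comb_diff[of n l E 0 p] by (simp only: comb_0 diff_0)
  then show "inv\<^bsub>int_power_group n\<^esub> g \<in> lattice_subgroup n l E"
    using p unfolding lattice_subgroup_def by (simp only: Zemb_inv) blast
next
  fix g g' assume "g \<in> lattice_subgroup n l E" "g' \<in> lattice_subgroup n l E"
  then obtain p q where p: "p \<in> Zvec n" "g = Zemb n (comb n l E p)" "q \<in> Zvec n" "g' = Zemb n (comb n l E q)"
    by (auto simp: lattice_subgroup_def)
  then show "g \<otimes>\<^bsub>int_power_group n\<^esub> g' \<in> lattice_subgroup n l E"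
    unfolding lattice_subgroup_def by (simp only: Zemb_mult comb_add[symmetric]) blast
qed

lemma lattice_coset_eq_iff:
  assumes "x \<in> Zvec n" "y \<in> Zvec n"
  shows "lattice_subgroup n l E #>\<^bsub>int_power_group n\<^esub> Zemb n x = lattice_subgroup n l E #>\<^bsub>int_power_group n\<^esub> Zemb n y
    \<longleftrightarrow> (\<exists>p\<in>Zvec n. y - x = comb n l E p)"
proof -
  have "Zemb n (y + - x) \<in> lattice_subgroup n l E \<longleftrightarrow> (\<exists>p\<in>Zvec n. y + - x = comb n l E p)"
    unfolding lattice_subgroup_def using assms Zemb_inj[of "y + - x" n] by (auto simp del: plus_fun_apply)
  then show ?thesis
    unfolding group.r_coset_eq_iff[OF group_int_power_group subgroup_lattice_subgroup Zemb_closed Zemb_closed]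
    by (simp only: Zemb_inv Zemb_mult diff_conv_add_uminus)
qed

lemma lattice_subgroup_fin_index:
  assumes E: "E \<in> perturbations n l" and n: "1 \<le> n" "1 \<le> l"
  shows "lattice_subgroup n l E \<in> fin_index_normal (int_power_group n)"
proof -
  let ?Z = "int_power_group n" and ?M = "lattice_subgroup n l E"
  have "?M \<lhd> ?Z"
    by (rule comm_group.subgroup_imp_normal[OF comm_group_int_power_group subgroup_lattice_subgroup])
  moreover have "rcosets\<^bsub>?Z\<^esub> ?M \<subseteq> (\<lambda>x. ?M #>\<^bsub>?Z\<^esub> Zemb n x) ` Zbox n (6 * n * l)"
  proof
    fix A assume "A \<in> rcosets\<^bsub>?Z\<^esub> ?M"
    then obtain g where "g \<in> carrier ?Z" "A = ?M #>\<^bsub>?Z\<^esub> g" by (auto simp: RCOSETS_def)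
    then obtain x where x: "x \<in> Zvec n" "A = ?M #>\<^bsub>?Z\<^esub> Zemb n x" using Zemb_surj by metis
    obtain p where p: "p \<in> Zvec n" "x - comb n l E p \<in> Zbox n (6 * n * l)"
      using comb_cobounded[OF E n x(1)] by blast
    have "x - (x - comb n l E p) = comb n l E p" by simp
    then have "?M #>\<^bsub>?Z\<^esub> Zemb n (x - comb n l E p) = A"
      using lattice_coset_eq_iff[OF Zbox_Zvec[OF p(2)] x(1), of l E] p(1) x(2) by blast
    then show "A \<in> (\<lambda>x. ?M #>\<^bsub>?Z\<^esub> Zemb n x) ` Zbox n (6 * n * l)" using p(2) by blast
  qed
  then have "finite (rcosets\<^bsub>?Z\<^esub> ?M)" by (rule finite_subset) simp
  ultimately show ?thesis by (simp add: fin_index_normal_def)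
qed

lemma lattice_subgroup_inj:
  assumes "E \<in> perturbations n l" "F \<in> perturbations n l" "1 \<le> n" "1 \<le> l"
    and eq: "lattice_subgroup n l E = lattice_subgroup n l F"
  shows "E = F"
proof (rule comb_lattice_inj[OF assms(1-4)])
  have "comb n l E ` Zvec n \<subseteq> comb n l F ` Zvec n" if "lattice_subgroup n l E \<subseteq> lattice_subgroup n l F" for E F
  proof
    fix x assume x: "x \<in> comb n l E ` Zvec n"
    then have "Zemb n x \<in> lattice_subgroup n l F" using that by (auto simp: lattice_subgroup_def)
    then obtain y where y: "y \<in> comb n l F ` Zvec n" "Zemb n x = Zemb n y"
      unfolding lattice_subgroup_def by blast
    have "x \<in> Zvec n" "y \<in> Zvec n" using x y(1) comb_Zvec by blast+
    then have "x = y" using y(2) by (rule Zemb_inj)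
    then show "x \<in> comb n l F ` Zvec n" using y by simp
  qed
  then show "comb n l E ` Zvec n = comb n l F ` Zvec n" using eq by (intro equalityI) auto
qed

lemma unit_vec_word_length:
  assumes T: "finite_generating_set (int_power_group n) T"
  obtains \<tau> where "\<And>i. i < n \<Longrightarrow> Zemb n (unit_vec i) \<in> wball (int_power_group n) T \<tau>"
proof -
  interpret group "int_power_group n" by (rule group_int_power_group)
  have "\<exists>r. Zemb n (unit_vec i) \<in> wball (int_power_group n) T r" for i
    using wball_cover[of T "Zemb n (unit_vec i)"] T Zemb_closed unfolding finite_generating_set_def by metis
  then obtain r where r: "\<And>i. Zemb n (unit_vec i) \<in> wball (int_power_group n) T (r i)" by metis
  show thesis
  proof (rule that[of "\<Sum>i<n. r i"])
    show "Zemb n (unit_vec i) \<in> wball (int_power_group n) T (\<Sum>i<n. r i)" if "i < n" for i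
      by (rule wball_mono[OF r]) (use that in \<open>auto intro: member_le_sum\<close>)
  qed
qed

lemma wball_int_power_group_Zbox:
  assumes T: "finite_generating_set (int_power_group n) T"
  obtains t where "\<And>r g. g \<in> wball (int_power_group n) T r \<Longrightarrow> \<exists>x\<in>Zbox n (t * r). g = Zemb n x"
proof -
  interpret group "int_power_group n" by (rule group_int_power_group)
  have Tc: "T \<subseteq> carrier (int_power_group n)" "finite T" using T by (auto simp: finite_generating_set_def)
  \<comment> \<open>The sum over the finite unit ball dominates each of its terms.
    \<open>l1_norm n\<close> reads only coordinates below \<open>n\<close>, so it may be applied to
    carrier elements directly.\<close>
  define t where "t = (\<Sum>g\<in>wball (int_power_group n) T 1. l1_norm n g)"
  have one: "\<exists>x\<in>Zbox n t. g = Zemb n x" if g: "g \<in> wball (int_power_group n) T 1" for g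
  proof -
    obtain x where x: "x \<in> Zvec n" "g = Zemb n x" using Zemb_surj[OF wball_closed[OF Tc(1) g]] by blast
    have "\<bar>x i\<bar> \<le> int t" if i: "i < n" for i
    proof -
      have "nat \<bar>g i\<bar> \<le> l1_norm n g"
        using i member_le_sum[of i "{..<n}" "\<lambda>i. nat \<bar>g i\<bar>"] by (auto simp: l1_norm_def)
      also have "\<dots> \<le> t" unfolding t_def using g finite_wball[OF Tc(2)] by (intro member_le_sum) auto
      finally show ?thesis using x(2) i by (simp add: Zemb_def)
    qed
    then show ?thesis using x by (auto simp: Zbox_def)
  qed
  show thesis
  proof (rule that[of t])
    show "\<exists>x\<in>Zbox n (t * r). g = Zemb n x" if "g \<in> wball (int_power_group n) T r" for r g
      using that
    proof (induction r arbitrary: g)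
      case 0
      then have "g = \<one>\<^bsub>int_power_group n\<^esub>" by (auto simp: wball_def is_word_def)
      then show ?case by (intro bexI[of _ 0]) (simp_all only: Zemb_one, simp add: Zbox_def)
    next
      case (Suc r)
      obtain u v where uv: "u \<in> wball (int_power_group n) T r" "v \<in> wball (int_power_group n) T 1"
        "g = u \<otimes>\<^bsub>int_power_group n\<^esub> v"
        using wball_Suc[OF Tc(1) Suc.prems] by blast
      obtain x y where x: "x \<in> Zbox n (t * r)" "u = Zemb n x" and y: "y \<in> Zbox n t" "v = Zemb n y"
        using Suc.IH[OF uv(1)] one[OF uv(2)] by blast
      have "x + y \<in> Zbox n (t * Suc r)" using Zbox_add[OF x(1) y(1)] by (simp add: add.commute)
      then show ?case using uv(3) x(2) y(2) by (auto simp: Zemb_mult simp del: plus_fun_apply)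
    qed
  qed
qed

text \<open>The vector l e_0 is not congruent to any vector of size at most t * r: their difference
  has size below 2 l, while a nonzero lattice vector has size at least 2 n l.\<close>

lemma lattice_diam_gt:
  assumes T: "finite_generating_set (int_power_group n) T"
    and t: "\<And>r g. g \<in> wball (int_power_group n) T r \<Longrightarrow> \<exists>x\<in>Zbox n (t * r). g = Zemb n x"
    and E: "E \<in> perturbations n l" and n: "1 \<le> n" and l: "t * r < l"
  shows "real r < word_diam (int_power_group n Mod lattice_subgroup n l E)
    (quot_image (int_power_group n) T (lattice_subgroup n l E))"
proof (rule ccontr)
  note [simp del] = mult_FactGroup one_FactGroup
  let ?Z = "int_power_group n" and ?M = "lattice_subgroup n l E"
  assume "\<not> ?thesis"
  then have le: "word_diam (?Z Mod ?M) (quot_image ?Z T ?M) \<le> real r" by simp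
  have l1: "1 \<le> l" using l by simp
  have M: "?M \<in> fin_index_normal ?Z" by (rule lattice_subgroup_fin_index[OF E n l1])
  interpret q: group_hom ?Z "?Z Mod ?M" "\<lambda>x. ?M #>\<^bsub>?Z\<^esub> x"
    using M by (intro coset_group_hom) (simp add: fin_index_normal_def)
  define v where "v = Zscale (int l) (unit_vec 0)"
  have v: "v \<in> Zvec n" "v 0 = int l" "v \<in> Zbox n l"
    using n by (auto simp: v_def Zscale_def unit_vec_def Zbox_def Zvec_def)
  have c: "\<one>\<^bsub>?Z Mod ?M\<^esub> \<in> carrier (?Z Mod ?M)" "?M #>\<^bsub>?Z\<^esub> Zemb n v \<in> carrier (?Z Mod ?M)" by auto
  have "box_dist ?Z T (?M, \<one>\<^bsub>?Z Mod ?M\<^esub>) (?M, ?M #>\<^bsub>?Z\<^esub> Zemb n v) \<le> real r"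
    using box_dist_le_diam[OF group_int_power_group T M c] le by (rule order_trans)
  then obtain b where b: "b \<in> wball ?Z T r" "?M #>\<^bsub>?Z\<^esub> Zemb n v = \<one>\<^bsub>?Z Mod ?M\<^esub> \<otimes>\<^bsub>?Z Mod ?M\<^esub> (?M #>\<^bsub>?Z\<^esub> b)"
    using box_dist_le_iff[OF group_int_power_group T M c] by blast
  obtain y where y: "y \<in> Zbox n (t * r)" "b = Zemb n y" using t[OF b(1)] by blast
  have yv: "y \<in> Zvec n" using y(1) by (rule Zbox_Zvec)
  have "?M #>\<^bsub>?Z\<^esub> Zemb n y = ?M #>\<^bsub>?Z\<^esub> Zemb n v" using b(2) y(2) by simp
  then obtain p where p: "p \<in> Zvec n" "v - y = comb n l E p" using lattice_coset_eq_iff[OF yv v(1)] by blast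
  have "v + - y \<in> Zbox n (l + t * r)" by (rule Zbox_add[OF v(3) Zbox_uminus[OF y(1)]])
  then have box: "comb n l E p \<in> Zbox n (l + t * r)" using p(2) by (simp only: diff_conv_add_uminus)
  have "p i = 0" if i: "i < n" for i
  proof -
    have "int (2 * n * l) * \<bar>p i\<bar> \<le> int (l + t * r)" by (rule comb_lower_bound[OF E box i])
    also have "\<dots> < int (2 * l)" unfolding of_nat_less_iff using l by linarith
    also have "\<dots> \<le> int (2 * n * l)" using n by (simp only: of_nat_le_iff) simp
    finally have "int (2 * n * l) * \<bar>p i\<bar> < int (2 * n * l) * 1" by simp
    then have "\<bar>p i\<bar> < 1" by (rule mult_left_less_imp_less) simp
    then show ?thesis by simp
  qed
  then have "p = 0" using p(1) by (auto simp: Zvec_def fun_eq_iff) (metis not_le)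
  then have "v = y" using p(2) by (simp only: comb_0 right_minus_eq)
  then have "int l \<le> int (t * r)" using y(1) v(2) n by (auto simp: Zbox_def dest!: spec[of _ 0])
  then show False using l by linarith
qed

section \<open>A map between box spaces on a single component\<close>

lemma box_dist_triangle:
  assumes "group G" "finite_generating_set G S"
    and "p \<in> box_points G" "q \<in> box_points G" "r \<in> box_points G"
  shows "box_dist G S p r \<le> box_dist G S p q + box_dist G S q r"
  using mdist_triangle[of p "full_box_space G S" q r] assms
  by (simp add: mspace_full_box_space mdist_full_box_space)

lemma box_dist_commute:
  assumes "group G" "finite_generating_set G S" "p \<in> box_points G" "q \<in> box_points G"
  shows "box_dist G S p q = box_dist G S q p"
  using mdist_commute[of "full_box_space G S" p q] assms
  by (simp add: mdist_full_box_space)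

text \<open>The coarse equivalence with its sequences replaced by control functions, going from the
  quotients of \<open>int_power_group n\<close> to those of \<open>H\<close>. The numbers \<tau> and
  \<open>t\<close> compare \<open>T\<close> with the unit vectors and with boxes.\<close>

locale box_map =
  fixes H :: "('a, 'b) monoid_scheme" and S :: "'a set" and n :: nat and T :: "(nat \<Rightarrow> int) set"
    and F :: "(nat \<Rightarrow> int) set \<times> (nat \<Rightarrow> int) set \<Rightarrow> 'a set \<times> 'a set"
    and C :: nat and \<rho> \<sigma> :: "nat \<Rightarrow> nat" and \<tau> t :: nat
  assumes H: "group H" and S: "finite_generating_set H S"
    and T: "finite_generating_set (int_power_group n) T" and n: "1 \<le> n"
    and F_point: "\<And>p. p \<in> box_points (int_power_group n) \<Longrightarrow> F p \<in> box_points H"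
    and F_dense: "\<And>q. q \<in> box_points H \<Longrightarrow> \<exists>p\<in>box_points (int_power_group n). box_dist H S q (F p) \<le> real C"
    and F_up: "\<And>p q r. p \<in> box_points (int_power_group n) \<Longrightarrow> q \<in> box_points (int_power_group n) \<Longrightarrow>
      box_dist (int_power_group n) T p q \<le> real r \<Longrightarrow> box_dist H S (F p) (F q) \<le> real (\<rho> r)"
    and F_down: "\<And>p q r. p \<in> box_points (int_power_group n) \<Longrightarrow> q \<in> box_points (int_power_group n) \<Longrightarrow>
      box_dist H S (F p) (F q) \<le> real r \<Longrightarrow> box_dist (int_power_group n) T p q \<le> real (\<sigma> r)"
    and \<tau>: "\<And>i. i < n \<Longrightarrow> Zemb n (unit_vec i) \<in> wball (int_power_group n) T \<tau>"
    and t: "\<And>r g. g \<in> wball (int_power_group n) T r \<Longrightarrow> \<exists>x\<in>Zbox n (t * r). g = Zemb n x"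
begin

abbreviation Z where "Z \<equiv> int_power_group n"
abbreviation M where "M \<equiv> lattice_subgroup n"

definition pt where "pt l E x = (M l E, M l E #>\<^bsub>Z\<^esub> Zemb n x)"

definition diamM where "diamM l E = word_diam (Z Mod M l E) (quot_image Z T (M l E))"

text \<open>One summand for each argument in which close images must force two points into the same
  component: two split components, density inside a component, and injectivity of
  \<open>target\<close>.\<close>

definition thr where "thr = \<sigma> (2 * \<rho> \<tau>) + \<sigma> (2 * C + 1) + \<sigma> C"

text \<open>A component is split if its image meets several components.  Splitting forces some point into
  a component of small diameter, which can happen on at most one large component.\<close>

definition splits where
  "splits l E \<longleftrightarrow> (\<exists>x\<in>Zvec n. \<exists>i<n. fst (F (pt l E x)) \<noteq> fst (F (pt l E (x + unit_vec i))))"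

definition target where "target l E = fst (F (pt l E 0))"

text \<open>Left translation moves the base point to the identity and leaves right multiplication by
  short elements unchanged.\<close>

definition lift where
  "lift l E x = inv\<^bsub>H Mod target l E\<^esub> snd (F (pt l E 0)) \<otimes>\<^bsub>H Mod target l E\<^esub> snd (F (pt l E x))"

lemma M_fin_index: "E \<in> perturbations n l \<Longrightarrow> 1 \<le> l \<Longrightarrow> M l E \<in> fin_index_normal Z"
  using lattice_subgroup_fin_index n by blast

lemma coset_carrier: "M l E #>\<^bsub>Z\<^esub> Zemb n x \<in> carrier (Z Mod M l E)"
  unfolding carrier_FactGroup by blast

lemma pt_point: "E \<in> perturbations n l \<Longrightarrow> 1 \<le> l \<Longrightarrow> pt l E x \<in> box_points Z"
  using M_fin_index coset_carrier by (simp add: pt_def box_points_def)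

lemma point_pt:
  assumes "p \<in> box_points Z" "fst p = M l E"
  obtains x where "x \<in> Zvec n" "p = pt l E x"
proof -
  have "snd p \<in> carrier (Z Mod M l E)" using assms by (auto simp: box_points_def)
  then obtain g where "g \<in> carrier Z" "snd p = M l E #>\<^bsub>Z\<^esub> g" unfolding carrier_FactGroup by blast
  then obtain x where "x \<in> Zvec n" "snd p = M l E #>\<^bsub>Z\<^esub> Zemb n x" using Zemb_surj by metis
  then show thesis using that[of x] assms by (simp add: pt_def prod_eq_iff)
qed

lemma pt_dist_le_iff:
  assumes E: "E \<in> perturbations n l" "1 \<le> l"
  shows "box_dist Z T (pt l E x) (pt l E y) \<le> real r \<longleftrightarrow>
    (\<exists>b\<in>wball Z T r. M l E #>\<^bsub>Z\<^esub> Zemb n y = M l E #>\<^bsub>Z\<^esub> (Zemb n x \<otimes>\<^bsub>Z\<^esub> b))"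
proof -
  note [simp del] = mult_FactGroup one_FactGroup
  interpret q: group_hom Z "Z Mod M l E" "\<lambda>x. M l E #>\<^bsub>Z\<^esub> x"
    using M_fin_index[OF E] by (intro coset_group_hom) (simp add: fin_index_normal_def)
  have Tc: "T \<subseteq> carrier Z" using T by (simp add: finite_generating_set_def)
  have "M l E #>\<^bsub>Z\<^esub> (Zemb n x \<otimes>\<^bsub>Z\<^esub> b) = (M l E #>\<^bsub>Z\<^esub> Zemb n x) \<otimes>\<^bsub>Z Mod M l E\<^esub> (M l E #>\<^bsub>Z\<^esub> b)"
    if "b \<in> wball Z T r" for b
    using q.G.wball_closed[OF Tc that] by simp
  then show ?thesis
    unfolding pt_def box_dist_le_iff[OF group_int_power_group T M_fin_index[OF E] coset_carrier coset_carrier]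
    by auto
qed

lemma pt_step_dist:
  assumes E: "E \<in> perturbations n l" "1 \<le> l" and i: "i < n"
  shows "box_dist Z T (pt l E x) (pt l E (x + unit_vec i)) \<le> real \<tau>"
  unfolding pt_dist_le_iff[OF E] by (intro bexI[OF _ \<tau>[OF i]]) (simp only: Zemb_mult)

lemma pt_periodic:
  assumes "x \<in> Zvec n" "p \<in> Zvec n"
  shows "pt l E (x + comb n l E p) = pt l E x"
proof -
  have "x + comb n l E p - x = comb n l E p" by simp
  then show ?thesis
    using lattice_coset_eq_iff[of x n "x + comb n l E p" l E] assms unfolding pt_def by blast
qed

lemma pt_close:
  assumes E: "E \<in> perturbations n l" "1 \<le> l" and x: "x \<in> Zvec n" "y \<in> Zvec n"
    and d: "box_dist Z T (pt l E x) (pt l E y) \<le> real r"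
  shows "\<exists>p\<in>Zvec n. y - x - comb n l E p \<in> Zbox n (t * r)"
proof -
  obtain b where b: "b \<in> wball Z T r" "M l E #>\<^bsub>Z\<^esub> Zemb n y = M l E #>\<^bsub>Z\<^esub> (Zemb n x \<otimes>\<^bsub>Z\<^esub> b)"
    using d pt_dist_le_iff[OF E] by blast
  obtain v where v: "v \<in> Zbox n (t * r)" "b = Zemb n v" using t[OF b(1)] by blast
  have vv: "x + v \<in> Zvec n" using x Zbox_Zvec[OF v(1)] by blast
  have "M l E #>\<^bsub>Z\<^esub> Zemb n (x + v) = M l E #>\<^bsub>Z\<^esub> Zemb n y" using b(2) v(2) by (simp add: Zemb_mult del: plus_fun_apply)
  then obtain p where p: "p \<in> Zvec n" "y - (x + v) = comb n l E p"
    using lattice_coset_eq_iff[OF vv x(2)] by blast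
  have "y - x - comb n l E p = v" unfolding p(2)[symmetric] by simp
  then show ?thesis using p(1) v(1) by metis
qed

lemma diamM_gt: "E \<in> perturbations n l \<Longrightarrow> t * r < l \<Longrightarrow> real r < diamM l E"
  unfolding diamM_def by (rule lattice_diam_gt[OF T t _ n])

lemma diamM_nonneg: "E \<in> perturbations n l \<Longrightarrow> 1 \<le> l \<Longrightarrow> 0 \<le> diamM l E"
  unfolding diamM_def by (rule word_diam_nonneg[OF group_int_power_group T M_fin_index])

lemma component_diam_nonneg:
  "q \<in> box_points H \<Longrightarrow> 0 \<le> word_diam (H Mod fst q) (quot_image H S (fst q))"
  by (rule word_diam_nonneg[OF H S]) (auto simp: box_points_def)

lemma dist_le_component_diams:
  assumes "q \<in> box_points H" "q' \<in> box_points H"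
  shows "box_dist H S q q' \<le> word_diam (H Mod fst q) (quot_image H S (fst q))
    + word_diam (H Mod fst q') (quot_image H S (fst q'))"
proof (cases "fst q = fst q'")
  case True
  have "box_dist H S (fst q, snd q) (fst q, snd q') \<le> word_diam (H Mod fst q) (quot_image H S (fst q))"
    using assms True by (intro box_dist_le_diam[OF H S]) (auto simp: box_points_def)
  then show ?thesis using True component_diam_nonneg[OF assms(2)] by (simp add: box_dist_def)
qed (simp add: box_dist_def)

text \<open>Neighbouring points have images within \<rho> \<tau>, and across components this
  distance is a sum of two diameters.\<close>

lemma splits_small_image:
  assumes E: "E \<in> perturbations n l" "1 \<le> l" and "splits l E"
  obtains x where "x \<in> Zvec n"
    "word_diam (H Mod fst (F (pt l E x))) (quot_image H S (fst (F (pt l E x)))) \<le> real (\<rho> \<tau>)"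
proof -
  obtain x i where xi: "x \<in> Zvec n" "i < n" "fst (F (pt l E x)) \<noteq> fst (F (pt l E (x + unit_vec i)))"
    using assms(3) unfolding splits_def by blast
  have "box_dist H S (F (pt l E x)) (F (pt l E (x + unit_vec i))) \<le> real (\<rho> \<tau>)"
    by (rule F_up[OF pt_point[OF E] pt_point[OF E] pt_step_dist[OF E xi(2)]])
  then have "word_diam (H Mod fst (F (pt l E x))) (quot_image H S (fst (F (pt l E x)))) \<le> real (\<rho> \<tau>)"
    using component_diam_nonneg[OF F_point[OF pt_point[OF E], of "x + unit_vec i"]] xi(3)
    by (simp add: box_dist_def del: plus_fun_apply)
  then show thesis using xi(1) that by blast
qed

text \<open>Two points in components of small diameter are close in every case, since a distance
  never exceeds the sum of the two diameters. Pulled back by \<sigma>, this bounds the distance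
  between two distinct components, which is again a sum of diameters.\<close>

lemma splits_unique:
  assumes E: "E \<in> perturbations n l" "1 \<le> l" "splits l E"
    and E': "E' \<in> perturbations n l'" "1 \<le> l'" "splits l' E'"
    and ne: "M l E \<noteq> M l' E'"
  shows "diamM l E + diamM l' E' \<le> real thr"
proof -
  obtain x where x: "x \<in> Zvec n"
    "word_diam (H Mod fst (F (pt l E x))) (quot_image H S (fst (F (pt l E x)))) \<le> real (\<rho> \<tau>)"
    using splits_small_image[OF E] by blast
  obtain y where y: "y \<in> Zvec n"
    "word_diam (H Mod fst (F (pt l' E' y))) (quot_image H S (fst (F (pt l' E' y)))) \<le> real (\<rho> \<tau>)"
    using splits_small_image[OF E'] by blast
  have p: "pt l E x \<in> box_points Z" "pt l' E' y \<in> box_points Z" using pt_point E E' by auto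
  have "box_dist H S (F (pt l E x)) (F (pt l' E' y)) \<le> real (2 * \<rho> \<tau>)"
    using dist_le_component_diams[OF F_point[OF p(1)] F_point[OF p(2)]] x(2) y(2) by simp
  then have "box_dist Z T (pt l E x) (pt l' E' y) \<le> real (\<sigma> (2 * \<rho> \<tau>))"
    by (rule F_down[OF p])
  then show ?thesis using ne by (simp add: box_dist_def pt_def diamM_def thr_def)
qed

text \<open>If one component beyond the threshold splits, every component of still larger diameter
  differs from it and so cannot split as well.\<close>

lemma eventually_unsplit:
  obtains l0 where "1 \<le> l0"
    "\<And>l E. l0 \<le> l \<Longrightarrow> E \<in> perturbations n l \<Longrightarrow> \<not> splits l E \<and> real thr < diamM l E"
proof (cases "\<exists>l E. t * thr < l \<and> E \<in> perturbations n l \<and> splits l E")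
  case False
  then show thesis using diamM_gt[of _ _ thr] by (intro that[of "t * thr + 1"]) auto
next
  case True
  then obtain l' E' where E': "t * thr < l'" "E' \<in> perturbations n l'" "splits l' E'" by blast
  obtain d :: nat where d: "diamM l' E' \<le> real d" using real_arch_simple by blast
  show thesis
  proof (rule that[of "t * thr + t * d + 1"])
    fix l E assume l: "t * thr + t * d + 1 \<le> l" and E: "E \<in> perturbations n l"
    have gt: "real thr < diamM l E" "real d < diamM l E" using diamM_gt[OF E] l by auto
    have "M l E \<noteq> M l' E'" using gt(2) d by (auto simp: diamM_def)
    moreover have "0 \<le> diamM l' E'" using E' by (intro diamM_nonneg) auto
    ultimately have "\<not> splits l E"
      using splits_unique[OF E _ _ E'(2) _ E'(3)] gt(1) l E'(1) by fastforce
    then show "\<not> splits l E \<and> real thr < diamM l E" using gt by blast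
  qed simp
qed

section \<open>The map on one large unsplit component\<close>

context
  fixes l :: nat and E :: "nat \<times> nat \<Rightarrow> int"
  assumes E: "E \<in> perturbations n l" "1 \<le> l" and unsplit: "\<not> splits l E" and big: "real thr < diamM l E"
begin

abbreviation N where "N \<equiv> target l E"

abbreviation P where "P \<equiv> H Mod target l E"

lemma fst_F_pt: "x \<in> Zvec n \<Longrightarrow> fst (F (pt l E x)) = N"
proof (induction rule: Zvec_induct)
  case zero
  show "fst (F (pt l E 0)) = N" by (simp only: target_def)
next
  case (step x i)
  then have "fst (F (pt l E x)) = fst (F (pt l E (x + unit_vec i)))" using unsplit unfolding splits_def by blast
  then show "(fst (F (pt l E x)) = N) = (fst (F (pt l E (x + unit_vec i))) = N)" by simp
qed

lemma F_pt: "x \<in> Zvec n \<Longrightarrow> F (pt l E x) = (N, snd (F (pt l E x)))"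
  using fst_F_pt by (simp add: prod_eq_iff)

lemma target_fin_index: "N \<in> fin_index_normal H"
  using F_point[OF pt_point[OF E, of 0]] unfolding target_def by (auto simp: box_points_def)

lemma target_normal: "N \<lhd> H"
  using target_fin_index by (simp add: fin_index_normal_def)

lemma snd_F_pt: "x \<in> Zvec n \<Longrightarrow> snd (F (pt l E x)) \<in> carrier P"
  using F_point[OF pt_point[OF E, of x]] fst_F_pt[of x] by (auto simp: box_points_def)

lemma point_H: "B \<in> carrier P \<Longrightarrow> (N, B) \<in> box_points H"
  using target_fin_index by (simp add: box_points_def)

text \<open>A point of another component would be at distance at least the diameter of this one,
  which exceeds \<open>thr\<close>.\<close>

lemma same_component:
  assumes z: "z \<in> box_points Z" and x: "x \<in> Zvec n"
    and d: "box_dist H S (F z) (F (pt l E x)) \<le> real r" and r: "\<sigma> r \<le> thr"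
  obtains y where "y \<in> Zvec n" "z = pt l E y"
proof -
  have "box_dist Z T z (pt l E x) \<le> real (\<sigma> r)" by (rule F_down[OF z pt_point[OF E] d])
  then have "box_dist Z T z (pt l E x) < diamM l E" using r big by linarith
  moreover have "0 \<le> word_diam (Z Mod fst z) (quot_image Z T (fst z))"
    using z by (intro word_diam_nonneg[OF group_int_power_group T]) (auto simp: box_points_def)
  ultimately have "fst z = M l E"
    by (cases "fst z = fst (pt l E x)") (auto simp: box_dist_def pt_def diamM_def)
  then show thesis using point_pt[OF z] that by blast
qed

text \<open>The nearby image granted by density in the whole box space might come from another
  component. On a walk through the target letter by letter, preimages found at consecutive points
  are within \<sigma> (2 * C + 1), too close for a change of component.\<close>

lemma component_dense:
  assumes B: "B \<in> carrier P"
  shows "\<exists>x\<in>Zvec n. box_dist H S (N, B) (F (pt l E x)) \<le> real C"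
proof -
  note [simp del] = mult_FactGroup one_FactGroup
  interpret q: group_hom H P "\<lambda>x. N #>\<^bsub>H\<^esub> x" by (rule coset_group_hom[OF target_normal])
  have Sc: "S \<subseteq> carrier H" "generate H S = carrier H" using S by (auto simp: finite_generating_set_def)
  let ?A = "snd (F (pt l E 0))"
  have A: "?A \<in> carrier P" by (rule snd_F_pt) simp
  have "\<exists>x\<in>Zvec n. box_dist H S (N, ?A \<otimes>\<^bsub>P\<^esub> (N #>\<^bsub>H\<^esub> b)) (F (pt l E x)) \<le> real C"
    if "b \<in> wball H S r" for b r
    using that
  proof (induction r arbitrary: b)
    case 0
    then have "b = \<one>\<^bsub>H\<^esub>" by (auto simp: wball_def is_word_def)
    then have "(N, ?A \<otimes>\<^bsub>P\<^esub> (N #>\<^bsub>H\<^esub> b)) = F (pt l E 0)" using A F_pt[of 0] by simp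
    moreover have "box_dist H S (N, ?A) (N, ?A) \<le> real 0"
      using box_dist_le_iff[OF H S target_fin_index A A, of 0] A q.G.one_in_wball
      by (metis q.G.one_closed q.H.r_one q.hom_one)
    then have "box_dist H S (F (pt l E 0)) (F (pt l E 0)) \<le> real C" using F_pt[of 0] by simp
    ultimately have "box_dist H S (N, ?A \<otimes>\<^bsub>P\<^esub> (N #>\<^bsub>H\<^esub> b)) (F (pt l E 0)) \<le> real C" by (simp only:)
    then show ?case by blast
  next
    case (Suc r)
    obtain u v where uv: "u \<in> wball H S r" "v \<in> wball H S 1" "b = u \<otimes>\<^bsub>H\<^esub> v"
      using q.G.wball_Suc[OF Sc(1) Suc.prems] by blast
    obtain x where x: "x \<in> Zvec n" "box_dist H S (N, ?A \<otimes>\<^bsub>P\<^esub> (N #>\<^bsub>H\<^esub> u)) (F (pt l E x)) \<le> real C"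
      using Suc.IH[OF uv(1)] by blast
    have c: "u \<in> carrier H" "v \<in> carrier H" using uv q.G.wball_closed[OF Sc(1)] by auto
    let ?B1 = "?A \<otimes>\<^bsub>P\<^esub> (N #>\<^bsub>H\<^esub> u)" and ?B = "?A \<otimes>\<^bsub>P\<^esub> (N #>\<^bsub>H\<^esub> b)"
    have B: "?B1 \<in> carrier P" "?B \<in> carrier P" "?B = ?B1 \<otimes>\<^bsub>P\<^esub> (N #>\<^bsub>H\<^esub> v)"
      using A c uv(3) by (simp_all add: q.H.m_assoc)
    have d1: "box_dist H S (N, ?B1) (N, ?B) \<le> real 1"
      using box_dist_le_iff[OF H S target_fin_index B(1,2), of 1] uv(2) B(3) by blast
    note pts = point_H[OF B(1)] point_H[OF B(2)] F_point[OF pt_point[OF E, of x]]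
    obtain z where z: "z \<in> box_points Z" "box_dist H S (N, ?B) (F z) \<le> real C"
      using F_dense[OF pts(2)] by blast
    have "box_dist H S (F z) (F (pt l E x)) \<le> box_dist H S (F z) (N, ?B) + box_dist H S (N, ?B) (F (pt l E x))"
      by (rule box_dist_triangle[OF H S F_point[OF z(1)] pts(2,3)])
    also have "\<dots> \<le> box_dist H S (N, ?B) (F z) + (box_dist H S (N, ?B1) (N, ?B) + box_dist H S (N, ?B1) (F (pt l E x)))"
      using box_dist_triangle[OF H S pts(2,1,3)] box_dist_commute[OF H S pts(1,2)]
        box_dist_commute[OF H S F_point[OF z(1)] pts(2)] by linarith
    also have "\<dots> \<le> real (2 * C + 1)" using z(2) d1 x(2) by simp
    finally have d: "box_dist H S (F z) (F (pt l E x)) \<le> real (2 * C + 1)" .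
    have "\<sigma> (2 * C + 1) \<le> thr" by (simp add: thr_def)
    then obtain y where "y \<in> Zvec n" "z = pt l E y"
      using same_component[OF z(1) x(1) d] by blast
    then show ?case using z(2) by blast
  qed
  moreover obtain b where "b \<in> carrier H" "B = ?A \<otimes>\<^bsub>P\<^esub> (N #>\<^bsub>H\<^esub> b)"
  proof -
    have "inv\<^bsub>P\<^esub> ?A \<otimes>\<^bsub>P\<^esub> B \<in> carrier P" using A B by simp
    then obtain b where b: "b \<in> carrier H" "inv\<^bsub>P\<^esub> ?A \<otimes>\<^bsub>P\<^esub> B = N #>\<^bsub>H\<^esub> b"
      unfolding carrier_FactGroup by blast
    have "B = ?A \<otimes>\<^bsub>P\<^esub> (N #>\<^bsub>H\<^esub> b)" unfolding b(2)[symmetric] using A B by (simp add: q.H.m_assoc[symmetric])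
    then show thesis using that b(1) by blast
  qed
  ultimately show ?thesis using q.G.wball_cover[OF Sc] by metis
qed

lemma lift_closed: "x \<in> Zvec n \<Longrightarrow> lift l E x \<in> carrier P"
proof -
  interpret q: group_hom H P "\<lambda>x. N #>\<^bsub>H\<^esub> x" by (rule coset_group_hom[OF target_normal])
  assume "x \<in> Zvec n"
  then show ?thesis unfolding lift_def
    by (intro q.H.m_closed q.H.inv_closed snd_F_pt) auto
qed

lemma lift_0: "lift l E 0 = \<one>\<^bsub>P\<^esub>"
proof -
  interpret q: group_hom H P "\<lambda>x. N #>\<^bsub>H\<^esub> x" by (rule coset_group_hom[OF target_normal])
  show ?thesis unfolding lift_def by (rule q.H.l_inv[OF snd_F_pt]) simp
qed

lemma lift_eq_iff:
  assumes x: "x \<in> Zvec n" "y \<in> Zvec n" and b: "b \<in> carrier H"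
  shows "lift l E y = lift l E x \<otimes>\<^bsub>P\<^esub> (N #>\<^bsub>H\<^esub> b) \<longleftrightarrow>
    snd (F (pt l E y)) = snd (F (pt l E x)) \<otimes>\<^bsub>P\<^esub> (N #>\<^bsub>H\<^esub> b)"
proof -
  note [simp del] = mult_FactGroup one_FactGroup
  interpret q: group_hom H P "\<lambda>x. N #>\<^bsub>H\<^esub> x" by (rule coset_group_hom[OF target_normal])
  have A: "snd (F (pt l E 0)) \<in> carrier P" by (rule snd_F_pt) simp
  have "lift l E x \<otimes>\<^bsub>P\<^esub> (N #>\<^bsub>H\<^esub> b) =
      inv\<^bsub>P\<^esub> snd (F (pt l E 0)) \<otimes>\<^bsub>P\<^esub> (snd (F (pt l E x)) \<otimes>\<^bsub>P\<^esub> (N #>\<^bsub>H\<^esub> b))"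
    unfolding lift_def using A b snd_F_pt[OF x(1)] by (simp add: q.H.m_assoc)
  then show ?thesis
    unfolding lift_def using A b snd_F_pt[OF x(1)] snd_F_pt[OF x(2)] by simp
qed

lemma lift_dist_iff:
  assumes x: "x \<in> Zvec n" "y \<in> Zvec n"
  shows "box_dist H S (F (pt l E x)) (F (pt l E y)) \<le> real r \<longleftrightarrow>
    (\<exists>b\<in>wball H S r. lift l E y = lift l E x \<otimes>\<^bsub>P\<^esub> (N #>\<^bsub>H\<^esub> b))"
proof -
  have Sc: "S \<subseteq> carrier H" using S by (auto simp: finite_generating_set_def)
  have "box_dist H S (F (pt l E x)) (F (pt l E y)) =
      box_dist H S (N, snd (F (pt l E x))) (N, snd (F (pt l E y)))"
    by (rule arg_cong2[OF F_pt[OF x(1)] F_pt[OF x(2)]])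
  also have "\<dots> \<le> real r \<longleftrightarrow>
      (\<exists>b\<in>wball H S r. snd (F (pt l E y)) = snd (F (pt l E x)) \<otimes>\<^bsub>P\<^esub> (N #>\<^bsub>H\<^esub> b))"
    by (rule box_dist_le_iff[OF H S target_fin_index snd_F_pt[OF x(1)] snd_F_pt[OF x(2)]])
  also have "\<dots> \<longleftrightarrow> (\<exists>b\<in>wball H S r. lift l E y = lift l E x \<otimes>\<^bsub>P\<^esub> (N #>\<^bsub>H\<^esub> b))"
    by (rule bex_cong[OF refl lift_eq_iff[OF x group.wball_closed[OF H Sc], symmetric]])
  finally show ?thesis .
qed

lemma lift_periodic: "x \<in> Zvec n \<Longrightarrow> p \<in> Zvec n \<Longrightarrow> lift l E (x + comb n l E p) = lift l E x"
  unfolding lift_def by (simp only: pt_periodic)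

lemma lift_lipschitz:
  assumes "x \<in> Zvec n" "i < n"
  shows "\<exists>b\<in>wball H S (\<rho> \<tau>). lift l E (x + unit_vec i) = lift l E x \<otimes>\<^bsub>P\<^esub> (N #>\<^bsub>H\<^esub> b)"
  using F_up[OF pt_point[OF E] pt_point[OF E] pt_step_dist[OF E assms(2), of x]]
    lift_dist_iff[OF assms(1), of "x + unit_vec i"] assms by blast

lemma lift_control:
  assumes x: "x \<in> Zvec n" "y \<in> Zvec n" and b: "b \<in> wball H S r"
    and eq: "lift l E y = lift l E x \<otimes>\<^bsub>P\<^esub> (N #>\<^bsub>H\<^esub> b)"
  shows "\<exists>p\<in>Zvec n. y - x - comb n l E p \<in> Zbox n (t * \<sigma> r)"
proof (rule pt_close[OF E x])
  have "box_dist H S (F (pt l E x)) (F (pt l E y)) \<le> real r" using lift_dist_iff[OF x] b eq by blast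
  then show "box_dist Z T (pt l E x) (pt l E y) \<le> real (\<sigma> r)" by (rule F_down[OF pt_point[OF E] pt_point[OF E]])
qed

lemma lift_dense:
  assumes B: "B \<in> carrier P"
  shows "\<exists>x\<in>Zvec n. \<exists>b\<in>wball H S C. B = lift l E x \<otimes>\<^bsub>P\<^esub> (N #>\<^bsub>H\<^esub> b)"
proof -
  note [simp del] = mult_FactGroup one_FactGroup
  interpret q: group_hom H P "\<lambda>x. N #>\<^bsub>H\<^esub> x" by (rule coset_group_hom[OF target_normal])
  have Sc: "S \<subseteq> carrier H" using S by (auto simp: finite_generating_set_def)
  let ?A = "snd (F (pt l E 0))"
  have A: "?A \<in> carrier P" by (rule snd_F_pt) simp
  have AB: "?A \<otimes>\<^bsub>P\<^esub> B \<in> carrier P" using A B by simp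
  obtain x where x: "x \<in> Zvec n" "box_dist H S (N, ?A \<otimes>\<^bsub>P\<^esub> B) (F (pt l E x)) \<le> real C"
    using component_dense[OF AB] by blast
  have "box_dist H S (N, snd (F (pt l E x))) (N, ?A \<otimes>\<^bsub>P\<^esub> B) \<le> real C"
    using x box_dist_commute[OF H S point_H[OF AB] F_point[OF pt_point[OF E, of x]]] F_pt[OF x(1)] by simp
  then obtain b where b: "b \<in> wball H S C" "?A \<otimes>\<^bsub>P\<^esub> B = snd (F (pt l E x)) \<otimes>\<^bsub>P\<^esub> (N #>\<^bsub>H\<^esub> b)"
    using box_dist_le_iff[OF H S target_fin_index snd_F_pt[OF x(1)] AB] by blast
  have bc: "N #>\<^bsub>H\<^esub> b \<in> carrier P" using q.G.wball_closed[OF Sc b(1)] by simp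
  have "B = inv\<^bsub>P\<^esub> ?A \<otimes>\<^bsub>P\<^esub> (?A \<otimes>\<^bsub>P\<^esub> B)" using A B by (simp add: q.H.m_assoc[symmetric])
  also have "\<dots> = lift l E x \<otimes>\<^bsub>P\<^esub> (N #>\<^bsub>H\<^esub> b)"
    unfolding b(2) lift_def using A bc snd_F_pt[OF x(1)] by (simp add: q.H.m_assoc)
  finally show ?thesis using x(1) b(1) by blast
qed

end

text \<open>With a common target, an image point of the second component is within \<open>C\<close>
  of an image point of the first; their preimages are then too close to lie in different
  components.\<close>

lemma target_inj:
  assumes E: "E \<in> perturbations n l" "\<not> splits l E" "real thr < diamM l E"
    and E': "E' \<in> perturbations n l" "\<not> splits l E'" and l: "1 \<le> l"
    and eq: "target l E = target l E'"
  shows "E = E'"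
proof -
  have pt': "pt l E' 0 \<in> box_points Z" by (rule pt_point[OF E'(1) l])
  have F': "F (pt l E' 0) = (target l E, snd (F (pt l E' 0)))" using eq by (simp add: target_def prod_eq_iff)
  have "snd (F (pt l E' 0)) \<in> carrier (H Mod target l E)"
    using F_point[OF pt'] F' by (auto simp: box_points_def)
  then obtain x where x: "x \<in> Zvec n" "box_dist H S (F (pt l E' 0)) (F (pt l E x)) \<le> real C"
    using component_dense[OF E(1) l E(2,3)] F' by metis
  have "\<sigma> C \<le> thr" by (simp add: thr_def)
  then obtain y where "pt l E' 0 = pt l E y"
    using same_component[OF E(1) l E(2,3) pt' x] by blast
  then have "M l E = M l E'" by (simp add: pt_def)
  then show ?thesis using lattice_subgroup_inj[OF E(1) E'(1) n l] by simp
qed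

end

section \<open>Passing to a common quotient\<close>

lemma (in group) normal_Inter:
  assumes "\<And>N. N \<in> A \<Longrightarrow> N \<lhd> G" "A \<noteq> {}"
  shows "\<Inter>A \<lhd> G"
  unfolding normal_inv_iff
proof (intro conjI ballI)
  show "subgroup (\<Inter>A) G"
    using assms by (intro subgroups_Inter) (auto simp: normal_inv_iff)
  show "x \<otimes> h \<otimes> inv x \<in> \<Inter>A" if "x \<in> carrier G" "h \<in> \<Inter>A" for x h
    using assms(1) that by (auto simp: normal_inv_iff)
qed

text \<open>Multiplying a coset by the set \<open>N\<close> writes the projection without choosing
  representatives.\<close>

lemma quotient_projection:
  assumes N0: "N0 \<lhd> G" and N: "N \<lhd> G" and sub: "N0 \<subseteq> N"
  shows "group_hom (G Mod N0) (G Mod N) (\<lambda>c. N <#>\<^bsub>G\<^esub> c)"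
    and "\<And>x. x \<in> carrier G \<Longrightarrow> N <#>\<^bsub>G\<^esub> (N0 #>\<^bsub>G\<^esub> x) = N #>\<^bsub>G\<^esub> x"
proof -
  note [simp del] = mult_FactGroup one_FactGroup
  interpret G: group G using N0 by (simp add: normal_def)
  interpret N0: normal N0 G by (rule N0)
  interpret N: normal N G by (rule N)
  interpret q0: group_hom G "G Mod N0" "\<lambda>x. N0 #>\<^bsub>G\<^esub> x" by (rule coset_group_hom[OF N0])
  interpret q: group_hom G "G Mod N" "\<lambda>x. N #>\<^bsub>G\<^esub> x" by (rule coset_group_hom[OF N])
  show proj: "N <#>\<^bsub>G\<^esub> (N0 #>\<^bsub>G\<^esub> x) = N #>\<^bsub>G\<^esub> x" if x: "x \<in> carrier G" for x
  proof
    show "N <#>\<^bsub>G\<^esub> (N0 #>\<^bsub>G\<^esub> x) \<subseteq> N #>\<^bsub>G\<^esub> x"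
    proof
      fix y assume "y \<in> N <#>\<^bsub>G\<^esub> (N0 #>\<^bsub>G\<^esub> x)"
      then obtain m k where mk: "m \<in> N" "k \<in> N0" "y = m \<otimes>\<^bsub>G\<^esub> (k \<otimes>\<^bsub>G\<^esub> x)"
        by (auto simp: set_mult_def r_coset_def)
      then have "y = (m \<otimes>\<^bsub>G\<^esub> k) \<otimes>\<^bsub>G\<^esub> x" using x by (simp add: G.m_assoc)
      moreover have "m \<otimes>\<^bsub>G\<^esub> k \<in> N" using mk sub by auto
      ultimately show "y \<in> N #>\<^bsub>G\<^esub> x" unfolding r_coset_def by blast
    qed
    show "N #>\<^bsub>G\<^esub> x \<subseteq> N <#>\<^bsub>G\<^esub> (N0 #>\<^bsub>G\<^esub> x)"
      using G.rcos_self[OF x N0.is_subgroup] unfolding set_mult_def r_coset_def by blast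
  qed
  have "(\<lambda>c. N <#>\<^bsub>G\<^esub> c) \<in> hom (G Mod N0) (G Mod N)"
  proof (rule homI)
    fix A B assume "A \<in> carrier (G Mod N0)" "B \<in> carrier (G Mod N0)"
    then obtain x y where xy: "x \<in> carrier G" "y \<in> carrier G" "A = N0 #>\<^bsub>G\<^esub> x" "B = N0 #>\<^bsub>G\<^esub> y"
      unfolding carrier_FactGroup by blast
    show "N <#>\<^bsub>G\<^esub> A \<in> carrier (G Mod N)" unfolding xy(3) proj[OF xy(1)] by (rule q.hom_closed[OF xy(1)])
    have "N <#>\<^bsub>G\<^esub> (A \<otimes>\<^bsub>G Mod N0\<^esub> B) = N <#>\<^bsub>G\<^esub> (N0 #>\<^bsub>G\<^esub> (x \<otimes>\<^bsub>G\<^esub> y))"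
      unfolding xy(3,4) q0.hom_mult[OF xy(1,2)] ..
    also have "\<dots> = N #>\<^bsub>G\<^esub> (x \<otimes>\<^bsub>G\<^esub> y)" by (rule proj[OF G.m_closed[OF xy(1,2)]])
    also have "\<dots> = (N <#>\<^bsub>G\<^esub> A) \<otimes>\<^bsub>G Mod N\<^esub> (N <#>\<^bsub>G\<^esub> B)"
      unfolding xy(3,4) proj[OF xy(1)] proj[OF xy(2)] by (rule q.hom_mult[OF xy(1,2)])
    finally show "N <#>\<^bsub>G\<^esub> (A \<otimes>\<^bsub>G Mod N0\<^esub> B) = (N <#>\<^bsub>G\<^esub> A) \<otimes>\<^bsub>G Mod N\<^esub> (N <#>\<^bsub>G\<^esub> B)" .
  qed
  then show "group_hom (G Mod N0) (G Mod N) (\<lambda>c. N <#>\<^bsub>G\<^esub> c)"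
    by (simp add: group_hom_def group_hom_axioms_def q0.H.is_group q.H.is_group)
qed

lemma pigeonhole_fibre:
  assumes "finite A" "finite B" "f ` A \<subseteq> B" "B \<noteq> {}"
  obtains y where "y \<in> B" "card A \<le> card B * card {x \<in> A. f x = y}"
proof -
  let ?c = "\<lambda>y. card {x \<in> A. f x = y}"
  have "Max (?c ` B) \<in> ?c ` B" using assms by (intro Max_in) auto
  then obtain y where y: "y \<in> B" "?c y = Max (?c ` B)" by auto
  have "A = (\<Union>y\<in>B. {x \<in> A. f x = y})" using assms(3) by auto
  then have "card A \<le> (\<Sum>y\<in>B. ?c y)" using card_UN_le[OF assms(2), of "\<lambda>y. {x \<in> A. f x = y}"] by simp
  also have "\<dots> \<le> of_nat (card B) * ?c y"
    unfolding y(2) using assms(2) by (intro sum_bounded_above) auto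
  finally show thesis using that y(1) by simp
qed

theorem (in box_map) no_box_map_of_two_generated:
  assumes n3: "3 \<le> n" and ab: "a \<in> carrier H" "b \<in> carrier H" and gen: "generate H {a, b} = carrier H"
  shows False
proof -
  note [simp del] = mult_FactGroup one_FactGroup
  interpret H: group H by (rule H)
  have Sc: "S \<subseteq> carrier H" "generate H S = carrier H" "finite S"
    using S by (auto simp: finite_generating_set_def)
  define L s where "L = \<rho> \<tau>" and "s = t * \<sigma> (2 * C + 1)"
  \<comment> \<open>The radius depends on the control data alone; since it does not grow with
    \<open>l\<close>, the traces on \<open>B\<close> take finitely many values.\<close>
  define R where "R = 4 * L + L * (n * s) + 2 * C + 1"
  define B where "B = wball H S R"
  obtain l0 where l0: "1 \<le> l0"
    "\<And>l E. l0 \<le> l \<Longrightarrow> E \<in> perturbations n l \<Longrightarrow> \<not> splits l E \<and> real thr < diamM l E"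
    using eventually_unsplit by blast
  have finB: "finite (Pow B)" unfolding B_def using H.finite_wball[OF Sc(3)] by simp
  have "\<forall>l. \<exists>X. X \<in> Pow B \<and>
      l ^ (n * n) \<le> card (Pow B) * card {E \<in> perturbations n l. target l E \<inter> B = X}"
    using pigeonhole_fibre[OF finite_perturbations finB, of "\<lambda>E. target l E \<inter> B" n l for l]
    unfolding card_perturbations by blast
  from choice[OF this] obtain \<Sigma> where \<Sigma>: "\<And>l. \<Sigma> l \<in> Pow B"
    "\<And>l. l ^ (n * n) \<le> card (Pow B) * card {E \<in> perturbations n l. target l E \<inter> B = \<Sigma> l}"
    by blast
  \<comment> \<open>The first pigeonhole selected a frequent trace for each \<open>l\<close>; the
    second makes it the same trace for infinitely many \<open>l\<close>.\<close>
  have "finite (\<Sigma> ` {l0..})" using \<Sigma>(1) finB by (meson finite_subset image_subsetI)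
  then obtain l1 where inf: "infinite {l \<in> {l0..}. \<Sigma> l = \<Sigma> l1}"
    using pigeonhole_infinite[OF infinite_Ici] by blast
  define \<Lambda> where "\<Lambda> = {l \<in> {l0..}. \<Sigma> l = \<Sigma> l1}"
  \<comment> \<open>The tag \<open>l\<close> is kept because a perturbation for one scale is also
    one for every larger scale and does not determine its lattice.\<close>
  define Cls where "Cls l = Pair l ` {E \<in> perturbations n l. target l E \<inter> B = \<Sigma> l1}" for l :: nat
  define tgt where "tgt U = target (fst U) (snd U)" for U
  have big: "l ^ (n * n) \<le> card (Pow B) * card (Cls l)" if "l \<in> \<Lambda>" for l
    using \<Sigma>(2)[of l] that by (simp add: \<Lambda>_def Cls_def card_image inj_on_def)
  have Cls: "E \<in> perturbations n l" "1 \<le> l" "\<not> splits l E" "real thr < diamM l E" "target l E \<inter> B = \<Sigma> l1"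
    if "l \<in> \<Lambda>" "(l', E) \<in> Cls l" for l l' E
    using that l0(1) l0(2)[of l E] by (auto simp: Cls_def \<Lambda>_def)
  have pair_Cls: "U = (l, snd U)" if "U \<in> Cls l" for l U using that by (auto simp: Cls_def)
  define \<U> where "\<U> = (\<Union>l\<in>\<Lambda>. Cls l)"
  have \<U>_ne: "\<U> \<noteq> {}"
  proof -
    have "\<not> \<Lambda> \<subseteq> {0}" using inf finite_subset unfolding \<Lambda>_def by blast
    then obtain l where l: "l \<in> \<Lambda>" "0 < l" by blast
    then have "0 < l ^ (n * n)" by simp
    then have "0 < card (Pow B) * card (Cls l)" using big[OF l(1)] by (rule less_le_trans)
    then have "Cls l \<noteq> {}" by auto
    then show ?thesis using l(1) unfolding \<U>_def by blast
  qed
  have tgt: "tgt U \<in> fin_index_normal H" "tgt U \<lhd> H" "tgt U \<inter> B = \<Sigma> l1" if "U \<in> \<U>" for U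
  proof -
    obtain l where l: "l \<in> \<Lambda>" "U \<in> Cls l" using \<open>U \<in> \<U>\<close> unfolding \<U>_def by blast
    define E where "E = snd U"
    have U: "U = (l, E)" "l \<in> \<Lambda>" "(l, E) \<in> Cls l" using l pair_Cls[OF l(2)] by (simp_all add: E_def)
    show "tgt U \<in> fin_index_normal H" "tgt U \<lhd> H" "tgt U \<inter> B = \<Sigma> l1"
      using target_fin_index[OF Cls(1-4)[OF U(2,3)]] target_normal[OF Cls(1-4)[OF U(2,3)]] Cls(5)[OF U(2,3)]
      by (simp_all add: tgt_def U(1))
  qed
  \<comment> \<open>An intersection over all scales may have infinite index, which is what allows
    \<open>?Q\<close> to contain kernels at every scale.\<close>
  define N0 where "N0 = \<Inter>(tgt ` \<U>)"
  have N0: "N0 \<lhd> H" unfolding N0_def using tgt(2) \<U>_ne by (intro H.normal_Inter) auto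
  have N0_sub: "N0 \<subseteq> tgt U" if "U \<in> \<U>" for U using that unfolding N0_def by blast
  \<comment> \<open>A short element lost in one quotient belongs to the common trace, hence to every
    target. So no projection from \<open>?Q\<close> identifies a nontrivial element of the ball of
    radius \<open>R\<close> with the identity.\<close>
  have N0_ball: "x \<in> N0" if "x \<in> B" "x \<in> tgt U" "U \<in> \<U>" for x U
    using that tgt(3) unfolding N0_def by blast
  let ?Q = "H Mod N0" and ?\<pi> = "\<lambda>x. N0 #>\<^bsub>H\<^esub> x"
  interpret \<pi>: group_hom H ?Q ?\<pi> by (rule coset_group_hom[OF N0])
  let ?S = "?\<pi> ` S"
  have Q: "?S \<subseteq> carrier ?Q" "finite ?S" "generate ?Q ?S = carrier ?Q"
    "generate ?Q {?\<pi> a, ?\<pi> b} = carrier ?Q"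
  proof -
    show "?S \<subseteq> carrier ?Q" "finite ?S" using Sc by auto
    show "generate ?Q ?S = carrier ?Q"
      unfolding \<pi>.generate_img[OF Sc(1)] Sc(2) carrier_FactGroup ..
    show "generate ?Q {?\<pi> a, ?\<pi> b} = carrier ?Q"
      using \<pi>.generate_img[of "{a, b}"] ab gen by (simp add: carrier_FactGroup)
  qed
  note ballQ = \<pi>.wball_image[OF Sc(1)]
  obtain r where r: "a \<in> wball H S r" "b \<in> wball H S r"
  proof -
    obtain ra rb where "a \<in> wball H S ra" "b \<in> wball H S rb"
      using H.wball_cover[OF Sc(1,2)] ab by metis
    then show thesis using that[of "max ra rb"] H.wball_mono by (meson max.cobounded1 max.cobounded2)
  qed
  let ?P = "\<lambda>U. H Mod tgt U" and ?h = "\<lambda>U c. tgt U <#>\<^bsub>H\<^esub> c"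
  define D where "D = 4 * L * n * n + s * (2 * r + 4 * L * n * n + 1)"
  have cover: "\<exists>\<theta>. lattice_kernel ?Q (?P U) (?h U) ?S n \<theta> (?\<pi> a) (?\<pi> b) D l \<and>
      (\<forall>r. card (wball ?Q ?S r) \<le> card (wball ?Q ?S C) * (2 * s + 1) ^ n * (r + 1) ^ n) \<and>
      (\<not> inj_on \<theta> (Zvec n) \<longrightarrow> (\<exists>C'. \<forall>r. card (wball ?Q ?S r) \<le> C' * (r + 1) ^ (n - 1)))"
    if U: "l \<in> \<Lambda>" "U \<in> Cls l" for l U
  proof -
    define E where "E = snd U"
    have UE: "U = (l, E)" using pair_Cls[OF U(2)] by (simp add: E_def)
    note E = Cls(1-4)[OF U(1) U(2)[unfolded UE]]
    have tU: "tgt U = target l E" by (simp add: tgt_def UE)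
    have U\<U>: "U \<in> \<U>" using U unfolding \<U>_def by blast
    note proj = quotient_projection[OF N0 tgt(2)[OF U\<U>] N0_sub[OF U\<U>]]
    interpret h: group_hom ?Q "?P U" "?h U" by (rule proj(1))
    show ?thesis
      unfolding D_def
    proof (rule h.coarse_cover_lattice_kernel[OF Q(1,2,3) _ _ n E(2,1), where f = "lift l E" and R = R])
      show "finite (carrier (?P U))" by (rule quot_generating(4)[OF H S tgt(1)[OF U\<U>]])
      show "?h U ` carrier ?Q = carrier (?P U)"
        unfolding carrier_FactGroup image_image using proj(2) by (intro image_cong) auto
      show "lift l E x \<in> carrier (?P U)" if "x \<in> Zvec n" for x
        unfolding tU by (rule lift_closed[OF E that])
      show "lift l E 0 = \<one>\<^bsub>?P U\<^esub>" unfolding tU by (rule lift_0[OF E])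
      show "lift l E (x + comb n l E p) = lift l E x" if "x \<in> Zvec n" "p \<in> Zvec n" for x p
        by (rule lift_periodic[OF E that])
      show "\<exists>b\<in>wball ?Q ?S L. lift l E (x + unit_vec i) = lift l E x \<otimes>\<^bsub>?P U\<^esub> ?h U b"
        if x: "x \<in> Zvec n" "i < n" for x i
      proof -
        obtain b where b: "b \<in> wball H S L" "lift l E (x + unit_vec i) = lift l E x \<otimes>\<^bsub>?P U\<^esub> (tgt U #>\<^bsub>H\<^esub> b)"
          using lift_lipschitz[OF E x] unfolding tU L_def by blast
        have "?h U (?\<pi> b) = tgt U #>\<^bsub>H\<^esub> b" by (rule proj(2)[OF H.wball_closed[OF Sc(1) b(1)]])
        then show ?thesis unfolding ballQ b(2) using b(1) by (intro bexI[of _ "?\<pi> b"]) auto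
      qed
      show "\<exists>p\<in>Zvec n. y - x - comb n l E p \<in> Zbox n s"
        if x: "x \<in> Zvec n" "y \<in> Zvec n" and b: "b \<in> wball ?Q ?S (2 * C + 1)"
          and eq: "lift l E y = lift l E x \<otimes>\<^bsub>?P U\<^esub> ?h U b" for x y b
      proof -
        obtain b' where b': "b' \<in> wball H S (2 * C + 1)" "b = ?\<pi> b'" using b unfolding ballQ by blast
        have "?h U b = tgt U #>\<^bsub>H\<^esub> b'" unfolding b'(2) by (rule proj(2)[OF H.wball_closed[OF Sc(1) b'(1)]])
        then show ?thesis unfolding s_def
          using lift_control[OF E x b'(1)] eq unfolding tU by simp
      qed
      show "\<exists>x\<in>Zvec n. \<exists>b\<in>wball ?Q ?S C. ?h U q = lift l E x \<otimes>\<^bsub>?P U\<^esub> ?h U b"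
        if q: "q \<in> carrier ?Q" for q
      proof -
        have "?h U q \<in> carrier (H Mod target l E)" using h.hom_closed[OF q] unfolding tU .
        then obtain x b where x: "x \<in> Zvec n" "b \<in> wball H S C" "?h U q = lift l E x \<otimes>\<^bsub>?P U\<^esub> (tgt U #>\<^bsub>H\<^esub> b)"
          using lift_dense[OF E] unfolding tU by blast
        have "?h U (?\<pi> b) = tgt U #>\<^bsub>H\<^esub> b" by (rule proj(2)[OF H.wball_closed[OF Sc(1) x(2)]])
        then have "?h U q = lift l E x \<otimes>\<^bsub>?P U\<^esub> ?h U (?\<pi> b)" using x(3) by simp
        then show ?thesis unfolding ballQ using x(1,2) by blast
      qed
      show "4 * L \<le> R" "L * (n * s) + 2 * C + 1 \<le> R" by (simp_all add: R_def)
      show "g = \<one>\<^bsub>?Q\<^esub>" if g: "g \<in> wball ?Q ?S R" "?h U g = \<one>\<^bsub>?P U\<^esub>" for g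
      proof -
        obtain x where x: "x \<in> B" "g = ?\<pi> x" using g(1) unfolding ballQ B_def by blast
        have xc: "x \<in> carrier H" using H.wball_closed[OF Sc(1)] x(1) unfolding B_def by blast
        have "tgt U #>\<^bsub>H\<^esub> x = tgt U" using g(2) proj(2)[OF xc] x(2) by (simp add: one_FactGroup)
        then have "x \<in> tgt U"
          using H.rcos_self[OF xc, of "tgt U"] tgt(2)[OF U\<U>] by (simp add: normal_imp_subgroup)
        then have "x \<in> N0" using N0_ball x(1) U\<U> by blast
        then show ?thesis
          unfolding x(2) one_FactGroup
          using H.coset_join2[OF xc normal_imp_subgroup[OF N0]] by simp
      qed
      show "?\<pi> a \<in> wball ?Q ?S r" "?\<pi> b \<in> wball ?Q ?S r" unfolding ballQ using r by auto
    qed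
  qed
  have "\<forall>U\<in>\<U>. \<exists>\<theta>. lattice_kernel ?Q (?P U) (?h U) ?S n \<theta> (?\<pi> a) (?\<pi> b) D (fst U) \<and>
      (\<not> inj_on \<theta> (Zvec n) \<longrightarrow> (\<exists>C'. \<forall>r. card (wball ?Q ?S r) \<le> C' * (r + 1) ^ (n - 1)))"
  proof
    fix U assume "U \<in> \<U>"
    then obtain l where l: "l \<in> \<Lambda>" "U \<in> Cls l" unfolding \<U>_def by blast
    have "fst U = l" using pair_Cls[OF l(2)] by (metis fst_conv)
    then show "\<exists>\<theta>. lattice_kernel ?Q (?P U) (?h U) ?S n \<theta> (?\<pi> a) (?\<pi> b) D (fst U) \<and>
      (\<not> inj_on \<theta> (Zvec n) \<longrightarrow> (\<exists>C'. \<forall>r. card (wball ?Q ?S r) \<le> C' * (r + 1) ^ (n - 1)))"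
      using cover[OF l] by blast
  qed
  then obtain \<theta> where \<theta>: "\<And>U. U \<in> \<U> \<Longrightarrow> lattice_kernel ?Q (?P U) (?h U) ?S n (\<theta> U) (?\<pi> a) (?\<pi> b) D (fst U)"
    "\<And>U. U \<in> \<U> \<Longrightarrow> \<not> inj_on (\<theta> U) (Zvec n) \<Longrightarrow> \<exists>C'. \<forall>r. card (wball ?Q ?S r) \<le> C' * (r + 1) ^ (n - 1)"
    by metis
  have growth: "card (wball ?Q ?S r) \<le> card (wball ?Q ?S C) * (2 * s + 1) ^ n * (r + 1) ^ n" for r
    using cover \<U>_ne unfolding \<U>_def by blast
  show False
  proof (rule \<pi>.H.no_large_lattice_families[OF n3 Q(4,2) _ big, where P = ?P and h = ?h and \<theta> = \<theta> and \<Lambda> = \<Lambda>])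
    show "infinite \<Lambda>" using inf unfolding \<Lambda>_def .
    show "lattice_kernel ?Q (?P U) (?h U) ?S n (\<theta> U) (?\<pi> a) (?\<pi> b) D l" if "l \<in> \<Lambda>" "U \<in> Cls l" for l U
    proof -
      have "fst U = l" using pair_Cls[OF that(2)] by (metis fst_conv)
      then show ?thesis using \<theta>(1)[of U] that unfolding \<U>_def by blast
    qed
    show "\<exists>C'. \<forall>r. card (wball ?Q ?S r) \<le> C' * (r + 1) ^ (n - 1)"
      if "l \<in> \<Lambda>" "U \<in> Cls l" "\<not> inj_on (\<theta> U) (Zvec n)" for l U
      using \<theta>(2)[of U] that unfolding \<U>_def by blast
    show "card (wball ?Q ?S r) \<le> card (wball ?Q ?S C) * (2 * s + 1) ^ n * (r + 1) ^ n" for r by (rule growth)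
    show "inj_on (\<lambda>U. kernel ?Q (?P U) (?h U)) (Cls l)" if l: "l \<in> \<Lambda>" for l
    proof (rule inj_onI)
      fix U V assume UV: "U \<in> Cls l" "V \<in> Cls l"
        and eq: "kernel ?Q (?P U) (?h U) = kernel ?Q (?P V) (?h V)"
      \<comment> \<open>A target is the preimage of its kernel in \<open>?Q\<close>; kernels
        therefore determine targets, and these determine the perturbations.\<close>
      have mem: "x \<in> tgt W \<longleftrightarrow> x \<in> carrier H \<and> ?\<pi> x \<in> kernel ?Q (?P W) (?h W)" if W: "W \<in> \<U>" for W x
      proof (cases "x \<in> carrier H")
        case True
        have sub: "subgroup (tgt W) H" using tgt(2)[OF W] by (rule normal_imp_subgroup)
        have "?\<pi> x \<in> kernel ?Q (?P W) (?h W) \<longleftrightarrow> tgt W #>\<^bsub>H\<^esub> x = tgt W"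
          using True quotient_projection(2)[OF N0 tgt(2)[OF W] N0_sub[OF W] True]
          by (simp add: kernel_def one_FactGroup)
        also have "\<dots> \<longleftrightarrow> x \<in> tgt W"
          using H.coset_join2[OF True sub] H.rcos_self[OF True sub] by auto
        finally show ?thesis using True by blast
      next
        case False
        moreover have "tgt W \<subseteq> carrier H" by (rule subgroup.subset[OF normal_imp_subgroup[OF tgt(2)[OF W]]])
        ultimately show ?thesis by blast
      qed
      have \<U>: "U \<in> \<U>" "V \<in> \<U>" using UV l unfolding \<U>_def by auto
      have "x \<in> tgt U \<longleftrightarrow> x \<in> tgt V" for x
        unfolding mem[OF \<U>(1), of x] mem[OF \<U>(2), of x] eq ..
      then have "tgt U = tgt V" by blast
      moreover obtain E E' where E: "U = (l, E)" "V = (l, E')" using pair_Cls UV by blast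
      ultimately have "E = E'"
        using target_inj[OF Cls(1,3,4)[OF l UV(1)[unfolded E(1)]] Cls(1,3)[OF l UV(2)[unfolded E(2)]]
          Cls(2)[OF l UV(1)[unfolded E(1)]]]
        by (simp add: tgt_def)
      then show "U = V" using E by simp
    qed
  qed
qed

theorem theorem1p4:
  fixes n :: nat and H :: "('a, 'b) monoid_scheme" and a b :: 'a
    and S :: "'a set" and T :: "(nat \<Rightarrow> int) set"
  assumes "n \<ge> 3"
    and "group H"
    and "a \<in> carrier H" and "b \<in> carrier H" and "generate H {a, b} = carrier H"
    and "finite_generating_set H S"
    and "finite_generating_set (int_power_group n) T"
  shows "\<not> coarsely_equivalent (full_box_space H S) (full_box_space (int_power_group n) T)"
proof
  assume "coarsely_equivalent (full_box_space H S) (full_box_space (int_power_group n) T)"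
  \<comment> \<open>The equivalence is reversed because the explicit quotients of
    \<open>int_power_group n\<close> have to be followed into the unknown ones of
    \<open>H\<close>.\<close>
  then obtain F where ce: "coarse_equivalence (full_box_space (int_power_group n) T) (full_box_space H S) F"
    using coarsely_equivalent_sym unfolding coarsely_equivalent_def by blast
  note Z = group_int_power_group[of n] assms(7)
  note sp = mspace_full_box_space[OF assms(2,6)] mspace_full_box_space[OF Z]
  note ds = mdist_full_box_space[OF assms(2,6)] mdist_full_box_space[OF Z]
  obtain C \<rho> \<sigma> where c:
    "\<And>q. q \<in> box_points H \<Longrightarrow> \<exists>p\<in>box_points (int_power_group n). mdist (full_box_space H S) q (F p) \<le> real C"
    "\<And>p. p \<in> box_points (int_power_group n) \<Longrightarrow> F p \<in> box_points H"
    "\<And>r p q. p \<in> box_points (int_power_group n) \<Longrightarrow> q \<in> box_points (int_power_group n) \<Longrightarrow>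
      mdist (full_box_space (int_power_group n) T) p q \<le> real r \<Longrightarrow>
      mdist (full_box_space H S) (F p) (F q) \<le> real (\<rho> r)"
    "\<And>r p q. p \<in> box_points (int_power_group n) \<Longrightarrow> q \<in> box_points (int_power_group n) \<Longrightarrow>
      mdist (full_box_space H S) (F p) (F q) \<le> real r \<Longrightarrow>
      mdist (full_box_space (int_power_group n) T) p q \<le> real (\<sigma> r)"
    using coarse_equivalence_control[OF ce, unfolded sp] by blast
  obtain \<tau> where \<tau>: "\<And>i. i < n \<Longrightarrow> Zemb n (unit_vec i) \<in> wball (int_power_group n) T \<tau>"
    using unit_vec_word_length[OF assms(7)] by blast
  obtain t where t: "\<And>r g. g \<in> wball (int_power_group n) T r \<Longrightarrow> \<exists>x\<in>Zbox n (t * r). g = Zemb n x"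
    using wball_int_power_group_Zbox[OF assms(7)] by blast
  have "box_map H S n T F C \<rho> \<sigma> \<tau> t"
  proof (rule box_map.intro)
    show "\<exists>p\<in>box_points (int_power_group n). box_dist H S q (F p) \<le> real C" if "q \<in> box_points H" for q
      using c(1)[OF that] c(2) ds(1)[OF that] by metis
    show "box_dist H S (F p) (F q) \<le> real (\<rho> r)"
      if "p \<in> box_points (int_power_group n)" "q \<in> box_points (int_power_group n)"
        "box_dist (int_power_group n) T p q \<le> real r" for p q r
      using c(3)[OF that(1,2), of r] that(3) ds(1)[OF c(2)[OF that(1)] c(2)[OF that(2)]] ds(2)[OF that(1,2)] by simp
    show "box_dist (int_power_group n) T p q \<le> real (\<sigma> r)"
      if "p \<in> box_points (int_power_group n)" "q \<in> box_points (int_power_group n)"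
        "box_dist H S (F p) (F q) \<le> real r" for p q r
      using c(4)[OF that(1,2), of r] that(3) ds(1)[OF c(2)[OF that(1)] c(2)[OF that(2)]] ds(2)[OF that(1,2)] by simp
  qed (use assms c(2) \<tau> t in auto)
  then show False by (rule box_map.no_box_map_of_two_generated[OF _ assms(1,3-5)])
qed

end
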